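(* The uniform Roe algebra $C^*_u|\mathbb{Z}^2|$ of $\mathbb{Z}^2$ does not have real rank zero.
   Context: $\mathbb{Z}^2$ is equipped with any left-invariant bounded geometry metric (for instance a word metric; the choice does not affect the algebra). $C^*_u|\mathbb{Z}^2|$ is the operator norm closure in $\mathcal{B}(\ell^2(\mathbb{Z}^2))$ of the $*$-algebra of $\mathbb{Z}^2$-by-$\mathbb{Z}^2$ complex matrices $(a_{xy})$ with uniformly bounded entries and finite propagation $\sup\{d(x,y)\mid a_{xy}\ne 0\}<\infty$. A unital $C^*$-algebra $A$ has real rank zero if the invertible self-adjoint elements are dense in the set of self-adjoint elements of $A$. *)

theory Defs
  imports "HOL-Analysis.Analysis"
begin

section \<open>The Hilbert space of square-summable functions\<close>

typedef 'a ell2 = "{f :: 'a \<Rightarrow> complex. (\<lambda>x. (cmod (f x))\<^sup>2) summable_on UNIV}"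
  morphisms ell2_apply Abs_ell2
  by (rule exI[of _ "\<lambda>_. 0"]) simp

setup_lifting type_definition_ell2

lemma ell2_summable: "(\<lambda>x. (cmod (ell2_apply f x))\<^sup>2) summable_on UNIV"
  using ell2_apply[of f] by simp

lemma ell2_eqI: "(\<And>x. ell2_apply f x = ell2_apply g x) \<Longrightarrow> f = g"
  by (metis ell2_apply_inject ext)

lemma square_summable_add:
  fixes f g :: "'a \<Rightarrow> complex"
  assumes "(\<lambda>x. (cmod (f x))\<^sup>2) summable_on UNIV" "(\<lambda>x. (cmod (g x))\<^sup>2) summable_on UNIV"
  shows "(\<lambda>x. (cmod (f x + g x))\<^sup>2) summable_on UNIV"
proof (rule summable_on_comparison_test)
  show "(\<lambda>x. 2 * (cmod (f x))\<^sup>2 + 2 * (cmod (g x))\<^sup>2) summable_on UNIV"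
    by (intro summable_on_add summable_on_cmult_right assms)
  fix x
  have "(cmod (f x + g x))\<^sup>2 \<le> (cmod (f x) + cmod (g x))\<^sup>2"
    by (intro power_mono norm_triangle_ineq) simp
  also have "\<dots> \<le> 2 * (cmod (f x))\<^sup>2 + 2 * (cmod (g x))\<^sup>2"
    using sum_squares_bound[of "cmod (f x)" "cmod (g x)"] by (simp add: power2_sum)
  finally show "(cmod (f x + g x))\<^sup>2 \<le> 2 * (cmod (f x))\<^sup>2 + 2 * (cmod (g x))\<^sup>2" .
qed auto

lemma square_summable_scale:
  fixes f :: "'a \<Rightarrow> complex"
  assumes "(\<lambda>x. (cmod (f x))\<^sup>2) summable_on UNIV"
  shows "(\<lambda>x. (cmod (c * f x))\<^sup>2) summable_on UNIV"
  unfolding norm_mult power_mult_distrib by (intro summable_on_cmult_right assms)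

text \<open>The inner product is conjugate-linear in the first argument.\<close>

definition cinner_ell2 :: "'a ell2 \<Rightarrow> 'a ell2 \<Rightarrow> complex" where
  "cinner_ell2 f g = (\<Sum>\<^sub>\<infinity>x. cnj (ell2_apply f x) * ell2_apply g x)"

lemma cinner_ell2_summable:
  "(\<lambda>x. cnj (ell2_apply f x) * ell2_apply g x) summable_on UNIV"
proof (rule abs_summable_summable, rule summable_on_comparison_test)
  show "(\<lambda>x. (cmod (ell2_apply f x))\<^sup>2 + (cmod (ell2_apply g x))\<^sup>2) summable_on UNIV"
    by (intro summable_on_add ell2_summable)
  fix x
  have "cmod (ell2_apply f x) * cmod (ell2_apply g x)
      \<le> 2 * cmod (ell2_apply f x) * cmod (ell2_apply g x)" by simp
  also have "\<dots> \<le> (cmod (ell2_apply f x))\<^sup>2 + (cmod (ell2_apply g x))\<^sup>2"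
    by (rule sum_squares_bound)
  finally show "norm (cnj (ell2_apply f x) * ell2_apply g x)
      \<le> (cmod (ell2_apply f x))\<^sup>2 + (cmod (ell2_apply g x))\<^sup>2"
    by (simp add: norm_mult)
qed auto

text \<open>The real structure underlying the complex Hilbert space; its norm is the usual norm
  \<open>sqrt (\<Sum>x. \<bar>f x\<bar>\<^sup>2)\<close>, see \<open>norm_ell2\<close> below.\<close>

instantiation ell2 :: (type) real_inner
begin

lift_definition zero_ell2 :: "'a ell2" is "\<lambda>_. 0" by simp

lift_definition plus_ell2 :: "'a ell2 \<Rightarrow> 'a ell2 \<Rightarrow> 'a ell2" is "\<lambda>f g x. f x + g x"
  by (rule square_summable_add)

lift_definition uminus_ell2 :: "'a ell2 \<Rightarrow> 'a ell2" is "\<lambda>f x. - f x" by simp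

definition minus_ell2 :: "'a ell2 \<Rightarrow> 'a ell2 \<Rightarrow> 'a ell2" where "f - g = f + - g" for f g :: "'a ell2"

lift_definition scaleR_ell2 :: "real \<Rightarrow> 'a ell2 \<Rightarrow> 'a ell2" is "\<lambda>r f x. complex_of_real r * f x"
  by (rule square_summable_scale)

definition inner_ell2 :: "'a ell2 \<Rightarrow> 'a ell2 \<Rightarrow> real" where
  "inner_ell2 f g = Re (cinner_ell2 f g)"

definition norm_ell2 :: "'a ell2 \<Rightarrow> real" where "norm_ell2 f = sqrt (inner f f)"

definition dist_ell2 :: "'a ell2 \<Rightarrow> 'a ell2 \<Rightarrow> real" where "dist_ell2 f g = norm (f - g)"

definition sgn_ell2 :: "'a ell2 \<Rightarrow> 'a ell2" where "sgn_ell2 f = inverse (norm f) *\<^sub>R f"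

definition uniformity_ell2 :: "('a ell2 \<times> 'a ell2) filter" where
  "uniformity_ell2 = (INF e\<in>{0<..}. principal {(f, g). dist f g < e})"

definition open_ell2 :: "'a ell2 set \<Rightarrow> bool" where
  "open_ell2 U = (\<forall>f\<in>U. \<forall>\<^sub>F (f', g) in uniformity. f' = f \<longrightarrow> g \<in> U)"

lemma inner_ell2_self: "inner f f = (\<Sum>\<^sub>\<infinity>x. (cmod (ell2_apply f x))\<^sup>2)" for f :: "'a ell2"
proof -
  have eq: "cnj z * z = of_real ((cmod z)\<^sup>2)" for z
    by (metis complex_norm_square mult.commute of_real_power)
  have "cinner_ell2 f f = (\<Sum>\<^sub>\<infinity>x. of_real ((cmod (ell2_apply f x))\<^sup>2))"
    unfolding cinner_ell2_def by (simp only: eq)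
  also have "\<dots> = of_real (\<Sum>\<^sub>\<infinity>x. (cmod (ell2_apply f x))\<^sup>2)"
    by (intro infsumI has_sum_bounded_linear[OF bounded_linear_of_real] has_sum_infsum ell2_summable)
  finally show ?thesis unfolding inner_ell2_def by simp
qed

instance
proof
  fix f g h :: "'a ell2" and r s :: real
  show "f + g + h = f + (g + h)" by transfer (simp add: add.assoc)
  show "f + g = g + f" by transfer (simp add: add.commute)
  show "0 + f = f" by transfer simp
  show "- f + f = 0" by transfer simp
  show "f - g = f + - g" by (rule minus_ell2_def)
  show "r *\<^sub>R (f + g) = r *\<^sub>R f + r *\<^sub>R g" by transfer (simp add: algebra_simps)
  show "(r + s) *\<^sub>R f = r *\<^sub>R f + s *\<^sub>R f" by transfer (simp add: algebra_simps)
  show "r *\<^sub>R s *\<^sub>R f = (r * s) *\<^sub>R f" by transfer (simp add: algebra_simps)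
  show "1 *\<^sub>R f = f" by transfer simp
  show "dist f g = norm (f - g)" by (rule dist_ell2_def)
  show "sgn f = inverse (norm f) *\<^sub>R f" by (rule sgn_ell2_def)
  show "uniformity = (INF e\<in>{0<..}. principal {(f :: 'a ell2, g). dist f g < e})"
    by (rule uniformity_ell2_def)
  show "open U = (\<forall>f\<in>U. \<forall>\<^sub>F (f', g) in uniformity. f' = f \<longrightarrow> g \<in> U)" for U :: "'a ell2 set"
    by (rule open_ell2_def)
  show "norm f = sqrt (inner f f)" by (rule norm_ell2_def)
  show "inner f g = inner g f"
  proof -
    have "cinner_ell2 f g = cnj (cinner_ell2 g f)"
      unfolding cinner_ell2_def infsum_cnj[symmetric] by (simp add: mult.commute)
    thus ?thesis by (simp add: inner_ell2_def)
  qed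
  show "inner (f + g) h = inner f h + inner g h"
    unfolding inner_ell2_def cinner_ell2_def plus_ell2.rep_eq
    by (simp add: ring_distribs infsum_add cinner_ell2_summable)
  show "inner (r *\<^sub>R f) g = r * inner f g"
    unfolding inner_ell2_def cinner_ell2_def scaleR_ell2.rep_eq
    by (simp add: mult.assoc infsum_cmult_right')
  show "0 \<le> inner f f"
    unfolding inner_ell2_self by (rule infsum_nonneg) simp
  show "inner f f = 0 \<longleftrightarrow> f = 0"
  proof
    assume "inner f f = 0"
    hence "(cmod (ell2_apply f x))\<^sup>2 = 0" for x
      unfolding inner_ell2_self
      using nonneg_infsum_le_0D[OF eq_refl ell2_summable[of f], of x] by simp
    thus "f = 0" by (intro ell2_eqI) (simp add: zero_ell2.rep_eq)
  qed (simp add: inner_ell2_self zero_ell2.rep_eq)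
qed

end

lemma norm_ell2: "norm f = sqrt (\<Sum>\<^sub>\<infinity>x. (cmod (ell2_apply f x))\<^sup>2)"
  by (simp add: norm_ell2_def inner_ell2_self)

section \<open>Uniform Roe algebras\<close>

definition bounded_geometry :: "('a \<Rightarrow> 'a \<Rightarrow> real) \<Rightarrow> bool" where
  "bounded_geometry d \<longleftrightarrow> (\<forall>r. \<exists>N. \<forall>x. finite {y. d x y \<le> r} \<and> card {y. d x y \<le> r} \<le> N)"

definition left_invariant :: "('a::group_add \<Rightarrow> 'a \<Rightarrow> real) \<Rightarrow> bool" where
  "left_invariant d \<longleftrightarrow> (\<forall>z x y. d (z + x) (z + y) = d x y)"

definition uniformly_bounded_entries :: "('a \<Rightarrow> 'a \<Rightarrow> complex) \<Rightarrow> bool" where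
  "uniformly_bounded_entries a \<longleftrightarrow> bounded {a x y | x y. True}"

definition finite_propagation :: "('a \<Rightarrow> 'a \<Rightarrow> real) \<Rightarrow> ('a \<Rightarrow> 'a \<Rightarrow> complex) \<Rightarrow> bool" where
  "finite_propagation d a \<longleftrightarrow> bdd_above {d x y | x y. a x y \<noteq> 0}"

text \<open>The bounded operator \<open>T\<close> is multiplication by the matrix \<open>a\<close>.  For a matrix of finite
  propagation over a space of bounded geometry the sums have finite support.\<close>

definition has_matrix :: "('a ell2 \<Rightarrow>\<^sub>L 'a ell2) \<Rightarrow> ('a \<Rightarrow> 'a \<Rightarrow> complex) \<Rightarrow> bool" where
  "has_matrix T a \<longleftrightarrow>
     (\<forall>f x. ell2_apply (blinfun_apply T f) x = (\<Sum>\<^sub>\<infinity>y. a x y * ell2_apply f y))"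

definition algebraic_uniform_roe :: "('a \<Rightarrow> 'a \<Rightarrow> real) \<Rightarrow> ('a ell2 \<Rightarrow>\<^sub>L 'a ell2) set" where
  "algebraic_uniform_roe d =
     {T. \<exists>a. uniformly_bounded_entries a \<and> finite_propagation d a \<and> has_matrix T a}"

text \<open>The type \<open>'a ell2 \<Rightarrow>\<^sub>L 'a ell2\<close> consists of the bounded \<^emph>\<open>real\<close>-linear operators, normed by
  the operator norm.  Operators given by a matrix are complex-linear, and hence so are their norm
  limits, so the closure below is the closure in the algebra of bounded complex-linear operators.\<close>

definition uniform_roe :: "('a \<Rightarrow> 'a \<Rightarrow> real) \<Rightarrow> ('a ell2 \<Rightarrow>\<^sub>L 'a ell2) set" where
  "uniform_roe d = closure (algebraic_uniform_roe d)"

text \<open>Every matrix with bounded entries and finite propagation defines a bounded operator, so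
  \<open>algebraic_uniform_roe d\<close> really is the algebra of all such matrices.\<close>

lemma has_matrix_exists:
  assumes met: "Metric_space UNIV d" and geo: "bounded_geometry d"
    and bdd: "uniformly_bounded_entries a" and fpr: "finite_propagation d a"
  shows "\<exists>T. has_matrix T a"
proof -
  obtain C where C: "cmod (a x y) \<le> C" for x y
    using bdd unfolding uniformly_bounded_entries_def bounded_iff by blast
  have C0: "0 \<le> C" using C norm_ge_zero order_trans by blast
  obtain r where r: "a x y \<noteq> 0 \<Longrightarrow> d x y \<le> r" for x y
    using fpr unfolding finite_propagation_def bdd_above_def by blast
  define B where "B x = {y. d x y \<le> r}" for x
  obtain N where fin: "finite (B x)" and N: "card (B x) \<le> N" for x
    using geo unfolding bounded_geometry_def B_def by metis
  have sym: "y \<in> B x \<longleftrightarrow> x \<in> B y" for x y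
    using Metric_space.commute[OF met] by (simp add: B_def)
  define M where "M f x = (\<Sum>y\<in>B x. a x y * f y)" for f :: "'a \<Rightarrow> complex" and x
  have M: "(\<Sum>\<^sub>\<infinity>y. a x y * f y) = M f x" for f x
  proof -
    have "(\<Sum>\<^sub>\<infinity>y. a x y * f y) = (\<Sum>\<^sub>\<infinity>y\<in>B x. a x y * f y)"
      by (rule infsum_cong_neutral) (use r B_def in auto)
    thus ?thesis by (simp add: M_def fin)
  qed
  define K where "K = real N * C\<^sup>2 * real N"
  have K0: "0 \<le> K" by (simp add: K_def)
  have row: "(cmod (M f x))\<^sup>2 \<le> real N * C\<^sup>2 * (\<Sum>y\<in>B x. (cmod (f y))\<^sup>2)" for f x
  proof -
    have "cmod (M f x) \<le> (\<Sum>y\<in>B x. C * cmod (f y))"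
      unfolding M_def by (intro sum_norm_le) (simp add: norm_mult mult_right_mono C)
    hence "(cmod (M f x))\<^sup>2 \<le> (\<Sum>y\<in>B x. C * cmod (f y))\<^sup>2"
      by (intro power_mono) auto
    also have "\<dots> \<le> (\<Sum>y\<in>B x. (C * cmod (f y))\<^sup>2) * card (B x)"
      by (rule sum_squared_le_sum_of_squares)
    also have "\<dots> \<le> (\<Sum>y\<in>B x. (C * cmod (f y))\<^sup>2) * N"
      by (intro mult_left_mono sum_nonneg) (auto simp: N)
    finally show ?thesis by (simp add: power_mult_distrib sum_distrib_left mult_ac)
  qed
  have col: "(\<Sum>x\<in>F. (cmod (M f x))\<^sup>2) \<le> K * (\<Sum>\<^sub>\<infinity>y. (cmod (f y))\<^sup>2)"
    if F: "finite F" and f: "(\<lambda>y. (cmod (f y))\<^sup>2) summable_on UNIV" for F f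
  proof -
    define Y where "Y = (\<Union>x\<in>F. B x)"
    have Y: "finite Y" using F fin by (simp add: Y_def)
    have "(\<Sum>x\<in>F. (cmod (M f x))\<^sup>2) \<le> real N * C\<^sup>2 * (\<Sum>x\<in>F. \<Sum>y\<in>B x. (cmod (f y))\<^sup>2)"
      unfolding sum_distrib_left[of "real N * C\<^sup>2" _ F] by (intro sum_mono row)
    also have "(\<Sum>x\<in>F. \<Sum>y\<in>B x. (cmod (f y))\<^sup>2) = (\<Sum>x\<in>F. \<Sum>y\<in>{y\<in>Y. y \<in> B x}. (cmod (f y))\<^sup>2)"
      by (intro sum.cong) (auto simp: Y_def)
    also have "\<dots> = (\<Sum>y\<in>Y. \<Sum>x\<in>{x\<in>F. y \<in> B x}. (cmod (f y))\<^sup>2)"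
      by (rule sum.swap_restrict[OF F Y])
    also have "\<dots> \<le> (\<Sum>y\<in>Y. real N * (cmod (f y))\<^sup>2)"
    proof (intro sum_mono)
      fix y
      have "card {x\<in>F. y \<in> B x} \<le> card (B y)"
        by (intro card_mono fin) (auto simp: sym)
      hence "card {x\<in>F. y \<in> B x} \<le> N" using N le_trans by blast
      thus "(\<Sum>x\<in>{x\<in>F. y \<in> B x}. (cmod (f y))\<^sup>2) \<le> real N * (cmod (f y))\<^sup>2"
        by (simp add: mult_right_mono)
    qed
    also have "\<dots> \<le> real N * (\<Sum>\<^sub>\<infinity>y. (cmod (f y))\<^sup>2)"
      unfolding sum_distrib_left[symmetric]
      by (intro mult_left_mono finite_sum_le_infsum f Y) auto
    finally show ?thesis by (simp add: K_def mult_left_mono mult.assoc)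
  qed
  have sum_M: "(\<lambda>x. (cmod (M f x))\<^sup>2) summable_on UNIV"
    if "(\<lambda>y. (cmod (f y))\<^sup>2) summable_on UNIV" for f
    by (rule nonneg_bdd_above_summable_on) (auto intro!: bdd_aboveI2 col that)
  define L where "L f = Abs_ell2 (M (ell2_apply f))" for f
  have L: "ell2_apply (L f) = M (ell2_apply f)" for f
    unfolding L_def by (rule Abs_ell2_inverse) (simp add: sum_M ell2_summable)
  have "bounded_linear L"
  proof (rule bounded_linear_intro)
    show "L (f + g) = L f + L g" for f g
      by (rule ell2_eqI) (simp add: L plus_ell2.rep_eq M_def ring_distribs sum.distrib)
    show "L (c *\<^sub>R f) = c *\<^sub>R L f" for c f
      by (rule ell2_eqI) (simp add: L scaleR_ell2.rep_eq M_def sum_distrib_left mult_ac)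
    fix f
    have "(\<Sum>\<^sub>\<infinity>x. (cmod (M (ell2_apply f) x))\<^sup>2) \<le> K * (\<Sum>\<^sub>\<infinity>y. (cmod (ell2_apply f y))\<^sup>2)"
      by (intro infsum_le_finite_sums sum_M ell2_summable col)
    thus "norm (L f) \<le> norm f * sqrt K"
      by (simp add: norm_ell2 L real_sqrt_mult[symmetric] mult.commute)
  qed
  thus ?thesis
    by (intro exI[of _ "Blinfun L"]) (simp add: has_matrix_def bounded_linear_Blinfun_apply L M)
qed

section \<open>Real rank zero\<close>

definition selfadjoint :: "('a ell2 \<Rightarrow>\<^sub>L 'a ell2) \<Rightarrow> bool" where
  "selfadjoint T \<longleftrightarrow>
     (\<forall>f g. cinner_ell2 (blinfun_apply T f) g = cinner_ell2 f (blinfun_apply T g))"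

definition invertible_in :: "('a ell2 \<Rightarrow>\<^sub>L 'a ell2) set \<Rightarrow> ('a ell2 \<Rightarrow>\<^sub>L 'a ell2) \<Rightarrow> bool" where
  "invertible_in A T \<longleftrightarrow>
     (\<exists>S\<in>A. T o\<^sub>L S = id_blinfun \<and> S o\<^sub>L T = id_blinfun)"

text \<open>\<open>A\<close> is meant to be a norm-closed star-algebra of operators containing the identity operator.\<close>

definition real_rank_zero :: "('a ell2 \<Rightarrow>\<^sub>L 'a ell2) set \<Rightarrow> bool" where
  "real_rank_zero A \<longleftrightarrow>
     {T \<in> A. selfadjoint T} \<subseteq> closure {T \<in> A. selfadjoint T \<and> invertible_in A T}"

end

theory Submission
  imports Defs "Jordan_Normal_Form.Determinant"
begin

text \<open>
  The proof replaces K-theory by signs of determinants.  For a Hermitian matrix \<open>T\<close> and a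
  slowly varying diagonal matrix \<open>W\<close> that marks the position in the plane, the spectral
  localizer \<open>[[T, W\<^sup>*], [W, - T]]\<close> is invertible as soon as \<open>T\<close> has a gap at 0.  Then
  \<open>T\<close> and \<open>W\<close> can be deformed linearly to 0 and 1, so the determinant of the
  localizer has the sign of the trivial one.

  On disjoint squares of growing size \<open>N\<close>, place the Hamiltonian
  \<open>\<tau>\<^sub>1 Y\<^sub>1 + \<tau>\<^sub>2 Y\<^sub>2 + \<tau>\<^sub>3 (Z\<^sub>1 + Z\<^sub>2 - 1)\<close>, where \<open>X, Y, Z\<close> is the rescaled
  representation of spin \<open>N/2\<close> in which \<open>X\<close> is diagonal (the position), and take the
  identity elsewhere.  The localizer of this operator is invertible with a uniform bound, but
  its determinant has the opposite sign: scaling \<open>X, Y, Z\<close> by \<open>\<kappa>\<close> from 1 to 0 leads to a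
  trivial localizer, and up to a small correction exactly one eigenvalue, \<open>2 \<kappa> - 1\<close>, crosses 0.

  Real rank zero would give a gapped self-adjoint operator of finite propagation close to this
  one.  On a large square, its localizer would have both signs.
\<close>

text \<open>Classically X, Y, Z are the coordinates of a sphere, and the squared localizer is the
  function \<open>\<kappa>\<^sup>2 (X\<^sub>1\<^sup>2 + Y\<^sub>1\<^sup>2 + X\<^sub>2\<^sup>2 +
  Y\<^sub>2\<^sup>2) + (\<kappa> (Z\<^sub>1 + Z\<^sub>2) - 1)\<^sup>2\<close> on a product of two
  spheres. At \<kappa> = 1 it equals \<open>1 + 2 (1 - Z\<^sub>1) (1 - Z\<^sub>2)\<close>, hence is
  at least 1. For \<kappa> in [0, 1] it vanishes only at \<kappa> = 1/2, at the single point where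
  both Z are 1; the coherent state at this point carries the crossing eigenvalue. The obstacle is
  that real rank zero controls neither the gap nor the propagation of the approximating operator,
  and both are known only after the given operator is fixed. The localizer argument needs the
  commutator with the position, of order propagation over \<open>N\<close>, to be smaller than the
  square of the gap. Hence one operator has to contain squares of all sizes.\<close>

hide_const (open) Finite_Cartesian_Product.mat Finite_Cartesian_Product.vec Determinants.det
unbundle no vec_syntax

section \<open>Signs of determinants of Hermitian matrices\<close>

text \<open>\<open>mat\<close> is indexed by numbers, whereas index sets such as
  \<open>S \<times> UNIV\<close> carry no canonical order. Rows and columns share one arbitrary
  enumeration, so the determinant is independent of it.\<close>

definition enum_of :: "'a set \<Rightarrow> nat \<Rightarrow> 'a" where
  "enum_of I = (SOME e. bij_betw e {0..<card I} I)"

definition jmat :: "'a set \<Rightarrow> ('a \<Rightarrow> 'a \<Rightarrow> complex) \<Rightarrow> complex mat" where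
  "jmat I M = mat (card I) (card I) (\<lambda>(i, j). M (enum_of I i) (enum_of I j))"

definition fdet :: "'a set \<Rightarrow> ('a \<Rightarrow> 'a \<Rightarrow> complex) \<Rightarrow> complex" where
  "fdet I M = det (jmat I M)"

text \<open>Meant for Hermitian \<open>M\<close>, where the determinant is real by
  \<open>fdet_real\<close> and \<open>Re\<close> loses nothing.\<close>

definition fsgn :: "'a set \<Rightarrow> ('a \<Rightarrow> 'a \<Rightarrow> complex) \<Rightarrow> real" where
  "fsgn I M = sgn (Re (fdet I M))"

definition mv :: "'a set \<Rightarrow> ('a \<Rightarrow> 'a \<Rightarrow> complex) \<Rightarrow> ('a \<Rightarrow> complex) \<Rightarrow> 'a \<Rightarrow> complex" where
  "mv I M f i = (\<Sum>j\<in>I. M i j * f j)"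

definition hermitian_on :: "'a set \<Rightarrow> ('a \<Rightarrow> 'a \<Rightarrow> complex) \<Rightarrow> bool" where
  "hermitian_on I M \<longleftrightarrow> (\<forall>i\<in>I. \<forall>j\<in>I. M j i = cnj (M i j))"

definition injective_on :: "'a set \<Rightarrow> ('a \<Rightarrow> 'a \<Rightarrow> complex) \<Rightarrow> bool" where
  "injective_on I M \<longleftrightarrow> (\<forall>f. (\<forall>i\<in>I. mv I M f i = 0) \<longrightarrow> (\<forall>i\<in>I. f i = 0))"

lemma hermitian_onD: "hermitian_on I M \<Longrightarrow> i \<in> I \<Longrightarrow> j \<in> I \<Longrightarrow> cnj (M i j) = M j i"
  by (metis hermitian_on_def)

lemma hermitian_onI: "(\<And>i j. i \<in> I \<Longrightarrow> j \<in> I \<Longrightarrow> cnj (M i j) = M j i) \<Longrightarrow> hermitian_on I M"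
  by (simp add: hermitian_on_def)

lemma enum_of_bij: "finite I \<Longrightarrow> bij_betw (enum_of I) {0..<card I} I"
  unfolding enum_of_def by (rule someI_ex[OF ex_bij_betw_nat_finite])

lemma jmat_carrier [simp]: "jmat I M \<in> carrier_mat (card I) (card I)"
  by (simp add: jmat_def)

lemma jmat_mult_vec:
  assumes "finite I" "i < card I"
  shows "(jmat I M *\<^sub>v vec (card I) (\<lambda>i. f (enum_of I i))) $ i = mv I M f (enum_of I i)"
proof -
  have "(jmat I M *\<^sub>v vec (card I) (\<lambda>i. f (enum_of I i))) $ i
      = (\<Sum>j = 0..<card I. M (enum_of I i) (enum_of I j) * f (enum_of I j))"
    using assms(2) by (simp add: jmat_def scalar_prod_def)
  also have "\<dots> = mv I M f (enum_of I i)"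
    unfolding mv_def by (rule sum.reindex_bij_betw[OF enum_of_bij[OF assms(1)]])
  finally show ?thesis .
qed

lemma fdet_nonzero:
  assumes I: "finite I" and inj: "injective_on I M"
  shows "fdet I M \<noteq> 0"
proof
  assume "fdet I M = 0"
  then obtain v where v: "v \<in> carrier_vec (card I)" "v \<noteq> 0\<^sub>v (card I)"
      and z: "jmat I M *\<^sub>v v = 0\<^sub>v (card I)"
    unfolding fdet_def using det_0_iff_vec_prod_zero[OF jmat_carrier] by blast
  define f where "f = (\<lambda>x. v $ (the_inv_into {0..<card I} (enum_of I) x))"
  note bij = enum_of_bij[OF I]
  have fe: "f (enum_of I i) = v $ i" if "i < card I" for i
    using that bij by (simp add: f_def the_inv_into_f_f bij_betw_def)
  have v_eq: "v = vec (card I) (\<lambda>i. f (enum_of I i))"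
    using v(1) by (intro eq_vecI) (auto simp: fe)
  have "mv I M f x = 0" if x: "x \<in> I" for x
  proof -
    obtain i where i: "i < card I" "x = enum_of I i"
      using x bij unfolding bij_betw_def by force
    show ?thesis
      using jmat_mult_vec[OF I i(1), of M f] z i v_eq by simp
  qed
  hence "f x = 0" if "x \<in> I" for x using inj that unfolding injective_on_def by blast
  moreover have "enum_of I i \<in> I" if "i < card I" for i
    using that bij unfolding bij_betw_def by auto
  ultimately have "v $ i = 0" if "i < card I" for i using fe that by metis
  hence "v = 0\<^sub>v (card I)" using v(1) by (intro eq_vecI) auto
  with v(2) show False by simp
qed

lemma permutes_lessThan: "p permutes {0..<n} \<Longrightarrow> i < n \<Longrightarrow> p i < (n::nat)"
  using permutes_in_image[of p "{0..<n}" i] by simp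

lemma fdet_leibniz:
  "fdet I M = (\<Sum>p\<in>{p. p permutes {0..<card I}}.
     signof p * (\<Prod>i = 0..<card I. M (enum_of I i) (enum_of I (p i))))"
proof -
  have "fdet I M = (\<Sum>p\<in>{p. p permutes {0..<card I}}.
     signof p * (\<Prod>i = 0..<card I. jmat I M $$ (i, p i)))"
    unfolding fdet_def by (rule det_def'[OF jmat_carrier])
  also have "\<dots> = (\<Sum>p\<in>{p. p permutes {0..<card I}}.
     signof p * (\<Prod>i = 0..<card I. M (enum_of I i) (enum_of I (p i))))"
    by (intro sum.cong refl arg_cong2[where f = "(*)"] prod.cong)
      (auto simp: jmat_def permutes_lessThan)
  finally show ?thesis .
qed

lemma continuous_on_fdet:
  assumes "finite I" and "\<And>i j. i \<in> I \<Longrightarrow> j \<in> I \<Longrightarrow> continuous_on T (\<lambda>t. M t i j)"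
  shows "continuous_on T (\<lambda>t. fdet I (M t))"
proof -
  have e: "enum_of I i \<in> I" if "i < card I" for i
    using that enum_of_bij[OF assms(1)] unfolding bij_betw_def by auto
  show ?thesis unfolding fdet_leibniz
    by (intro continuous_intros assms(2) e) (auto simp: permutes_lessThan)
qed

lemma cnj_fdet:
  assumes I: "finite I" and h: "hermitian_on I M"
  shows "cnj (fdet I M) = fdet I M"
proof -
  have e: "enum_of I i \<in> I" if "i < card I" for i
    using that enum_of_bij[OF I] unfolding bij_betw_def by auto
  have "cnj (fdet I M) = fdet I (\<lambda>i j. cnj (M i j))"
    unfolding fdet_leibniz by (simp add: sign_def)
  also have "jmat I (\<lambda>i j. cnj (M i j)) = transpose_mat (jmat I M)"
    using e by (intro eq_matI) (auto simp: jmat_def hermitian_onD[OF h])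
  hence "fdet I (\<lambda>i j. cnj (M i j)) = fdet I M"
    unfolding fdet_def by (simp add: det_transpose[OF jmat_carrier])
  finally show ?thesis .
qed

lemma fdet_cong: "finite I \<Longrightarrow> (\<And>i j. i \<in> I \<Longrightarrow> j \<in> I \<Longrightarrow> M i j = M' i j) \<Longrightarrow> fdet I M = fdet I M'"
proof -
  assume I: "finite I" and M: "\<And>i j. i \<in> I \<Longrightarrow> j \<in> I \<Longrightarrow> M i j = M' i j"
  have e: "enum_of I i \<in> I" if "i < card I" for i
    using that enum_of_bij[OF I] unfolding bij_betw_def by auto
  have "jmat I M = jmat I M'" by (intro eq_matI) (auto simp: jmat_def M e)
  thus ?thesis by (simp add: fdet_def)
qed

lemma fdet_mult:
  assumes I: "finite I"
  shows "fdet I (\<lambda>i j. \<Sum>k\<in>I. A i k * B k j) = fdet I A * fdet I B"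
proof -
  have "jmat I (\<lambda>i j. \<Sum>k\<in>I. A i k * B k j) = jmat I A * jmat I B"
  proof (rule eq_matI)
    fix i j assume "i < dim_row (jmat I A * jmat I B)" "j < dim_col (jmat I A * jmat I B)"
    hence ij: "i < card I" "j < card I" by (auto simp: jmat_def)
    have "(jmat I A * jmat I B) $$ (i, j)
        = (\<Sum>k = 0..<card I. A (enum_of I i) (enum_of I k) * B (enum_of I k) (enum_of I j))"
      using ij by (simp add: jmat_def scalar_prod_def)
    also have "\<dots> = (\<Sum>k\<in>I. A (enum_of I i) k * B k (enum_of I j))"
      by (rule sum.reindex_bij_betw[OF enum_of_bij[OF I]])
    finally show "jmat I (\<lambda>i j. \<Sum>k\<in>I. A i k * B k j) $$ (i, j) = (jmat I A * jmat I B) $$ (i, j)"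
      using ij by (simp add: jmat_def)
  qed (auto simp: jmat_def)
  thus ?thesis unfolding fdet_def by (simp add: det_mult[OF jmat_carrier jmat_carrier])
qed

text \<open>The matrix determinant lemma. Both \<open>P * Q\<close> and \<open>Q * P\<close> are
  block triangular; the diagonal of the first exhibits \<open>1 + s\<close>, that of the second
  \<open>R\<close>, and the two products have the same determinant.\<close>

lemma det_one_plus_rank_one:
  fixes x y :: "nat \<Rightarrow> complex"
  shows "det (mat n n (\<lambda>(i, j). (if i = j then 1 else 0) + x i * y j)) = 1 + (\<Sum>i<n. x i * y i)"
proof -
  define R where "R = mat n n (\<lambda>(i, j). (if i = j then 1 else 0) + x i * y j)"
  define X where "X = mat n 1 (\<lambda>(i, j). x i)"
  define Y where "Y = mat 1 n (\<lambda>(i, j). y j)"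
  define s where "s = (\<Sum>i<n. x i * y i)"
  have X: "X \<in> carrier_mat n 1" and Y: "Y \<in> carrier_mat 1 n" and R: "R \<in> carrier_mat n n"
    by (auto simp: X_def Y_def R_def)
  define P where "P = four_block_mat (1\<^sub>m n) (- X) Y (1\<^sub>m 1)"
  define Q where "Q = four_block_mat (1\<^sub>m n) X (0\<^sub>m 1 n) (1\<^sub>m 1)"
  have P: "P \<in> carrier_mat (n + 1) (n + 1)" and Q: "Q \<in> carrier_mat (n + 1) (n + 1)"
    unfolding P_def Q_def by (auto intro!: four_block_carrier_mat)
  have YX: "Y * X = mat 1 1 (\<lambda>_. s)"
    by (intro eq_matI) (auto simp: X_def Y_def scalar_prod_def s_def mult.commute atLeast0LessThan)
  have XY: "1\<^sub>m n + X * Y = R"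
    by (intro eq_matI) (auto simp: X_def Y_def R_def scalar_prod_def)
  have Q1: "det Q = 1"
    unfolding Q_def by (subst det_four_block_mat_lower_left_zero[of _ n _ 1]) (use X in auto)
  have "P * Q = four_block_mat (1\<^sub>m n) (0\<^sub>m n 1) Y (Y * X + 1\<^sub>m 1)"
    unfolding P_def Q_def
    by (subst mult_four_block_mat[of _ n n _ 1 _ 1 _ _ n _ 1]) (use X Y in auto)
  hence "det P * det Q = det (four_block_mat (1\<^sub>m n) (0\<^sub>m n 1) Y (Y * X + 1\<^sub>m 1))"
    using det_mult[OF P Q] by simp
  also have "\<dots> = det (1\<^sub>m n) * det (Y * X + 1\<^sub>m 1)"
    by (rule det_four_block_mat_upper_right_zero) (use X Y in auto)
  also have "det (Y * X + 1\<^sub>m 1) = 1 + s"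
    unfolding YX by (subst det_single) auto
  finally have a: "det P = 1 + s" using Q1 by simp
  have "Q * P = four_block_mat R (0\<^sub>m n 1) Y (1\<^sub>m 1)"
    unfolding P_def Q_def
    by (subst mult_four_block_mat[of _ n n _ 1 _ 1 _ _ n _ 1]) (use X Y XY in auto)
  hence "det Q * det P = det (four_block_mat R (0\<^sub>m n 1) Y (1\<^sub>m 1))"
    using det_mult[OF Q P] by simp
  also have "\<dots> = det R * det (1\<^sub>m 1)"
    by (rule det_four_block_mat_upper_right_zero) (use R Y in auto)
  finally show ?thesis using a Q1 by (simp add: R_def s_def)
qed

lemma fdet_one_plus_rank_one:
  assumes I: "finite I"
  shows "fdet I (\<lambda>i j. (if i = j then 1 else 0) + x i * y j) = 1 + (\<Sum>i\<in>I. x i * y i)"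
proof -
  note bij = enum_of_bij[OF I]
  have "jmat I (\<lambda>i j. (if i = j then 1 else 0) + x i * y j)
      = mat (card I) (card I) (\<lambda>(i, j). (if i = j then 1 else 0) + x (enum_of I i) * y (enum_of I j))"
    using bij by (intro eq_matI) (auto simp: jmat_def bij_betw_def dest: inj_onD)
  hence "fdet I (\<lambda>i j. (if i = j then 1 else 0) + x i * y j)
      = 1 + (\<Sum>i<card I. x (enum_of I i) * y (enum_of I i))"
    unfolding fdet_def by (simp add: det_one_plus_rank_one)
  also have "(\<Sum>i<card I. x (enum_of I i) * y (enum_of I i)) = (\<Sum>i\<in>I. x i * y i)"
    unfolding atLeast0LessThan[symmetric] by (rule sum.reindex_bij_betw[OF bij])
  finally show ?thesis .
qed

section \<open>Behaviour of the sign along paths of Hermitian matrices\<close>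

lemma fdet_real:
  assumes "finite I" "hermitian_on I M"
  shows "fdet I M = of_real (Re (fdet I M))"
  using cnj_fdet[OF assms] by (metis Reals_cnj_iff of_real_Re)

lemma fsgn_nonzero:
  assumes "finite I" "hermitian_on I M" "injective_on I M"
  shows "fsgn I M \<noteq> 0"
  using fdet_real[OF assms(1,2)] fdet_nonzero[OF assms(1,3)]
  by (metis fsgn_def of_real_0 sgn_0_0)

text \<open>The determinant is a continuous real function without zeros along the path, so the
  intermediate value theorem fixes its sign.\<close>

lemma fsgn_path:
  fixes M :: "real \<Rightarrow> 'a \<Rightarrow> 'a \<Rightarrow> complex"
  assumes I: "finite I" and cont: "\<And>i j. i \<in> I \<Longrightarrow> j \<in> I \<Longrightarrow> continuous_on {0..1} (\<lambda>t. M t i j)"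
    and h: "\<And>t. t \<in> {0..1} \<Longrightarrow> hermitian_on I (M t)"
    and inj: "\<And>t. t \<in> {0..1} \<Longrightarrow> injective_on I (M t)"
  shows "fsgn I (M 0) = fsgn I (M 1)"
proof (rule ccontr)
  define f where "f t = Re (fdet I (M t))" for t
  have c: "continuous_on {0..1} f"
    unfolding f_def by (intro continuous_on_Re continuous_on_fdet I cont)
  have nz: "f t \<noteq> 0" if "t \<in> {0..1}" for t
    using fsgn_nonzero[OF I h[OF that] inj[OF that]] by (auto simp: f_def fsgn_def)
  assume "fsgn I (M 0) \<noteq> fsgn I (M 1)"
  hence "f 0 < 0 \<and> f 1 > 0 \<or> f 0 > 0 \<and> f 1 < 0"
    using nz[of 0] nz[of 1] unfolding fsgn_def f_def[symmetric] by (auto simp: sgn_if split: if_splits)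
  hence "\<exists>t\<in>{0..1}. f t = 0"
    using IVT'[of f 0 0 1] IVT2'[of f 1 0 0] c by force
  thus False using nz by blast
qed

text \<open>The perturbation \<open>M + (1 - \<mu>) v v\<^sup>*\<close> replaces the eigenvalue \<open>\<mu>\<close> of \<open>v\<close> by 1,
  which makes the path invertible throughout.\<close>

lemma fsgn_flip:
  fixes M :: "real \<Rightarrow> 'a \<Rightarrow> 'a \<Rightarrow> complex" and \<mu> :: "real \<Rightarrow> real"
  assumes I: "finite I" and cont: "\<And>i j. i \<in> I \<Longrightarrow> j \<in> I \<Longrightarrow> continuous_on {0..1} (\<lambda>t. M t i j)"
    and h: "\<And>t. t \<in> {0..1} \<Longrightarrow> hermitian_on I (M t)"
    and eig: "\<And>t i. t \<in> {0..1} \<Longrightarrow> i \<in> I \<Longrightarrow> mv I (M t) v i = of_real (\<mu> t) * v i"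
    and v: "(\<Sum>i\<in>I. cnj (v i) * v i) = 1"
    and inj: "\<And>t f. t \<in> {0..1} \<Longrightarrow> \<forall>i\<in>I. mv I (M t) f i = 0 \<Longrightarrow> (\<Sum>i\<in>I. cnj (v i) * f i) = 0
        \<Longrightarrow> \<forall>i\<in>I. f i = 0"
    and \<mu>: "continuous_on {0..1} \<mu>" "\<mu> 0 < 0" "\<mu> 1 > 0"
  shows "fsgn I (M 0) = - fsgn I (M 1)"
proof -
  define P where "P t i j = M t i j + of_real (1 - \<mu> t) * (v i * cnj (v j))" for t i j
  have mvP: "mv I (P t) f i = mv I (M t) f i + of_real (1 - \<mu> t) * v i * (\<Sum>j\<in>I. cnj (v j) * f j)" for t f i
    unfolding mv_def P_def by (simp add: ring_distribs sum.distrib sum_distrib_left mult_ac)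
  have hP: "hermitian_on I (P t)" if "t \<in> {0..1}" for t
    by (rule hermitian_onI) (simp add: P_def hermitian_onD[OF h[OF that]])
  have injP: "injective_on I (P t)" if t: "t \<in> {0..1}" for t
    unfolding injective_on_def
  proof (intro allI impI)
    fix f assume z: "\<forall>i\<in>I. mv I (P t) f i = 0"
    \<comment> \<open>Pairing with \<open>v\<close> isolates \<open>s\<close>: as \<open>M t\<close>
      is Hermitian, its part contributes \<mu> s, and the added rank-one term contributes (1 -
      \<mu>) s.\<close>
    define s where "s = (\<Sum>j\<in>I. cnj (v j) * f j)"
    have "(\<Sum>i\<in>I. cnj (v i) * mv I (M t) f i) = (\<Sum>i\<in>I. \<Sum>j\<in>I. cnj (v i) * M t i j * f j)"
      by (simp add: mv_def sum_distrib_left mult_ac)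
    also have "\<dots> = (\<Sum>j\<in>I. \<Sum>i\<in>I. cnj (v i) * M t i j * f j)" by (rule sum.swap)
    also have "\<dots> = (\<Sum>j\<in>I. cnj (mv I (M t) v j) * f j)"
      unfolding mv_def cnj_sum sum_distrib_right
      by (intro sum.cong refl) (simp add: hermitian_onD[OF h[OF t]])
    also have "\<dots> = of_real (\<mu> t) * s"
      using eig[OF t] by (simp add: s_def sum_distrib_left mult_ac)
    finally have a: "(\<Sum>i\<in>I. cnj (v i) * mv I (M t) f i) = of_real (\<mu> t) * s" .
    have "0 = (\<Sum>i\<in>I. cnj (v i) * mv I (P t) f i)" using z by simp
    also have "\<dots> = (\<Sum>i\<in>I. cnj (v i) * mv I (M t) f i) + of_real (1 - \<mu> t) * s * (\<Sum>i\<in>I. cnj (v i) * v i)"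
      unfolding mvP s_def[symmetric] by (simp add: ring_distribs sum.distrib sum_distrib_left mult_ac)
    also have "\<dots> = s" unfolding a v by (simp add: algebra_simps)
    finally have s0: "s = 0" by simp
    hence "\<forall>i\<in>I. mv I (M t) f i = 0" using z mvP by (simp add: s_def)
    thus "\<forall>i\<in>I. f i = 0" using inj[OF t] s0 by (simp add: s_def)
  qed
  have PP: "fsgn I (P 0) = fsgn I (P 1)"
    by (rule fsgn_path[OF I _ hP injP]) (auto simp: P_def intro!: continuous_intros cont \<mu>)
  have rel: "fsgn I (M t) = sgn (\<mu> t) * fsgn I (P t)" if t: "t \<in> {0..1}" and nz: "\<mu> t \<noteq> 0" for t
  proof -
    \<comment> \<open>Since \<open>v\<close> is an eigenvector, \<open>P t\<close> is the product of
      \<open>M t\<close> and \<open>1 + c v v\<^sup>*\<close>, and the second factor has determinant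
      1 + c = 1 / \<mu>. Division by \<mu> restricts this to times with \<mu> nonzero, such as both
      endpoints.\<close>
    define c where "c = complex_of_real ((1 - \<mu> t) / \<mu> t)"
    have "P t i j = (\<Sum>k\<in>I. M t i k * ((if k = j then 1 else 0) + (c * v k) * cnj (v j)))"
      if "i \<in> I" "j \<in> I" for i j
    proof -
      have "(\<Sum>k\<in>I. M t i k * ((if k = j then 1 else 0) + (c * v k) * cnj (v j)))
          = (\<Sum>k\<in>I. if k = j then M t i k else 0) + c * cnj (v j) * mv I (M t) v i"
        unfolding mv_def sum_distrib_left sum.distrib[symmetric]
        by (intro sum.cong refl) (auto simp: algebra_simps)
      also have "\<dots> = M t i j + c * cnj (v j) * (of_real (\<mu> t) * v i)"
        using that I eig[OF t] by simp
      also have "\<dots> = P t i j" using nz by (simp add: P_def c_def)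
      finally show ?thesis by simp
    qed
    hence "fdet I (P t)
        = fdet I (\<lambda>i j. \<Sum>k\<in>I. M t i k * ((if k = j then 1 else 0) + (c * v k) * cnj (v j)))"
      by (rule fdet_cong[OF I])
    also have "\<dots> = fdet I (M t) * (1 + (\<Sum>k\<in>I. (c * v k) * cnj (v k)))"
      unfolding fdet_mult[OF I] fdet_one_plus_rank_one[OF I] ..
    also have "(\<Sum>k\<in>I. (c * v k) * cnj (v k)) = c"
      using v by (simp add: sum_distrib_left[symmetric] mult_ac)
    also have "1 + c = of_real (1 / \<mu> t)" using nz by (simp add: c_def field_simps)
    finally have "Re (fdet I (P t)) = Re (fdet I (M t)) / \<mu> t"
      by (metis Re_divide_of_real of_real_1 of_real_divide times_divide_eq_right mult.right_neutral)
    hence "Re (fdet I (M t)) = \<mu> t * Re (fdet I (P t))" using nz by simp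
    thus ?thesis by (simp add: fsgn_def sgn_mult)
  qed
  show ?thesis using rel[of 0] rel[of 1] \<mu> PP by simp
qed

section \<open>The spectral localizer\<close>

definition nrm :: "'a set \<Rightarrow> ('a \<Rightarrow> complex) \<Rightarrow> real" where
  "nrm I f = L2_set (\<lambda>i. cmod (f i)) I"

definition cip :: "'a set \<Rightarrow> ('a \<Rightarrow> complex) \<Rightarrow> ('a \<Rightarrow> complex) \<Rightarrow> complex" where
  "cip I f g = (\<Sum>i\<in>I. cnj (f i) * g i)"

lemma nrm_nonneg [simp]: "0 \<le> nrm I f"
  by (simp add: nrm_def)

lemma nrm_squared: "(nrm I f)\<^sup>2 = (\<Sum>i\<in>I. (cmod (f i))\<^sup>2)"
  by (simp add: nrm_def L2_set_def sum_nonneg)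

lemma nrm_cong: "(\<And>i. i \<in> I \<Longrightarrow> f i = g i) \<Longrightarrow> nrm I f = nrm I g"
  by (simp add: nrm_def cong: L2_set_cong)

lemma nrm_add_le: "nrm I (\<lambda>i. f i + g i) \<le> nrm I f + nrm I g"
proof -
  have "nrm I (\<lambda>i. f i + g i) \<le> L2_set (\<lambda>i. cmod (f i) + cmod (g i)) I"
    unfolding nrm_def by (intro L2_set_mono) (auto intro: norm_triangle_ineq)
  also have "\<dots> \<le> nrm I f + nrm I g"
    unfolding nrm_def by (rule L2_set_triangle_ineq)
  finally show ?thesis .
qed

lemma nrm_mult: "nrm I (\<lambda>i. c * f i) = cmod c * nrm I f"
  by (simp add: nrm_def norm_mult L2_set_right_distrib)

lemma nrm_diff_le: "nrm I (\<lambda>i. f i - g i) \<le> nrm I f + nrm I g"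
  using nrm_add_le[of I f "\<lambda>i. (-1) * g i"] nrm_mult[of I "-1" g] by simp

lemma nrm_mono: "(\<And>i. i \<in> I \<Longrightarrow> cmod (f i) \<le> cmod (g i)) \<Longrightarrow> nrm I f \<le> nrm I g"
  unfolding nrm_def by (intro L2_set_mono) auto

lemma nrm_eq_0: "finite I \<Longrightarrow> nrm I f = 0 \<Longrightarrow> i \<in> I \<Longrightarrow> f i = 0"
  unfolding nrm_def by (simp add: L2_set_eq_0_iff)

lemma cip_self: "cip I f f = of_real ((nrm I f)\<^sup>2)"
  unfolding cip_def nrm_squared by (simp add: complex_norm_square[symmetric] mult.commute)

lemma cip_bound: "cmod (cip I f g) \<le> nrm I f * nrm I g"
proof -
  have "cmod (cip I f g) \<le> (\<Sum>i\<in>I. \<bar>cmod (f i)\<bar> * \<bar>cmod (g i)\<bar>)"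
    unfolding cip_def by (rule order_trans[OF norm_sum]) (simp add: norm_mult)
  also have "\<dots> \<le> nrm I f * nrm I g"
    unfolding nrm_def by (rule L2_set_mult_ineq)
  finally show ?thesis .
qed

lemma cip_mv:
  assumes "hermitian_on I M"
  shows "cip I f (mv I M g) = cip I (mv I M f) g"
proof -
  have "cip I f (mv I M g) = (\<Sum>i\<in>I. \<Sum>j\<in>I. cnj (f i) * M i j * g j)"
    by (simp add: cip_def mv_def sum_distrib_left mult_ac)
  also have "\<dots> = (\<Sum>j\<in>I. \<Sum>i\<in>I. cnj (f i) * M i j * g j)" by (rule sum.swap)
  also have "\<dots> = cip I (mv I M f) g"
    unfolding cip_def mv_def cnj_sum sum_distrib_right
    by (intro sum.cong refl) (simp add: hermitian_onD[OF assms] mult_ac)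
  finally show ?thesis .
qed

text \<open>A Schur test: Cauchy-Schwarz on the at most \<open>n\<close> entries of each row, then
  each value of \<open>f\<close> is counted at most \<open>n\<close> times because of the
  columns.\<close>

lemma nrm_mv_schur:
  fixes A :: "'a \<Rightarrow> 'a \<Rightarrow> complex"
  assumes I: "finite I" and c: "\<And>i j. i \<in> I \<Longrightarrow> j \<in> I \<Longrightarrow> cmod (A i j) \<le> c"
    and row: "\<And>i. i \<in> I \<Longrightarrow> card {j \<in> I. A i j \<noteq> 0} \<le> n"
    and col: "\<And>j. j \<in> I \<Longrightarrow> card {i \<in> I. A i j \<noteq> 0} \<le> n"
  shows "nrm I (mv I A f) \<le> c * real n * nrm I f"
proof (cases "I = {}")
  case True
  thus ?thesis by (simp add: nrm_def)
next
  case False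
  hence c0: "0 \<le> c" using c norm_ge_zero order_trans by blast
  have r: "(cmod (mv I A f i))\<^sup>2 \<le> c\<^sup>2 * n * (\<Sum>j\<in>{j \<in> I. A i j \<noteq> 0}. (cmod (f j))\<^sup>2)" if i: "i \<in> I" for i
  proof -
    let ?J = "{j \<in> I. A i j \<noteq> 0}"
    have "mv I A f i = (\<Sum>j\<in>?J. A i j * f j)"
      unfolding mv_def by (rule sum.mono_neutral_right[OF I]) auto
    also have "cmod \<dots> \<le> (\<Sum>j\<in>?J. c * cmod (f j))"
      by (intro sum_norm_le) (use i c in \<open>auto simp: norm_mult mult_right_mono\<close>)
    finally have "(cmod (mv I A f i))\<^sup>2 \<le> (\<Sum>j\<in>?J. c * cmod (f j))\<^sup>2"
      by (intro power_mono) auto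
    also have "\<dots> \<le> (\<Sum>j\<in>?J. (c * cmod (f j))\<^sup>2) * card ?J"
      by (rule sum_squared_le_sum_of_squares)
    also have "\<dots> \<le> (\<Sum>j\<in>?J. (c * cmod (f j))\<^sup>2) * n"
      by (intro mult_left_mono sum_nonneg) (use row[OF i] in auto)
    finally show ?thesis by (simp add: power_mult_distrib sum_distrib_left mult_ac)
  qed
  have "(nrm I (mv I A f))\<^sup>2 \<le> (\<Sum>i\<in>I. c\<^sup>2 * n * (\<Sum>j\<in>{j \<in> I. A i j \<noteq> 0}. (cmod (f j))\<^sup>2))"
    unfolding nrm_squared by (intro sum_mono r)
  also have "\<dots> = c\<^sup>2 * n * (\<Sum>j\<in>I. \<Sum>i\<in>{i \<in> I. A i j \<noteq> 0}. (cmod (f j))\<^sup>2)"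
    unfolding sum_distrib_left[symmetric] by (subst sum.swap_restrict[OF I I]) simp
  also have "\<dots> \<le> c\<^sup>2 * n * (\<Sum>j\<in>I. n * (cmod (f j))\<^sup>2)"
    by (intro mult_left_mono sum_mono) (use col in \<open>auto intro!: mult_right_mono\<close>)
  also have "\<dots> = (c * n * nrm I f)\<^sup>2"
    unfolding sum_distrib_left[symmetric] nrm_squared[symmetric] by (simp add: power2_eq_square mult_ac)
  finally show ?thesis
    by (rule power2_le_imp_le) (use c0 in simp)
qed

text \<open>Along the segment from \<open>M\<close> to \<open>M'\<close> the distance to
  \<open>M'\<close> stays at most \<open>e\<close>, below the lower bound \<open>c\<close> of
  \<open>M'\<close>, so no kernel can appear.\<close>

lemma fsgn_perturb:
  assumes I: "finite I" and h: "hermitian_on I M" "hermitian_on I M'"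
    and low: "\<And>f. c * nrm I f \<le> nrm I (mv I M' f)"
    and near: "\<And>f. nrm I (\<lambda>i. mv I M f i - mv I M' f i) \<le> e * nrm I f" and "e < c"
  shows "fsgn I M = fsgn I M'"
proof -
  define P where "P t i j = M i j + of_real t * (M' i j - M i j)" for t i j
  have mvP: "mv I (P t) f i = mv I M' f i + of_real (1 - t) * (mv I M f i - mv I M' f i)" for t f i
    by (simp add: mv_def P_def algebra_simps sum.distrib sum_subtractf sum_distrib_left)
  have "fsgn I (P 0) = fsgn I (P 1)"
  proof (rule fsgn_path[OF I])
    fix t :: real assume t: "t \<in> {0..1}"
    show "hermitian_on I (P t)"
      by (rule hermitian_onI) (simp add: P_def hermitian_onD[OF h(1)] hermitian_onD[OF h(2)])
    show "injective_on I (P t)"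
      unfolding injective_on_def
    proof (intro allI impI ballI)
      fix f i assume z: "\<forall>i\<in>I. mv I (P t) f i = 0" and i: "i \<in> I"
      have "c * nrm I f \<le> nrm I (mv I M' f)" by (rule low)
      also have "\<dots> = nrm I (\<lambda>i. of_real (t - 1) * (mv I M f i - mv I M' f i))"
        by (intro nrm_cong) (use z in \<open>auto simp: mvP algebra_simps\<close>)
      also have "\<dots> = (1 - t) * nrm I (\<lambda>i. mv I M f i - mv I M' f i)"
        unfolding nrm_mult norm_of_real using t by simp
      also have "\<dots> \<le> 1 * nrm I (\<lambda>i. mv I M f i - mv I M' f i)"
        using t by (intro mult_right_mono) auto
      also have "\<dots> \<le> e * nrm I f" using near by simp
      finally have "(c - e) * nrm I f \<le> 0" by (simp add: algebra_simps)
      hence "nrm I f = 0"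
        using \<open>e < c\<close> nrm_nonneg[of I f] by (simp add: mult_le_0_iff)
      thus "f i = 0" using nrm_eq_0[OF I _ i] by blast
    qed
  qed (auto simp: P_def intro!: continuous_intros)
  moreover have "P 0 = M" "P 1 = M'" by (simp_all add: P_def fun_eq_iff)
  ultimately show ?thesis by simp
qed

text \<open>The spectral localizer: the matrix with blocks \<open>T\<close>, \<open>W\<^sup>*\<close>, \<open>W\<close>, \<open>- T\<close>,
  where \<open>W\<close> is diagonal.\<close>

definition loc :: "('s \<Rightarrow> 's \<Rightarrow> complex) \<Rightarrow> ('s \<Rightarrow> complex) \<Rightarrow> 's \<times> bool \<Rightarrow> 's \<times> bool \<Rightarrow> complex" where
  "loc T W = (\<lambda>(s, a) (t, b).
     if a then if b then - T s t else if s = t then W s else 0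
     else if b then if s = t then cnj (W s) else 0 else T s t)"

lemma sum_times_bool:
  "(\<Sum>x\<in>S \<times> (UNIV :: bool set). F x) = (\<Sum>s\<in>S. F (s, False)) + (\<Sum>s\<in>S. F (s, True))"
proof -
  have "(\<Sum>x\<in>S \<times> (UNIV :: bool set). F x) = (\<Sum>s\<in>S. \<Sum>b\<in>UNIV. F (s, b))"
    by (simp add: sum.cartesian_product)
  thus ?thesis by (simp add: UNIV_bool sum.distrib)
qed

lemma mv_loc:
  assumes "finite S" "s \<in> S"
  shows "mv (S \<times> UNIV) (loc T W) f (s, False) = mv S T (\<lambda>t. f (t, False)) s + cnj (W s) * f (s, True)"
    and "mv (S \<times> UNIV) (loc T W) f (s, True) = W s * f (s, False) - mv S T (\<lambda>t. f (t, True)) s"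
  using assms by (simp_all add: mv_def sum_times_bool loc_def sum_negf
      if_distrib[of "\<lambda>x. x * _"] cong: if_cong)

lemma nrm_times_bool:
  "(nrm (S \<times> UNIV) f)\<^sup>2 = (nrm S (\<lambda>s. f (s, False)))\<^sup>2 + (nrm S (\<lambda>s. f (s, True)))\<^sup>2"
  by (simp add: nrm_squared sum_times_bool)

lemma hermitian_loc: "hermitian_on S T \<Longrightarrow> hermitian_on (S \<times> UNIV) (loc T W)"
  by (rule hermitian_onI) (auto simp: loc_def hermitian_onD)

lemma mv_add: "mv S T (\<lambda>i. f i + g i) s = mv S T f s + mv S T g s"
  by (simp add: mv_def ring_distribs sum.distrib)

lemma mv_scale: "mv S T (\<lambda>i. c * f i) s = c * mv S T f s"
  by (simp add: mv_def sum_distrib_left mult_ac)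

lemma mv_cong: "(\<And>i. i \<in> S \<Longrightarrow> f i = g i) \<Longrightarrow> mv S T f s = mv S T g s"
  by (simp add: mv_def)

text \<open>With commutators \<open>[T, W]\<close> that are small compared with the square of the gap of \<open>T\<close>, the
  term \<open>T\<^sup>2\<close> keeps the whole segment from \<open>loc T W\<close> to \<open>loc 0 1\<close> invertible,
  even where the scalar part degenerates.\<close>

lemma fsgn_loc_gap:
  assumes S: "finite S" and T: "hermitian_on S T"
    and gap: "\<And>u. g * nrm S u \<le> nrm S (mv S T u)" and g: "0 < g"
    and comm: "\<And>u. nrm S (\<lambda>s. mv S T (\<lambda>t. W t * u t) s - W s * mv S T u s) \<le> \<delta> * nrm S u"
      "\<And>u. nrm S (\<lambda>s. mv S T (\<lambda>t. cnj (W t) * u t) s - cnj (W s) * mv S T u s) \<le> \<delta> * nrm S u"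
    and \<delta>: "0 \<le> \<delta>" "\<delta> < g\<^sup>2"
  shows "fsgn (S \<times> UNIV) (loc T W) = fsgn (S \<times> UNIV) (loc (\<lambda>_ _. 0) (\<lambda>_. 1))"
proof -
  define P where "P t = loc (\<lambda>s s'. of_real (1 - t) * T s s') (\<lambda>s. of_real (1 - t) * W s + of_real t)" for t
  have "fsgn (S \<times> UNIV) (P 0) = fsgn (S \<times> UNIV) (P 1)"
  proof (rule fsgn_path)
    show "finite (S \<times> (UNIV :: bool set))" using S by simp
    show "continuous_on {0..1} (\<lambda>t. P t i j)" for i j
      by (cases "snd i"; cases "snd j"; cases "fst i = fst j")
        (auto simp: P_def loc_def split_beta intro!: continuous_intros)
    fix t :: real assume t: "t \<in> {0..1}"
    show "hermitian_on (S \<times> UNIV) (P t)"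
      unfolding P_def by (rule hermitian_loc, rule hermitian_onI) (simp add: hermitian_onD[OF T])
    show "injective_on (S \<times> UNIV) (P t)"
      unfolding injective_on_def
    proof (intro allI impI)
      fix f :: "'a \<times> bool \<Rightarrow> complex"
      assume z: "\<forall>i\<in>S \<times> UNIV. mv (S \<times> UNIV) (P t) f i = 0"
      define u v where "u = (\<lambda>s. f (s, False))" and "v = (\<lambda>s. f (s, True))"
      define V where "V s = of_real (1 - t) * W s + of_real t" for s
      define \<tau> where "\<tau> = complex_of_real (1 - t)"
      have mvt: "mv S (\<lambda>s s'. \<tau> * T s s') w s = \<tau> * mv S T w s" for w s
        by (simp add: mv_def sum_distrib_left mult_ac)
      have PV: "P t = loc (\<lambda>s s'. \<tau> * T s s') V"
        unfolding P_def \<tau>_def V_def[abs_def] ..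
      have e1: "\<tau> * mv S T u s + cnj (V s) * v s = 0" if "s \<in> S" for s
        using z[rule_format, of "(s, False)"] that
        unfolding PV by (simp add: mv_loc S mvt u_def v_def)
      have e2: "V s * u s - \<tau> * mv S T v s = 0" if "s \<in> S" for s
        using z[rule_format, of "(s, True)"] that
        unfolding PV by (simp add: mv_loc S mvt u_def v_def)
      have "u s = 0 \<and> v s = 0" if s: "s \<in> S" for s
      proof (cases "t = 1")
        case True
        thus ?thesis using e1[OF s] e2[OF s] by (simp add: \<tau>_def V_def)
      next
        case False
        define r where "r = 1 - t"
        have r: "r > 0" using False t by (simp add: r_def)
        have \<tau>r: "\<tau> = of_real r" by (simp add: \<tau>_def r_def)
        define A where "A s = mv S T (\<lambda>t. cnj (W t) * v t) s - cnj (W s) * mv S T v s" for s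
        define B where "B s = mv S T (\<lambda>t. W t * u t) s - W s * mv S T u s" for s
        have VA: "mv S T (\<lambda>t. cnj (V t) * v t) s = cnj (V s) * mv S T v s + \<tau> * A s" for s
        proof -
          have "mv S T (\<lambda>t. cnj (V t) * v t) s
              = mv S T (\<lambda>x. \<tau> * (cnj (W x) * v x) + of_real t * v x) s"
            by (intro mv_cong) (simp add: V_def \<tau>_def algebra_simps)
          also have "\<dots> = \<tau> * mv S T (\<lambda>x. cnj (W x) * v x) s + of_real t * mv S T v s"
            by (simp only: mv_add mv_scale)
          also have "\<dots> = cnj (V s) * mv S T v s + \<tau> * A s"
            by (simp add: A_def V_def \<tau>_def algebra_simps)
          finally show ?thesis .
        qed
        have VB: "mv S T (\<lambda>t. V t * u t) s = V s * mv S T u s + \<tau> * B s" for s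
        proof -
          have "mv S T (\<lambda>t. V t * u t) s
              = mv S T (\<lambda>x. \<tau> * (W x * u x) + of_real t * u x) s"
            by (intro mv_cong) (simp add: V_def \<tau>_def algebra_simps)
          also have "\<dots> = \<tau> * mv S T (\<lambda>x. W x * u x) s + of_real t * mv S T u s"
            by (simp only: mv_add mv_scale)
          also have "\<dots> = V s * mv S T u s + \<tau> * B s"
            by (simp add: B_def V_def \<tau>_def algebra_simps)
          finally show ?thesis .
        qed
        \<comment> \<open>Apply \<open>T\<close> to \<open>e1\<close> and eliminate \<open>v\<close>
          by \<open>e2\<close>. The only error is the commutator \<open>A\<close>. It carries the
          factor \<open>\<tau>\<^sup>2\<close> just as \<open>T\<^sup>2\<close> does, because only
          the part \<open>\<tau> W\<close> of \<open>V\<close> fails to commute with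
          \<open>T\<close>; so the estimate stays uniform as t approaches 1.\<close>
        have f1: "\<tau>\<^sup>2 * mv S T (mv S T u) s = - (V s * cnj (V s)) * u s - \<tau>\<^sup>2 * A s" if s: "s \<in> S" for s
        proof -
          have "\<tau> * mv S T (mv S T u) s = mv S T (\<lambda>x. (-1) * (cnj (V x) * v x)) s"
            unfolding mv_scale[of S T \<tau> "mv S T u" s, symmetric]
            by (intro mv_cong) (use e1 in \<open>simp add: eq_neg_iff_add_eq_0\<close>)
          also have "\<dots> = - (cnj (V s) * mv S T v s + \<tau> * A s)" by (simp only: mv_scale VA) simp
          finally have "\<tau> * mv S T (mv S T u) s = - (cnj (V s) * mv S T v s + \<tau> * A s)" .
          hence "\<tau>\<^sup>2 * mv S T (mv S T u) s = \<tau> * (- (cnj (V s) * mv S T v s + \<tau> * A s))"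
            by (simp only: power2_eq_square mult.assoc)
          also have "\<dots> = - cnj (V s) * (\<tau> * mv S T v s) - \<tau>\<^sup>2 * A s"
            by (simp add: power2_eq_square algebra_simps)
          finally have "\<tau>\<^sup>2 * mv S T (mv S T u) s = - cnj (V s) * (\<tau> * mv S T v s) - \<tau>\<^sup>2 * A s" .
          thus ?thesis using e2[OF s] by (simp add: algebra_simps)
        qed
        have f2: "\<tau>\<^sup>2 * mv S T (mv S T v) s = - (V s * cnj (V s)) * v s + \<tau>\<^sup>2 * B s" if s: "s \<in> S" for s
        proof -
          have "\<tau> * mv S T (mv S T v) s = mv S T (\<lambda>x. V x * u x) s"
            unfolding mv_scale[of S T \<tau> "mv S T v" s, symmetric]
            by (intro mv_cong) (use e2 in simp)
          also have "\<dots> = V s * mv S T u s + \<tau> * B s" by (rule VB)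
          finally have "\<tau> * mv S T (mv S T v) s = V s * mv S T u s + \<tau> * B s" .
          hence "\<tau>\<^sup>2 * mv S T (mv S T v) s = \<tau> * (V s * mv S T u s + \<tau> * B s)"
            by (simp only: power2_eq_square mult.assoc)
          also have "\<dots> = V s * (\<tau> * mv S T u s) + \<tau>\<^sup>2 * B s"
            by (simp add: power2_eq_square algebra_simps)
          finally have "\<tau>\<^sup>2 * mv S T (mv S T v) s = V s * (\<tau> * mv S T u s) + \<tau>\<^sup>2 * B s" .
          moreover have "\<tau> * mv S T u s = - (cnj (V s) * v s)"
            using e1[OF s] by (simp add: eq_neg_iff_add_eq_0)
          ultimately show ?thesis by simp
        qed
        have est: "g\<^sup>2 * (nrm S x)\<^sup>2 \<le> \<delta> * nrm S u * nrm S v"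
          if eq: "\<And>s. s \<in> S \<Longrightarrow> \<tau>\<^sup>2 * mv S T (mv S T x) s = - (V s * cnj (V s)) * x s + \<tau>\<^sup>2 * C s"
            and C: "nrm S x * nrm S C \<le> \<delta> * nrm S u * nrm S v" for x C
        proof -
          have V2: "cip S (\<lambda>s. V s * x s) (\<lambda>s. V s * x s) = cip S x (\<lambda>s. (V s * cnj (V s)) * x s)"
            by (simp add: cip_def mult_ac)
          have "\<tau>\<^sup>2 * cip S x (mv S T (mv S T x))
              = cip S x (\<lambda>s. - (V s * cnj (V s)) * x s + \<tau>\<^sup>2 * C s)"
            unfolding cip_def sum_distrib_left
            by (intro sum.cong refl) (use eq in \<open>simp add: mult.left_commute\<close>)
          also have "\<dots> = - cip S (\<lambda>s. V s * x s) (\<lambda>s. V s * x s) + \<tau>\<^sup>2 * cip S x C"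
            unfolding V2
            by (simp add: cip_def sum_distrib_left algebra_simps sum.distrib sum_negf sum_subtractf)
          finally have "\<tau>\<^sup>2 * of_real ((nrm S (mv S T x))\<^sup>2)
              = - of_real ((nrm S (\<lambda>s. V s * x s))\<^sup>2) + \<tau>\<^sup>2 * cip S x C"
            unfolding cip_mv[OF T] cip_self .
          from arg_cong[OF this, of Re]
          have "r\<^sup>2 * (nrm S (mv S T x))\<^sup>2 = - (nrm S (\<lambda>s. V s * x s))\<^sup>2 + r\<^sup>2 * Re (cip S x C)"
            unfolding \<tau>r of_real_power[symmetric]
            by (simp only: Re_complex_of_real plus_complex.sel uminus_complex.sel times_complex.sel
                of_real_mult[symmetric] Im_complex_of_real)
          also have "\<dots> \<le> r\<^sup>2 * (\<delta> * nrm S u * nrm S v)"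
          proof -
            have "Re (cip S x C) \<le> \<delta> * nrm S u * nrm S v"
              using complex_Re_le_cmod[of "cip S x C"] cip_bound[of S x C] C by linarith
            hence "r\<^sup>2 * Re (cip S x C) \<le> r\<^sup>2 * (\<delta> * nrm S u * nrm S v)"
              by (intro mult_left_mono) auto
            thus ?thesis using zero_le_power2[of "nrm S (\<lambda>s. V s * x s)"] by linarith
          qed
          finally have "(nrm S (mv S T x))\<^sup>2 \<le> \<delta> * nrm S u * nrm S v"
            using r by simp
          moreover have "(g * nrm S x)\<^sup>2 \<le> (nrm S (mv S T x))\<^sup>2"
            by (rule power_mono[OF gap]) (use g in simp)
          ultimately show ?thesis by (simp add: power_mult_distrib)
        qed
        have "g\<^sup>2 * (nrm S u)\<^sup>2 \<le> \<delta> * nrm S u * nrm S v"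
        proof (rule est)
          show "\<tau>\<^sup>2 * mv S T (mv S T u) s = - (V s * cnj (V s)) * u s + \<tau>\<^sup>2 * (- 1 * A s)" if "s \<in> S" for s
            using f1[OF that] by simp
          have "nrm S A \<le> \<delta> * nrm S v" unfolding A_def by (rule comm(2))
          hence "nrm S (\<lambda>s. - 1 * A s) \<le> \<delta> * nrm S v" by (simp only: nrm_mult) simp
          from mult_left_mono[OF this, of "nrm S u"]
          show "nrm S u * nrm S (\<lambda>s. - 1 * A s) \<le> \<delta> * nrm S u * nrm S v" by (simp add: mult_ac)
        qed
        moreover have "g\<^sup>2 * (nrm S v)\<^sup>2 \<le> \<delta> * nrm S u * nrm S v"
        proof (rule est)
          show "\<tau>\<^sup>2 * mv S T (mv S T v) s = - (V s * cnj (V s)) * v s + \<tau>\<^sup>2 * B s" if "s \<in> S" for s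
            by (rule f2[OF that])
          have "nrm S B \<le> \<delta> * nrm S u" unfolding B_def by (rule comm(1))
          from mult_left_mono[OF this, of "nrm S v"]
          show "nrm S v * nrm S B \<le> \<delta> * nrm S u * nrm S v" by (simp add: mult_ac)
        qed
        \<comment> \<open>By the inequality of the means, the sum of both estimates contradicts
          \<open>\<delta> < g\<^sup>2\<close> unless \<open>u\<close> and \<open>v\<close>
          vanish.\<close>
        moreover have "2 * (\<delta> * nrm S u * nrm S v) \<le> \<delta> * ((nrm S u)\<^sup>2 + (nrm S v)\<^sup>2)"
          using mult_left_mono[OF sum_squares_bound[of "nrm S u" "nrm S v"] \<delta>(1)] by (simp add: mult_ac)
        ultimately have "(g\<^sup>2 - \<delta>) * ((nrm S u)\<^sup>2 + (nrm S v)\<^sup>2) \<le> 0"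
          by (simp add: algebra_simps)
        hence "(nrm S u)\<^sup>2 + (nrm S v)\<^sup>2 \<le> 0"
          using \<delta>(2) by (simp add: mult_le_0_iff)
        hence "nrm S u = 0" "nrm S v = 0"
          by (simp_all add: sum_power2_le_zero_iff)
        thus ?thesis using nrm_eq_0[OF S] s by blast
      qed
      thus "\<forall>i\<in>S \<times> UNIV. f i = 0"
        by (auto simp: u_def v_def split: prod.splits) (metis (full_types))
    qed
  qed
  moreover have "P 0 = loc T W" "P 1 = loc (\<lambda>_ _. 0) (\<lambda>_. 1)"
    by (simp_all add: P_def)
  ultimately show ?thesis by simp
qed

section \<open>The spin representation\<close>

text \<open>The representation of spin \<open>N/2\<close>, divided by \<open>(N + 1)/2\<close>: with \<open>X\<close> the
  multiplication by \<open>spin_pos\<close>, \<open>Z = Zop\<close> and \<open>\<i> Y = Dop\<close> one has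
  \<open>[X, Y] = \<i> h Z\<close> (cyclically) for \<open>h = spin_step\<close>.  Further,
  \<open>Aop\<close> with \<open>s = 1\<close> is \<open>A = X + \<i> Y\<close>, and \<open>s = - 1\<close> gives its adjoint.  The shift by
  \<open>s h/2\<close> in \<open>Top\<close> turns the Casimir relation into \<open>A\<^sup>* A = 1 - T\<^sup>2\<close>.
  The weights vanish at both ends, so the interval \<open>{0..N}\<close> is invariant.\<close>

definition wt :: "int \<Rightarrow> int \<Rightarrow> real" where
  "wt N k = (if 1 \<le> k \<and> k \<le> N then sqrt (real_of_int (k * (N + 1 - k))) / (N + 1) else 0)"

definition spin_pos :: "int \<Rightarrow> int \<Rightarrow> real" where
  "spin_pos N k = (2 * k - N) / (N + 1)"

definition spin_step :: "int \<Rightarrow> real" where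
  "spin_step N = 2 / (N + 1)"

definition Zop :: "int \<Rightarrow> (int \<Rightarrow> complex) \<Rightarrow> int \<Rightarrow> complex" where
  "Zop N f k = of_real (wt N (k + 1)) * f (k + 1) + of_real (wt N k) * f (k - 1)"

definition Dop :: "int \<Rightarrow> (int \<Rightarrow> complex) \<Rightarrow> int \<Rightarrow> complex" where
  "Dop N f k = of_real (wt N (k + 1)) * f (k + 1) - of_real (wt N k) * f (k - 1)"

definition Aop :: "int \<Rightarrow> real \<Rightarrow> (int \<Rightarrow> complex) \<Rightarrow> int \<Rightarrow> complex" where
  "Aop N s f k = of_real (spin_pos N k) * f k + of_real s * Dop N f k"

definition Top :: "int \<Rightarrow> real \<Rightarrow> (int \<Rightarrow> complex) \<Rightarrow> int \<Rightarrow> complex" where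
  "Top N s f k = Zop N f k + of_real (s * spin_step N / 2) * f k"

lemma wt_outside [simp]: "k \<le> 0 \<Longrightarrow> wt N k = 0" "N < k \<Longrightarrow> wt N k = 0"
  by (auto simp: wt_def)

lemma wt_squared:
  assumes "0 \<le> k" "k \<le> N + 1"
  shows "wt N k * wt N k = k * (N + 1 - k) / (N + 1)\<^sup>2"
proof (cases "1 \<le> k \<and> k \<le> N")
  case True
  hence "0 \<le> k * (N + 1 - k)" by simp
  hence "sqrt (real_of_int (k * (N + 1 - k))) * sqrt (real_of_int (k * (N + 1 - k))) = k * (N + 1 - k)"
    by (metis of_int_0_le_iff real_sqrt_mult_self abs_of_nonneg)
  thus ?thesis using True by (simp add: wt_def power2_eq_square)
next
  case False
  hence "k = 0 \<or> k = N + 1" using assms by auto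
  thus ?thesis by auto
qed

lemma wt_pos: "1 \<le> k \<Longrightarrow> k \<le> N \<Longrightarrow> wt N k > 0"
  by (simp add: wt_def)

lemma spin_pos_shift: "0 \<le> N \<Longrightarrow> spin_pos N (k + 1) = spin_pos N k + spin_step N" "0 \<le> N \<Longrightarrow> spin_pos N (k - 1) = spin_pos N k - spin_step N"
  by (simp_all add: spin_pos_def spin_step_def add_divide_distrib[symmetric] diff_divide_distrib[symmetric])

text \<open>The diagonal of the Casimir relation
  \<open>X\<^sup>2 + Y\<^sup>2 + Z\<^sup>2 = 1 - h\<^sup>2 / 4\<close>. The defect reflects N (N +
  2) = \<open>(N + 1)\<^sup>2 - 1\<close>.\<close>

lemma weight_sum:
  assumes "0 \<le> k" "k \<le> N"
  shows "(spin_pos N k)\<^sup>2 + 2 * (wt N (k + 1) * wt N (k + 1)) + 2 * (wt N k * wt N k) + (spin_step N)\<^sup>2 / 4 = 1"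
proof -
  have a: "wt N (k + 1) * wt N (k + 1) = (k + 1) * (N - k) / (N + 1)\<^sup>2"
    using wt_squared[of "k + 1" N] assms by simp
  have b: "wt N k * wt N k = k * (N + 1 - k) / (N + 1)\<^sup>2"
    using wt_squared[of k N] assms by simp
  have nz: "(real_of_int N + 1)\<^sup>2 \<noteq> 0" using assms by auto
  have "(spin_pos N k)\<^sup>2 + 2 * (wt N (k + 1) * wt N (k + 1)) + 2 * (wt N k * wt N k) + (spin_step N)\<^sup>2 / 4
      = ((2 * k - N)\<^sup>2 + 2 * ((k + 1) * (N - k)) + 2 * (k * (N + 1 - k)) + 1) / (real_of_int N + 1)\<^sup>2"
    unfolding a b spin_pos_def spin_step_def by (simp add: power_divide add_divide_distrib)
  also have "(2 * k - N)\<^sup>2 + 2 * ((k + 1) * (N - k)) + 2 * (k * (N + 1 - k)) + 1 = (real_of_int N + 1)\<^sup>2"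
    by (simp add: power2_eq_square algebra_simps)
  finally show ?thesis using nz by simp
qed

text \<open>The diagonal of the commutation relation \<open>[Y, Z] = \<i> h X\<close>.\<close>

lemma weight_diff:
  assumes "0 \<le> k" "k \<le> N"
  shows "2 * (wt N k * wt N k) - 2 * (wt N (k + 1) * wt N (k + 1)) = spin_step N * spin_pos N k"
proof -
  have a: "wt N (k + 1) * wt N (k + 1) = (k + 1) * (N - k) / (N + 1)\<^sup>2"
    using wt_squared[of "k + 1" N] assms by simp
  have b: "wt N k * wt N k = k * (N + 1 - k) / (N + 1)\<^sup>2"
    using wt_squared[of k N] assms by simp
  have "2 * (wt N k * wt N k) - 2 * (wt N (k + 1) * wt N (k + 1))
      = (2 * (k * (N + 1 - k)) - 2 * ((k + 1) * (N - k))) / (real_of_int N + 1)\<^sup>2"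
    unfolding a b by (simp add: diff_divide_distrib)
  also have "real_of_int (2 * (k * (N + 1 - k)) - 2 * ((k + 1) * (N - k))) = 2 * (2 * k - N)"
    by (simp add: algebra_simps)
  finally show ?thesis by (simp add: spin_pos_def spin_step_def power2_eq_square)
qed

lemma Aop_Aop:
  assumes k: "0 \<le> k" "k \<le> N" and s: "s = 1 \<or> s = -1"
  shows "Aop N (- s) (Aop N s f) k = f k - Top N s (Top N s f) k"
proof -
  have N: "0 \<le> N" using k by simp
  define x h a b c d where "x = complex_of_real (spin_pos N k)" and "h = complex_of_real (spin_step N)"
    and "a = complex_of_real (wt N (k + 1))" and "b = complex_of_real (wt N k)"
    and "c = complex_of_real (wt N (k + 2))" and "d = complex_of_real (wt N (k - 1))"
  have e: "x\<^sup>2 + 2 * (a * a) + 2 * (b * b) + h\<^sup>2 / 4 = 1"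
    using arg_cong[OF weight_sum[OF k], of complex_of_real]
    by (simp add: x_def h_def a_def b_def)
  have "Aop N (- s) (Aop N s f) k + Top N s (Top N s f) k
      = (x\<^sup>2 + 2 * (a * a) + 2 * (b * b) + h\<^sup>2 / 4) * f k"
    using s unfolding Aop_def Top_def Dop_def Zop_def spin_pos_shift[OF N]
    by (auto simp: x_def h_def a_def b_def c_def d_def algebra_simps power2_eq_square)
  thus ?thesis unfolding e by (simp add: algebra_simps)
qed

text \<open>\<open>Aop\<close> is a ladder operator for \<open>Z\<close>: it shifts the eigenvalues
  by s h.\<close>

lemma Zop_Aop:
  assumes k: "0 \<le> k" "k \<le> N" and s: "s = 1 \<or> s = -1"
  shows "Zop N (Aop N s f) k = Aop N s (Zop N f) k + of_real (s * spin_step N) * Aop N s f k"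
proof -
  have N: "0 \<le> N" using k by simp
  define x h a b where "x = complex_of_real (spin_pos N k)" and "h = complex_of_real (spin_step N)"
    and "a = complex_of_real (wt N (k + 1))" and "b = complex_of_real (wt N k)"
  have e: "2 * (b * b) - 2 * (a * a) = h * x"
    using arg_cong[OF weight_diff[OF k], of complex_of_real]
    by (simp add: x_def h_def a_def b_def)
  have "Zop N (Aop N s f) k - Aop N s (Zop N f) k - of_real (s * spin_step N) * Aop N s f k
      = of_real s * (2 * (b * b) - 2 * (a * a) - h * x) * f k"
    using s unfolding Aop_def Dop_def Zop_def spin_pos_shift[OF N]
    by (auto simp: x_def h_def a_def b_def algebra_simps)
  thus ?thesis unfolding e by (simp add: algebra_simps)
qed

text \<open>The position is the difference of k / (N + 1) and (N - k) / (N + 1). Starting at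
  \<open>wt N 0 = 0\<close>, this splits the three-term recursion \<open>A f = 0\<close> into two
  recursions with two terms each.\<close>

lemma Aop_kernel:
  fixes N k :: int
  assumes A: "\<And>k. 0 \<le> k \<Longrightarrow> k \<le> N \<Longrightarrow> Aop N s f k = 0" and s: "s = 1 \<or> s = -1"
    and k: "0 \<le> k" "k \<le> N"
  shows "of_real (s * wt N (k + 1)) * f (k + 1) = of_real ((N - k) / (N + 1)) * f k"
    and "of_real (s * wt N k) * f (k - 1) = of_real (k / (N + 1)) * f k"
proof -
  have N: "real_of_int N + 1 \<noteq> 0" using k by linarith
  have step: "of_real (s * wt N (j + 1)) * f (j + 1) = of_real ((N - j) / (N + 1)) * f j"
    if "0 \<le> j" "j \<le> N" and low: "of_real (s * wt N j) * f (j - 1) = of_real (j / (N + 1)) * f j" for j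
  proof -
    have "of_real (s * wt N (j + 1)) * f (j + 1) = of_real (s * wt N j) * f (j - 1) - of_real (spin_pos N j) * f j"
      using A[OF that(1,2)] by (simp add: Aop_def Dop_def algebra_simps)
    also have "\<dots> = of_real (j / (N + 1) - spin_pos N j) * f j" unfolding low by (simp add: algebra_simps)
    also have "j / (N + 1) - spin_pos N j = (N - j) / (N + 1)"
      unfolding spin_pos_def by (simp add: diff_divide_distrib[symmetric])
    finally show ?thesis .
  qed
  have low: "of_real (s * wt N k) * f (k - 1) = of_real (k / (N + 1)) * f k" if "0 \<le> k" "k \<le> N" for k
    using that
  proof (induction k rule: int_ge_induct)
    case base
    show ?case by simp
  next
    case (step i)
    hence i: "0 \<le> i" "i \<le> N" "i + 1 \<le> N" by auto
    have w: "wt N (i + 1) * wt N (i + 1) = (i + 1) * (N - i) / (N + 1)\<^sup>2"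
      using wt_squared[of "i + 1" N] i by simp
    \<comment> \<open>Multiplying by the weight once more turns it into its square, whose factor N -
      i cancels because i < N.\<close>
    have "of_real (s * wt N (i + 1)) * (of_real (s * wt N (i + 1)) * f (i + 1))
        = of_real (s * wt N (i + 1)) * (of_real ((N - i) / (N + 1)) * f i)"
      using \<open>\<And>j. 0 \<le> j \<Longrightarrow> j \<le> N \<Longrightarrow> of_real (s * wt N j) * f (j - 1) = of_real (j / (N + 1)) * f j
        \<Longrightarrow> of_real (s * wt N (j + 1)) * f (j + 1) = of_real ((N - j) / (N + 1)) * f j\<close>[of i]
        step.IH i by simp
    moreover have "of_real (s * wt N (i + 1)) * (of_real (s * wt N (i + 1)) * f (i + 1))
        = of_real (wt N (i + 1) * wt N (i + 1)) * f (i + 1)"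
      using s by auto
    ultimately have "of_real ((i + 1) * (N - i) / (N + 1)\<^sup>2) * f (i + 1)
        = of_real (s * wt N (i + 1)) * (of_real ((N - i) / (N + 1)) * f i)"
      unfolding w by simp
    hence "of_real ((N - i) / (N + 1)) * (of_real ((i + 1) / (N + 1)) * f (i + 1))
        = of_real ((N - i) / (N + 1)) * (of_real (s * wt N (i + 1)) * f i)"
      by (simp add: power2_eq_square mult_ac)
    moreover have "complex_of_real ((N - i) / (N + 1)) \<noteq> 0"
      using i N by (simp del: of_real_divide)
    ultimately show ?case by (metis add_diff_cancel_right' mult_cancel_left of_int_1 of_int_add)
  qed
  show "of_real (s * wt N k) * f (k - 1) = of_real (k / (N + 1)) * f k" by (rule low[OF k])
  thus "of_real (s * wt N (k + 1)) * f (k + 1) = of_real ((N - k) / (N + 1)) * f k"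
    by (rule step[OF k])
qed

text \<open>Adding the two recursions of \<open>Aop_kernel\<close> gives s Z = N / (N + 1) = 1 - h/2
  on the kernel: these are the extremal weight vectors of Z, and the shift in \<open>Top\<close>
  makes the eigenvalue exactly \<open>s\<close>.\<close>

lemma Top_kernel:
  fixes N k :: int
  assumes A: "\<And>k. 0 \<le> k \<Longrightarrow> k \<le> N \<Longrightarrow> Aop N s f k = 0" and s: "s = 1 \<or> s = -1"
    and k: "0 \<le> k" "k \<le> N"
  shows "Top N s f k = of_real s * f k"
proof -
  have N: "real_of_int N + 1 \<noteq> 0" using k by linarith
  have kk: "of_real (s * wt N (k + 1)) * f (k + 1) = of_real ((N - k) / (N + 1)) * f k"
      "of_real (s * wt N k) * f (k - 1) = of_real (k / (N + 1)) * f k"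
    using Aop_kernel[where f = f, OF A s k] by auto
  have "of_real s * Zop N f k = of_real (s * wt N (k + 1)) * f (k + 1) + of_real (s * wt N k) * f (k - 1)"
    by (simp add: Zop_def algebra_simps)
  also have "\<dots> = of_real ((N - k) / (N + 1) + k / (N + 1)) * f k"
    unfolding kk by (simp only: of_real_add ring_distribs)
  also have "(N - k) / (N + 1) + k / (N + 1) = N / (N + 1)"
    by (simp add: add_divide_distrib[symmetric])
  also have "N / (N + 1) = 1 - spin_step N / 2"
    using N by (simp add: spin_step_def field_simps)
  finally have Z: "of_real s * Zop N f k = of_real (1 - spin_step N / 2) * f k" .
  have "Zop N f k = of_real s * (of_real s * Zop N f k)" using s by auto
  also have "\<dots> = of_real (s * (1 - spin_step N / 2)) * f k" unfolding Z by simp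
  finally have "Zop N f k = of_real (s * (1 - spin_step N / 2)) * f k" .
  thus ?thesis by (simp add: Top_def algebra_simps)
qed

section \<open>Coherent states: the kernel of the ladder operator\<close>

definition coherent :: "int \<Rightarrow> int \<Rightarrow> real" where
  "coherent N k = sqrt (real (nat N choose nat k))"

text \<open>Under the square root, (j + 1) (n choose j + 1) = (n - j) (n choose j) turns both
  neighbour terms into multiples of \<open>coherent N k\<close>. The multiples are (n - j) / (n + 1)
  and j / (n + 1), and their difference cancels the position.\<close>

lemma Aop_coherent:
  assumes k: "0 \<le> k" "k \<le> N"
  shows "Aop N 1 (\<lambda>k. of_real (coherent N k)) k = 0"
proof -
  obtain n where n: "N = int n" using k by (metis nonneg_int_cases order_trans)
  obtain j where j: "k = int j" using k by (metis nonneg_int_cases)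
  have jn: "j \<le> n" using k n j by simp
  have up: "wt N (k + 1) * coherent N (k + 1) = (real n - real j) / (real n + 1) * coherent N k"
  proof (cases "j = n")
    case True
    thus ?thesis using n j by simp
  next
    case False
    hence jn': "Suc j \<le> n" using jn by simp
    have "Suc j * (n choose Suc j) = (n - j) * (n choose j)"
      using choose_mult_lemma jn' by (metis Suc_diff_le binomial_absorb_comp binomial_absorption diff_Suc_Suc mult.commute Suc_le_D diff_Suc_1 binomial_absorption)
    hence c: "real (Suc j) * real (n choose Suc j) = (real n - real j) * real (n choose j)"
      using jn by (metis of_nat_diff of_nat_mult)
    have "wt N (k + 1) * coherent N (k + 1) = sqrt ((real j + 1) * (real n - real j) * real (n choose Suc j)) / (real n + 1)"
      using jn' n j by (simp add: wt_def coherent_def real_sqrt_mult nat_add_distrib mult_ac)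
    also have "(real j + 1) * (real n - real j) * real (n choose Suc j)
        = (real n - real j) * (real (Suc j) * real (n choose Suc j))" by simp
    also have "\<dots> = (real n - real j)\<^sup>2 * real (n choose j)"
      unfolding c by (simp add: power2_eq_square)
    also have "sqrt \<dots> = (real n - real j) * coherent N k"
      using jn n j by (simp add: real_sqrt_mult coherent_def)
    finally show ?thesis by simp
  qed
  have down: "wt N k * coherent N (k - 1) = real j / (real n + 1) * coherent N k"
  proof (cases j)
    case 0
    thus ?thesis using j by simp
  next
    case (Suc i)
    have "Suc i * (n choose Suc i) = (n - i) * (n choose i)"
      using jn Suc by (metis Suc_diff_le binomial_absorb_comp binomial_absorption diff_Suc_Suc mult.commute Suc_le_D diff_Suc_1)
    hence c: "real (Suc i) * real (n choose Suc i) = (real n - real i) * real (n choose i)"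
      using jn Suc by (metis Suc_leD of_nat_diff of_nat_mult)
    have "wt N k * coherent N (k - 1) = sqrt ((real i + 1) * (real n - real i) * real (n choose i)) / (real n + 1)"
      using jn n j Suc by (simp add: wt_def coherent_def real_sqrt_mult mult_ac)
    also have "(real i + 1) * (real n - real i) * real (n choose i)
        = (real i + 1) * ((real n - real i) * real (n choose i))" by simp
    also have "\<dots> = (real i + 1)\<^sup>2 * real (n choose Suc i)"
      unfolding c[symmetric] by (simp add: power2_eq_square)
    also have "sqrt \<dots> = (real i + 1) * coherent N k"
      using n j Suc by (simp add: real_sqrt_mult coherent_def nat_add_distrib)
    finally show ?thesis using Suc by simp
  qed
  have "spin_pos N k * coherent N k + (wt N (k + 1) * coherent N (k + 1) - wt N k * coherent N (k - 1)) = 0"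
    unfolding up down using n j by (simp add: spin_pos_def diff_divide_distrib algebra_simps)
  from arg_cong[OF this, of complex_of_real] show ?thesis
    by (simp add: Aop_def Dop_def)
qed

text \<open>The weights inside the interval are positive, so the recursion determines
  \<open>f\<close> from \<open>f 0\<close>. This one-dimensional kernel is the reason why only one
  eigenvalue crosses 0.\<close>

lemma Aop_kernel_unique:
  assumes A: "\<And>k. 0 \<le> k \<Longrightarrow> k \<le> N \<Longrightarrow> Aop N 1 f k = 0"
    and k: "0 \<le> k" "k \<le> N"
  shows "f k = f 0 * of_real (coherent N k)"
  using k
proof (induction k rule: int_ge_induct)
  case base
  show ?case by (simp add: coherent_def)
next
  case (step i)
  hence i: "0 \<le> i" "i \<le> N" by auto
  have f: "of_real (wt N (i + 1)) * f (i + 1) = of_real ((N - i) / (N + 1)) * f i"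
    using Aop_kernel(1)[OF A _ i] by simp
  have v: "of_real (wt N (i + 1)) * of_real (coherent N (i + 1))
      = complex_of_real ((N - i) / (N + 1)) * of_real (coherent N i)"
    using Aop_kernel(1)[OF Aop_coherent _ i] by simp
  have "of_real (wt N (i + 1)) * f (i + 1) = f 0 * (complex_of_real ((N - i) / (N + 1)) * of_real (coherent N i))"
    unfolding f using step by simp
  also have "\<dots> = of_real (wt N (i + 1)) * (f 0 * of_real (coherent N (i + 1)))"
    unfolding v[symmetric] by simp
  finally show ?case using wt_pos[of "i + 1" N] step by simp
qed

section \<open>Adjoints on the interval {0..N}\<close>

lemma sum_shift_int:
  fixes F :: "int \<Rightarrow> complex"
  assumes "0 \<le> N" "F 0 = 0" "F (N + 1) = 0"
  shows "(\<Sum>k\<in>{0..N}. F (k + 1)) = (\<Sum>k\<in>{0..N}. F k)"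
proof -
  have z: "F i = 0" if "i \<in> {0..N + 1} - {1..N + 1}" for i
    using that assms by (cases "i = 0") auto
  have z': "F i = 0" if "i \<in> {0..N + 1} - {0..N}" for i
    using that assms by (cases "i = N + 1") auto
  have "(\<Sum>k\<in>{0..N}. F (k + 1)) = (\<Sum>k\<in>{1..N + 1}. F k)"
    by (rule sum.reindex_bij_witness[of _ "\<lambda>k. k - 1" "\<lambda>k. k + 1"]) auto
  also have "\<dots> = (\<Sum>k\<in>{0..N + 1}. F k)"
    by (rule sum.mono_neutral_left) (use z in auto)
  also have "\<dots> = (\<Sum>k\<in>{0..N}. F k)"
    by (rule sum.mono_neutral_right) (use z' in auto)
  finally show ?thesis .
qed

text \<open>There are no boundary terms: the weights at 0 and N + 1 vanish, so values of
  \<open>f\<close> and \<open>g\<close> outside the interval do not enter.\<close>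

lemma shift_adjoint:
  assumes "0 \<le> N"
  shows "(\<Sum>k\<in>{0..N}. cnj (of_real (wt N (k + 1)) * f (k + 1)) * g k)
    = (\<Sum>k\<in>{0..N}. cnj (f k) * (of_real (wt N k) * g (k - 1)))"
  using sum_shift_int[OF assms, of "\<lambda>k. cnj (f k) * (of_real (wt N k) * g (k - 1))"]
  by (simp add: mult_ac)

lemma shift_adjoint':
  assumes "0 \<le> N"
  shows "(\<Sum>k\<in>{0..N}. cnj (of_real (wt N k) * f (k - 1)) * g k)
    = (\<Sum>k\<in>{0..N}. cnj (f k) * (of_real (wt N (k + 1)) * g (k + 1)))"
  using sum_shift_int[OF assms, of "\<lambda>k. cnj (f (k - 1)) * (of_real (wt N k) * g k)"]
  by (simp add: mult_ac)

lemma Zop_adjoint: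
  assumes "0 \<le> N"
  shows "(\<Sum>k\<in>{0..N}. cnj (Zop N f k) * g k) = (\<Sum>k\<in>{0..N}. cnj (f k) * Zop N g k)"
  using shift_adjoint[OF assms, of f g] shift_adjoint'[OF assms, of f g]
  by (simp add: Zop_def ring_distribs sum.distrib)

lemma Aop_adjoint:
  assumes "0 \<le> N"
  shows "(\<Sum>k\<in>{0..N}. cnj (Aop N s f k) * g k) = (\<Sum>k\<in>{0..N}. cnj (f k) * Aop N (- s) g k)"
proof -
  have "(\<Sum>k\<in>{0..N}. cnj (Dop N f k) * g k) = - (\<Sum>k\<in>{0..N}. cnj (f k) * Dop N g k)"
    using shift_adjoint[OF assms, of f g] shift_adjoint'[OF assms, of f g]
    by (simp add: Dop_def ring_distribs sum.distrib sum_subtractf)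
  from arg_cong[OF this, of "(*) (of_real s)"] show ?thesis
    by (simp add: Aop_def ring_distribs sum.distrib sum_distrib_left mult_ac sum_negf sum_subtractf)
qed

lemma Top_adjoint:
  assumes "0 \<le> N"
  shows "(\<Sum>k\<in>{0..N}. cnj (Top N s f k) * g k) = (\<Sum>k\<in>{0..N}. cnj (f k) * Top N s g k)"
  using Zop_adjoint[OF assms, of f g]
  by (simp add: Top_def ring_distribs sum.distrib mult_ac)

text \<open>The ladder step s h is exactly the difference between the shifts by s h/2 and - s
  h/2.\<close>

lemma Top_Aop:
  assumes k: "0 \<le> k" "k \<le> N" and s: "s = 1 \<or> s = -1"
  shows "Top N s (Aop N (- s) f) k = Aop N (- s) (Top N (- s) f) k"
proof -
  have R: "Aop N (- s) (Top N (- s) f) k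
      = Aop N (- s) (Zop N f) k + of_real (- s * spin_step N / 2) * Aop N (- s) f k"
    by (simp add: Top_def Aop_def Dop_def algebra_simps)
  have Z: "Zop N (Aop N (- s) f) k = Aop N (- s) (Zop N f) k + of_real (- s * spin_step N) * Aop N (- s) f k"
    by (rule Zop_Aop[OF k]) (use s in auto)
  show ?thesis
    unfolding R unfolding Top_def Z by (simp add: field_simps)
qed

section \<open>Two tensor factors\<close>

definition op1 :: "((int \<Rightarrow> complex) \<Rightarrow> int \<Rightarrow> complex) \<Rightarrow> (int \<Rightarrow> int \<Rightarrow> complex) \<Rightarrow> int \<Rightarrow> int \<Rightarrow> complex" where
  "op1 P f k l = P (\<lambda>k. f k l) k"

definition op2 :: "((int \<Rightarrow> complex) \<Rightarrow> int \<Rightarrow> complex) \<Rightarrow> (int \<Rightarrow> int \<Rightarrow> complex) \<Rightarrow> int \<Rightarrow> int \<Rightarrow> complex" where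
  "op2 P f k l = P (f k) l"

definition cip2 :: "int \<Rightarrow> (int \<Rightarrow> int \<Rightarrow> complex) \<Rightarrow> (int \<Rightarrow> int \<Rightarrow> complex) \<Rightarrow> complex" where
  "cip2 N f g = (\<Sum>k\<in>{0..N}. \<Sum>l\<in>{0..N}. cnj (f k l) * g k l)"

definition Cop :: "int \<Rightarrow> real \<Rightarrow> real \<Rightarrow> real \<Rightarrow> (int \<Rightarrow> int \<Rightarrow> complex) \<Rightarrow> int \<Rightarrow> int \<Rightarrow> complex" where
  "Cop N \<kappa> s1 s2 f k l = of_real \<kappa> * (op1 (Top N s1) f k l + op2 (Top N s2) f k l) - f k l"

lemma op2_apply: "op2 P f k = P (f k)"
  by (simp add: op2_def fun_eq_iff)

lemma cip2_add: "cip2 N (\<lambda>k l. f k l + g k l) h = cip2 N f h + cip2 N g h"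
    "cip2 N f (\<lambda>k l. g k l + h k l) = cip2 N f g + cip2 N f h"
  by (simp_all add: cip2_def ring_distribs sum.distrib)

lemma cip2_diff: "cip2 N (\<lambda>k l. f k l - g k l) h = cip2 N f h - cip2 N g h"
    "cip2 N f (\<lambda>k l. g k l - h k l) = cip2 N f g - cip2 N f h"
  by (simp_all add: cip2_def ring_distribs sum_subtractf)

lemma cip2_minus: "cip2 N (\<lambda>k l. - f k l) h = - cip2 N f h" "cip2 N f (\<lambda>k l. - g k l) = - cip2 N f g"
  by (simp_all add: cip2_def sum_negf)

lemma cip2_scale: "cip2 N (\<lambda>k l. c * f k l) h = cnj c * cip2 N f h"
    "cip2 N f (\<lambda>k l. c * g k l) = c * cip2 N f g"
  by (simp_all add: cip2_def sum_distrib_left mult_ac)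

lemmas cip2_linear = cip2_add cip2_diff cip2_minus cip2_scale

lemma cnj_cip2: "cnj (cip2 N f g) = cip2 N g f"
  by (simp add: cip2_def mult.commute)

lemma cip2_cong: "(\<And>k l. 0 \<le> k \<Longrightarrow> k \<le> N \<Longrightarrow> 0 \<le> l \<Longrightarrow> l \<le> N \<Longrightarrow> g k l = g' k l) \<Longrightarrow> cip2 N f g = cip2 N f g'"
  by (simp add: cip2_def)

lemma cip2_self: "cip2 N f f = of_real (\<Sum>k\<in>{0..N}. \<Sum>l\<in>{0..N}. (cmod (f k l))\<^sup>2)"
  unfolding cip2_def of_real_sum complex_norm_square by (simp only: mult.commute)

lemma Re_cip2_self: "0 \<le> Re (cip2 N f f)"
  unfolding cip2_self by (simp add: sum_nonneg)

lemma cip2_self_eq_0: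
  assumes "Re (cip2 N f f) = 0" "0 \<le> k" "k \<le> N" "0 \<le> l" "l \<le> N"
  shows "f k l = 0"
proof -
  have "(\<Sum>k\<in>{0..N}. \<Sum>l\<in>{0..N}. (cmod (f k l))\<^sup>2) = 0"
    using assms(1) unfolding cip2_self by simp
  hence "(\<Sum>l\<in>{0..N}. (cmod (f k l))\<^sup>2) = 0"
    using assms by (subst (asm) sum_nonneg_eq_0_iff) (auto intro: sum_nonneg)
  hence "(cmod (f k l))\<^sup>2 = 0"
    using assms by (subst (asm) sum_nonneg_eq_0_iff) auto
  thus ?thesis by simp
qed

lemma op1_adjoint:
  assumes "\<And>f g. (\<Sum>k\<in>{0..N}. cnj (P f k) * g k) = (\<Sum>k\<in>{0..N}. cnj (f k) * Q g k)"
  shows "cip2 N (op1 P f) g = cip2 N f (op1 Q g)"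
proof -
  have "cip2 N (op1 P f) g = (\<Sum>l\<in>{0..N}. \<Sum>k\<in>{0..N}. cnj (P (\<lambda>k. f k l) k) * g k l)"
    unfolding cip2_def op1_def by (rule sum.swap)
  also have "\<dots> = (\<Sum>l\<in>{0..N}. \<Sum>k\<in>{0..N}. cnj (f k l) * Q (\<lambda>k. g k l) k)"
    by (intro sum.cong refl assms)
  also have "\<dots> = cip2 N f (op1 Q g)"
    unfolding cip2_def op1_def by (rule sum.swap)
  finally show ?thesis .
qed

lemma op2_adjoint:
  assumes "\<And>f g. (\<Sum>k\<in>{0..N}. cnj (P f k) * g k) = (\<Sum>k\<in>{0..N}. cnj (f k) * Q g k)"
  shows "cip2 N (op2 P f) g = cip2 N f (op2 Q g)"
  unfolding cip2_def op2_def by (intro sum.cong refl assms)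

text \<open>The common form of \<open>Aop\<close> and \<open>Top\<close>; it yields linearity and
  the commutation of operators that act on different variables.\<close>

definition stencil :: "((int \<Rightarrow> complex) \<Rightarrow> int \<Rightarrow> complex) \<Rightarrow> bool" where
  "stencil P \<longleftrightarrow> (\<exists>a b c. \<forall>f k. P f k = a k * f k + b k * f (k + 1) + c k * f (k - 1))"

lemma stencil_Aop: "stencil (Aop N s)"
  unfolding stencil_def Aop_def Dop_def
  by (rule exI[of _ "\<lambda>k. of_real (spin_pos N k)"], rule exI[of _ "\<lambda>k. of_real (s * wt N (k + 1))"],
      rule exI[of _ "\<lambda>k. - of_real (s * wt N k)"]) (simp add: algebra_simps)

lemma stencil_Top: "stencil (Top N s)"
  unfolding stencil_def Top_def Zop_def
  by (rule exI[of _ "\<lambda>k. of_real (s * spin_step N / 2)"], rule exI[of _ "\<lambda>k. of_real (wt N (k + 1))"],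
      rule exI[of _ "\<lambda>k. of_real (wt N k)"]) (simp add: algebra_simps)

lemma op1_op2_commute:
  assumes "stencil P" "stencil Q"
  shows "op1 P (op2 Q f) = op2 Q (op1 P f)"
proof -
  obtain a b c where P: "\<And>f k. P f k = a k * f k + b k * f (k + 1) + c k * f (k - 1)"
    using assms(1) unfolding stencil_def by blast
  obtain a' b' c' where Q: "\<And>f k. Q f k = a' k * f k + b' k * f (k + 1) + c' k * f (k - 1)"
    using assms(2) unfolding stencil_def by blast
  show ?thesis by (intro ext) (simp add: op1_def op2_def P Q algebra_simps)
qed

lemma stencil_lin:
  assumes "stencil P"
  shows "op1 P (\<lambda>k l. c * f k l + g k l) k l = c * op1 P f k l + op1 P g k l"
    and "op2 P (\<lambda>k l. c * f k l + g k l) k l = c * op2 P f k l + op2 P g k l"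
proof -
  obtain a b d where P: "\<And>f k. P f k = a k * f k + b k * f (k + 1) + d k * f (k - 1)"
    using assms(1) unfolding stencil_def by blast
  show "op1 P (\<lambda>k l. c * f k l + g k l) k l = c * op1 P f k l + op1 P g k l"
    and "op2 P (\<lambda>k l. c * f k l + g k l) k l = c * op2 P f k l + op2 P g k l"
    by (simp_all add: op1_def op2_def P algebra_simps)
qed

lemma stencil_add:
  assumes "stencil P"
  shows "op1 P (\<lambda>k l. f k l + g k l) k l = op1 P f k l + op1 P g k l"
    and "op2 P (\<lambda>k l. f k l + g k l) k l = op2 P f k l + op2 P g k l"
  using stencil_lin[OF assms, of 1 f g k l] by simp_all

lemma stencil_diff:
  assumes "stencil P"
  shows "op1 P (\<lambda>k l. f k l - g k l) k l = op1 P f k l - op1 P g k l"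
    and "op2 P (\<lambda>k l. f k l - g k l) k l = op2 P f k l - op2 P g k l"
  using stencil_lin[OF assms, of "-1" g f k l] by simp_all

lemma stencil_scale:
  assumes "stencil P"
  shows "op1 P (\<lambda>k l. c * f k l) k l = c * op1 P f k l"
    and "op2 P (\<lambda>k l. c * f k l) k l = c * op2 P f k l"
  using stencil_lin[OF assms, of c f "\<lambda>_ _. 0" k l] stencil_lin[OF assms, of 1 "\<lambda>_ _. 0" "\<lambda>_ _. 0" k l]
  by simp_all

lemma Cop_adjoint: "0 \<le> N \<Longrightarrow> cip2 N (Cop N \<kappa> s1 s2 f) g = cip2 N f (Cop N \<kappa> s1 s2 g)"
  using op1_adjoint[OF Top_adjoint, of N s1 f g] op2_adjoint[OF Top_adjoint, of N s2 f g]
  by (simp add: Cop_def[abs_def] cip2_linear)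

lemma Aop_adjoint2:
  "0 \<le> N \<Longrightarrow> cip2 N (op1 (Aop N s) f) g = cip2 N f (op1 (Aop N (- s)) g)"
  "0 \<le> N \<Longrightarrow> cip2 N (op2 (Aop N s) f) g = cip2 N f (op2 (Aop N (- s)) g)"
  by (rule op1_adjoint op2_adjoint, rule Aop_adjoint, assumption)+

lemma Cop_Aop:
  assumes "0 \<le> k" "k \<le> N" "0 \<le> l" "l \<le> N" and s: "s = 1 \<or> s = -1"
  shows "Cop N \<kappa> s s' (op1 (Aop N (- s)) g) k l = op1 (Aop N (- s)) (Cop N \<kappa> (- s) s' g) k l"
    and "Cop N \<kappa> s' s (op2 (Aop N (- s)) g) k l = op2 (Aop N (- s)) (Cop N \<kappa> s' (- s) g) k l"
proof -
  have 1: "op1 (Top N s) (op1 (Aop N (- s)) g) k l = op1 (Aop N (- s)) (op1 (Top N (- s)) g) k l"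
    using Top_Aop[OF assms(1,2) s] by (simp add: op1_def)
  have 2: "op2 (Top N s) (op2 (Aop N (- s)) g) k l = op2 (Aop N (- s)) (op2 (Top N (- s)) g) k l"
    using Top_Aop[OF assms(3,4) s] by (simp add: op2_apply)
  have c1: "op2 (Top N s') (op1 (Aop N (- s)) g) = op1 (Aop N (- s)) (op2 (Top N s') g)"
    by (rule op1_op2_commute[symmetric]) (rule stencil_Aop stencil_Top)+
  have c2: "op1 (Top N s') (op2 (Aop N (- s)) g) = op2 (Aop N (- s)) (op1 (Top N s') g)"
    by (rule op1_op2_commute) (rule stencil_Aop stencil_Top)+
  note lin = stencil_add[OF stencil_Aop] stencil_diff[OF stencil_Aop] stencil_scale[OF stencil_Aop]
  show "Cop N \<kappa> s s' (op1 (Aop N (- s)) g) k l = op1 (Aop N (- s)) (Cop N \<kappa> (- s) s' g) k l"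
    unfolding Cop_def[abs_def] lin c1 1 ..
  show "Cop N \<kappa> s' s (op2 (Aop N (- s)) g) k l = op2 (Aop N (- s)) (Cop N \<kappa> s' (- s) g) k l"
    unfolding Cop_def[abs_def] lin c2 2 ..
qed

text \<open>Moving the ladder operator to the other factor changes \<open>Cop\<close> into that of
  the neighbouring component. Together with \<open>cross_A\<close> this identifies the cross terms
  that cancel in \<open>norm_G\<close>.\<close>

lemma cross_C:
  assumes N: "0 \<le> N" and s: "s = 1 \<or> s = -1"
  shows "cip2 N (Cop N \<kappa> s s' f) (op1 (Aop N (- s)) g) = cip2 N (op1 (Aop N s) f) (Cop N \<kappa> (- s) s' g)"
    and "cip2 N (Cop N \<kappa> s' s f) (op2 (Aop N (- s)) g) = cip2 N (op2 (Aop N s) f) (Cop N \<kappa> s' (- s) g)"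
  unfolding Cop_adjoint[OF N] Aop_adjoint2[OF N]
  by (rule cip2_cong, rule Cop_Aop; use s in simp)+

lemma cross_A:
  assumes N: "0 \<le> N"
  shows "cip2 N (op1 (Aop N s) f) (op2 (Aop N s') g) = cip2 N (op2 (Aop N (- s')) f) (op1 (Aop N (- s)) g)"
  unfolding Aop_adjoint2[OF N] op1_op2_commute[OF stencil_Aop stencil_Aop] minus_minus ..

text \<open>The four components of the localizer of the model, in the basis of
  \<open>\<complex>\<^sup>2 \<otimes> \<complex>\<^sup>2\<close> in which both conserved weights are diagonal; they belong to the signs
  \<open>(+,+)\<close>, \<open>(-,+)\<close>, \<open>(+,-)\<close>, \<open>(-,-)\<close>.\<close>

definition Gp where "Gp N \<kappa> p w r k l = Cop N \<kappa> 1 1 p k l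
  + \<i> * of_real \<kappa> * op1 (Aop N (-1)) w k l + of_real \<kappa> * op2 (Aop N (-1)) r k l"

definition Gw where "Gw N \<kappa> w p q k l = - Cop N \<kappa> (-1) 1 w k l
  - \<i> * of_real \<kappa> * op1 (Aop N 1) p k l - of_real \<kappa> * op2 (Aop N (-1)) q k l"

definition Gr where "Gr N \<kappa> r q p k l = - Cop N \<kappa> 1 (-1) r k l
  + \<i> * of_real \<kappa> * op1 (Aop N (-1)) q k l + of_real \<kappa> * op2 (Aop N 1) p k l"

definition Gq where "Gq N \<kappa> q r w k l = Cop N \<kappa> (-1) (-1) q k l
  - \<i> * of_real \<kappa> * op1 (Aop N 1) r k l - of_real \<kappa> * op2 (Aop N 1) w k l"

text \<open>The form of a diagonal block of the squared localizer, \<open>C\<^sup>2 +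
  \<kappa>\<^sup>2 (A\<^sub>1\<^sup>* A\<^sub>1 + A\<^sub>2\<^sup>* A\<^sub>2)\<close>.\<close>

definition energy where "energy N \<kappa> s1 s2 f
  = cip2 N (Cop N \<kappa> s1 s2 f) (Cop N \<kappa> s1 s2 f)
  + of_real (\<kappa>\<^sup>2) * cip2 N (op1 (Aop N s1) f) (op1 (Aop N s1) f)
  + of_real (\<kappa>\<^sup>2) * cip2 N (op2 (Aop N s2) f) (op2 (Aop N s2) f)"

text \<open>The Clifford relations: all cross terms cancel.\<close>

lemma norm_G:
  assumes N: "0 \<le> N"
  shows "cip2 N (Gp N \<kappa> p w r) (Gp N \<kappa> p w r) + cip2 N (Gw N \<kappa> w p q) (Gw N \<kappa> w p q)
     + cip2 N (Gr N \<kappa> r q p) (Gr N \<kappa> r q p) + cip2 N (Gq N \<kappa> q r w) (Gq N \<kappa> q r w)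
    = energy N \<kappa> 1 1 p + energy N \<kappa> (-1) 1 w + energy N \<kappa> 1 (-1) r + energy N \<kappa> (-1) (-1) q"
proof -
  have X: "cip2 N (Cop N \<kappa> 1 1 p) (op1 (Aop N (-1)) w) = cip2 N (op1 (Aop N 1) p) (Cop N \<kappa> (-1) 1 w)"
    "cip2 N (Cop N \<kappa> 1 1 p) (op2 (Aop N (-1)) r) = cip2 N (op2 (Aop N 1) p) (Cop N \<kappa> 1 (-1) r)"
    "cip2 N (Cop N \<kappa> (-1) (-1) q) (op1 (Aop N 1) r) = cip2 N (op1 (Aop N (-1)) q) (Cop N \<kappa> 1 (-1) r)"
    "cip2 N (Cop N \<kappa> (-1) (-1) q) (op2 (Aop N 1) w) = cip2 N (op2 (Aop N (-1)) q) (Cop N \<kappa> (-1) 1 w)"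
    "cip2 N (op1 (Aop N (-1)) w) (op2 (Aop N (-1)) r) = cip2 N (op2 (Aop N 1) w) (op1 (Aop N 1) r)"
    "cip2 N (op1 (Aop N 1) p) (op2 (Aop N (-1)) q) = cip2 N (op2 (Aop N 1) p) (op1 (Aop N (-1)) q)"
    using cross_C[OF N, of 1 \<kappa> 1 p w] cross_C(2)[OF N, of 1 \<kappa> 1 p r]
      cross_C(1)[OF N, of "-1" \<kappa> "-1" q r] cross_C(2)[OF N, of "-1" \<kappa> "-1" q w]
      cross_A[OF N, of "-1" w "-1" r] cross_A[OF N, of 1 p "-1" q] by simp_all
  note X' = X[THEN arg_cong[of _ _ cnj], unfolded cnj_cip2]
  show ?thesis
    unfolding Gp_def[abs_def] Gw_def[abs_def] Gr_def[abs_def] Gq_def[abs_def] energy_def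
    by (simp add: cip2_linear X X' algebra_simps power2_eq_square)
qed

section \<open>Lower bound and zeros of the energy\<close>

lemma norm_op_Aop:
  assumes N: "0 \<le> N" and s: "s = 1 \<or> s = -1"
  shows "cip2 N (op1 (Aop N s) f) (op1 (Aop N s) g) = cip2 N f g - cip2 N f (op1 (Top N s) (op1 (Top N s) g))"
    and "cip2 N (op2 (Aop N s) f) (op2 (Aop N s) g) = cip2 N f g - cip2 N f (op2 (Top N s) (op2 (Top N s) g))"
proof -
  have "cip2 N f (op1 (Aop N (- s)) (op1 (Aop N s) g))
      = cip2 N f (\<lambda>k l. g k l - op1 (Top N s) (op1 (Top N s) g) k l)"
    by (rule cip2_cong) (use Aop_Aop s in \<open>simp add: op1_def\<close>)
  thus "cip2 N (op1 (Aop N s) f) (op1 (Aop N s) g) = cip2 N f g - cip2 N f (op1 (Top N s) (op1 (Top N s) g))"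
    by (simp add: Aop_adjoint2[OF N] cip2_linear)
  have "cip2 N f (op2 (Aop N (- s)) (op2 (Aop N s) g))
      = cip2 N f (\<lambda>k l. g k l - op2 (Top N s) (op2 (Top N s) g) k l)"
    by (rule cip2_cong) (use Aop_Aop s in \<open>simp add: op2_apply\<close>)
  thus "cip2 N (op2 (Aop N s) f) (op2 (Aop N s) g) = cip2 N f g - cip2 N f (op2 (Top N s) (op2 (Top N s) g))"
    by (simp add: Aop_adjoint2[OF N] cip2_linear)
qed

lemma Top_adjoint2:
  "0 \<le> N \<Longrightarrow> cip2 N (op1 (Top N s) f) g = cip2 N f (op1 (Top N s) g)"
  "0 \<le> N \<Longrightarrow> cip2 N (op2 (Top N s) f) g = cip2 N f (op2 (Top N s) g)"
  by (rule op1_adjoint op2_adjoint, rule Top_adjoint, assumption)+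

text \<open>\<open>2 (1 - T) = (1 - T)\<^sup>2 + A\<^sup>* A\<close> exhibits \<open>1 - T\<close> as a positive operator.\<close>

lemma one_minus_Top:
  assumes N: "0 \<le> N" and s: "s = 1 \<or> s = -1"
  shows "2 * cip2 N f (\<lambda>k l. g k l - op1 (Top N s) g k l)
      = cip2 N (\<lambda>k l. f k l - op1 (Top N s) f k l) (\<lambda>k l. g k l - op1 (Top N s) g k l)
        + cip2 N (op1 (Aop N s) f) (op1 (Aop N s) g)"
    and "2 * cip2 N f (\<lambda>k l. g k l - op2 (Top N s) g k l)
      = cip2 N (\<lambda>k l. f k l - op2 (Top N s) f k l) (\<lambda>k l. g k l - op2 (Top N s) g k l)
        + cip2 N (op2 (Aop N s) f) (op2 (Aop N s) g)"
  by (simp_all add: norm_op_Aop[OF N s] cip2_linear Top_adjoint2[OF N])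

lemma one_minus_Top2_nonneg:
  assumes N: "0 \<le> N" and s: "s = 1 \<or> s = -1"
  shows "0 \<le> Re (cip2 N f (\<lambda>k l. f k l - op2 (Top N s) f k l))"
proof -
  have "2 * Re (cip2 N f (\<lambda>k l. f k l - op2 (Top N s) f k l))
     = Re (2 * cip2 N f (\<lambda>k l. f k l - op2 (Top N s) f k l))" by simp
  also have "\<dots> \<ge> 0" unfolding one_minus_Top(2)[OF N s] by (simp add: Re_cip2_self)
  finally show ?thesis by simp
qed

text \<open>A product of commuting positive operators is positive: \<open>one_minus_Top\<close>
  writes \<open>1 - T\<^sub>1\<close> through squares of operators in the first variable, and these
  commute with \<open>1 - T\<^sub>2\<close>.\<close>

lemma product_nonneg:
  assumes N: "0 \<le> N" and s: "s = 1 \<or> s = -1" "s' = 1 \<or> s' = -1"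
  shows "0 \<le> Re (cip2 N f (\<lambda>k l. (f k l - op2 (Top N s') f k l)
    - op1 (Top N s) (\<lambda>k l. f k l - op2 (Top N s') f k l) k l))"
proof -
  let ?g = "\<lambda>k l. f k l - op2 (Top N s') f k l"
  have c: "op1 P (op2 (Top N s') f) k l = op2 (Top N s') (op1 P f) k l" if "stencil P" for P k l
    by (simp add: op1_op2_commute[OF that stencil_Top])
  have a: "(\<lambda>k l. ?g k l - op1 (Top N s) ?g k l)
      = (\<lambda>k l. (f k l - op1 (Top N s) f k l) - op2 (Top N s') (\<lambda>k l. f k l - op1 (Top N s) f k l) k l)"
    by (simp add: stencil_diff[OF stencil_Top] c[OF stencil_Top] fun_eq_iff)
  have b: "op1 (Aop N s) ?g
      = (\<lambda>k l. op1 (Aop N s) f k l - op2 (Top N s') (op1 (Aop N s) f) k l)"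
    by (intro ext) (simp add: stencil_diff[OF stencil_Aop] c[OF stencil_Aop])
  have "0 \<le> Re (2 * cip2 N f (\<lambda>k l. ?g k l - op1 (Top N s) ?g k l))"
    unfolding one_minus_Top(1)[OF N s(1)] unfolding a b
    using one_minus_Top2_nonneg[OF N s(2)] by simp
  thus ?thesis by simp
qed

text \<open>At \<kappa> = 1 the energy is the form of
  \<open>1 + 2 (1 - T\<^sub>1) (1 - T\<^sub>2)\<close>. Thanks to the shifts the classical identity
  holds without error, so the bound does not depend on \<open>N\<close>.\<close>

lemma energy_lower:
  assumes N: "0 \<le> N" and s: "s = 1 \<or> s = -1" "s' = 1 \<or> s' = -1"
  shows "Re (cip2 N f f) \<le> Re (energy N 1 s s' f)"
proof -
  have c: "op1 (Top N s) (op2 (Top N s') f) k l = op2 (Top N s') (op1 (Top N s) f) k l" for k l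
    by (simp add: op1_op2_commute[OF stencil_Top stencil_Top])
  have c': "op1 (Top N s) (op2 (Top N s') f) = op2 (Top N s') (op1 (Top N s) f)"
    by (simp add: op1_op2_commute[OF stencil_Top stencil_Top])
  have "energy N 1 s s' f = cip2 N f f + 2 * cip2 N f (\<lambda>k l. (f k l - op2 (Top N s') f k l)
    - op1 (Top N s) (\<lambda>k l. f k l - op2 (Top N s') f k l) k l)"
    unfolding energy_def norm_op_Aop[OF N s(1)] norm_op_Aop[OF N s(2)] Cop_adjoint[OF N]
    by (simp add: Cop_def[abs_def] cip2_linear stencil_add[OF stencil_Top] stencil_diff[OF stencil_Top]
        Top_adjoint2[OF N] c c' algebra_simps)
  thus ?thesis using product_nonneg[OF N s, of f] by simp
qed

lemma energy_nonneg: "0 \<le> Re (energy N \<kappa> s1 s2 f)"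
  by (simp add: energy_def Re_cip2_self flip: of_real_power)

lemma energy_eq_0:
  assumes "Re (energy N \<kappa> s1 s2 f) = 0" "0 \<le> k" "k \<le> N" "0 \<le> l" "l \<le> N"
  shows "Cop N \<kappa> s1 s2 f k l = 0" "\<kappa> \<noteq> 0 \<Longrightarrow> op1 (Aop N s1) f k l = 0" "\<kappa> \<noteq> 0 \<Longrightarrow> op2 (Aop N s2) f k l = 0"
proof -
  let ?a = "Re (cip2 N (Cop N \<kappa> s1 s2 f) (Cop N \<kappa> s1 s2 f))"
  let ?b = "Re (cip2 N (op1 (Aop N s1) f) (op1 (Aop N s1) f))"
  let ?c = "Re (cip2 N (op2 (Aop N s2) f) (op2 (Aop N s2) f))"
  have "Re (energy N \<kappa> s1 s2 f) = ?a + \<kappa>\<^sup>2 * ?b + \<kappa>\<^sup>2 * ?c"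
    by (simp add: energy_def flip: of_real_power)
  moreover have "0 \<le> ?a" "0 \<le> \<kappa>\<^sup>2 * ?b" "0 \<le> \<kappa>\<^sup>2 * ?c" by (simp_all add: Re_cip2_self)
  ultimately have z: "?a = 0" "\<kappa>\<^sup>2 * ?b = 0" "\<kappa>\<^sup>2 * ?c = 0" using assms(1) by linarith+
  show "Cop N \<kappa> s1 s2 f k l = 0" using cip2_self_eq_0[OF z(1) assms(2-)] .
  show "op1 (Aop N s1) f k l = 0" if "\<kappa> \<noteq> 0" using cip2_self_eq_0[OF _ assms(2-), of "op1 (Aop N s1) f"] z(2) that by simp
  show "op2 (Aop N s2) f k l = 0" if "\<kappa> \<noteq> 0" using cip2_self_eq_0[OF _ assms(2-), of "op2 (Aop N s2) f"] z(3) that by simp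
qed

lemma Cop_kernel:
  assumes A1: "\<And>k l. 0 \<le> k \<Longrightarrow> k \<le> N \<Longrightarrow> 0 \<le> l \<Longrightarrow> l \<le> N \<Longrightarrow> op1 (Aop N s1) f k l = 0"
    and A2: "\<And>k l. 0 \<le> k \<Longrightarrow> k \<le> N \<Longrightarrow> 0 \<le> l \<Longrightarrow> l \<le> N \<Longrightarrow> op2 (Aop N s2) f k l = 0"
    and s: "s1 = 1 \<or> s1 = -1" "s2 = 1 \<or> s2 = -1"
    and kl: "0 \<le> k" "k \<le> N" "0 \<le> l" "l \<le> N"
  shows "Cop N \<kappa> s1 s2 f k l = of_real (\<kappa> * (s1 + s2) - 1) * f k l"
proof -
  have "op1 (Top N s1) f k l = of_real s1 * f k l"
    unfolding op1_def by (rule Top_kernel[OF _ s(1) kl(1,2)]) (use A1 kl in \<open>simp add: op1_def\<close>)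
  moreover have "op2 (Top N s2) f k l = of_real s2 * f k l"
    unfolding op2_def by (rule Top_kernel[OF _ s(2) kl(3,4)]) (use A2 kl in \<open>simp add: op2_def\<close>)
  ultimately show ?thesis by (simp add: Cop_def algebra_simps)
qed

text \<open>On the common kernel of both ladder operators \<open>Cop\<close> acts as \<kappa> (s1 +
  s2) - 1, which is negative here. Only the component (+,+) can have zero energy.\<close>

lemma energy_0_imp_0:
  assumes e: "Re (energy N \<kappa> s1 s2 f) = 0" and \<kappa>: "0 \<le> \<kappa>"
    and s: "s1 = 1 \<or> s1 = -1" "s2 = 1 \<or> s2 = -1" "s1 + s2 \<le> 0"
    and kl: "0 \<le> k" "k \<le> N" "0 \<le> l" "l \<le> N"
  shows "f k l = 0"
proof (cases "\<kappa> = 0")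
  case True
  thus ?thesis using energy_eq_0(1)[OF e kl] by (simp add: Cop_def)
next
  case False
  have "of_real (\<kappa> * (s1 + s2) - 1) * f k l = 0"
    using Cop_kernel[OF energy_eq_0(2,3)[OF e] s(1,2) kl, of \<kappa>] energy_eq_0(1)[OF e kl] False by simp
  moreover have "\<kappa> * (s1 + s2) - 1 < 0"
    using mult_nonneg_nonpos[OF \<kappa> s(3)] by linarith
  ultimately show ?thesis by (metis less_irrefl mult_eq_0_iff of_real_eq_0_iff)
qed

lemma energy_0_imp_coherent:
  assumes e: "Re (energy N \<kappa> 1 1 f) = 0"
    and kl: "0 \<le> k" "k \<le> N" "0 \<le> l" "l \<le> N"
  shows "f k l = f 0 0 * (of_real (coherent N k) * of_real (coherent N l))"
proof (cases "\<kappa> = 0")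
  case True
  \<comment> \<open>At \<kappa> = 0 the ladder operators drop out of the energy, but
    \<open>Cop\<close> is minus the identity, so both sides are 0.\<close>
  thus ?thesis using energy_eq_0(1)[OF e kl] energy_eq_0(1)[OF e, of 0 0] kl by (simp add: Cop_def)
next
  case False
  have "f k l = f 0 l * of_real (coherent N k)"
    by (rule Aop_kernel_unique[of N "\<lambda>k. f k l", OF _ kl(1,2)])
      (use energy_eq_0(2)[OF e _ _ kl(3,4) False] in \<open>simp add: op1_def\<close>)
  moreover have "f 0 l = f 0 0 * of_real (coherent N l)"
    by (rule Aop_kernel_unique[of N "f 0", OF _ kl(3,4)])
      (use energy_eq_0(3)[OF e, of 0] kl False in \<open>simp add: op2_def\<close>)
  ultimately show ?thesis by simp
qed

lemma Aop_coherent2: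
  assumes "0 \<le> k" "k \<le> N" "0 \<le> l" "l \<le> N"
  shows "op1 (Aop N 1) (\<lambda>k l. c * (of_real (coherent N k) * of_real (coherent N l))) k l = 0"
    and "op2 (Aop N 1) (\<lambda>k l. c * (of_real (coherent N k) * of_real (coherent N l))) k l = 0"
proof -
  have lin: "Aop N 1 (\<lambda>k. a * f k) k = a * Aop N 1 f k" for a f k
    by (simp add: Aop_def Dop_def algebra_simps)
  have "(\<lambda>k. c * (of_real (coherent N k) * of_real (coherent N l))) = (\<lambda>k. (c * of_real (coherent N l)) * of_real (coherent N k))"
    by (simp add: fun_eq_iff)
  thus "op1 (Aop N 1) (\<lambda>k l. c * (of_real (coherent N k) * of_real (coherent N l))) k l = 0"
    unfolding op1_def using lin Aop_coherent assms by simp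
  have "(\<lambda>l. c * (of_real (coherent N k) * of_real (coherent N l))) = (\<lambda>l. (c * of_real (coherent N k)) * of_real (coherent N l))"
    by (simp add: fun_eq_iff)
  thus "op2 (Aop N 1) (\<lambda>k l. c * (of_real (coherent N k) * of_real (coherent N l))) k l = 0"
    unfolding op2_def using lin Aop_coherent assms by simp
qed

lemma Cop_coherent2:
  assumes kl: "0 \<le> k" "k \<le> N" "0 \<le> l" "l \<le> N"
  shows "Cop N \<kappa> 1 1 (\<lambda>k l. c * (of_real (coherent N k) * of_real (coherent N l))) k l
    = of_real (2 * \<kappa> - 1) * (c * (of_real (coherent N k) * of_real (coherent N l)))"
proof -
  have "Cop N \<kappa> 1 1 (\<lambda>k l. c * (of_real (coherent N k) * of_real (coherent N l))) k l
      = of_real (\<kappa> * (1 + 1) - 1) * (c * (of_real (coherent N k) * of_real (coherent N l)))"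
    by (rule Cop_kernel) (use kl in \<open>auto simp: Aop_coherent2\<close>)
  thus ?thesis by (simp add: mult.commute)
qed

section \<open>The model Hamiltonian\<close>

text \<open>A site \<open>(k, l, a)\<close> consists of a point of the square and an index \<open>a\<close> for
  \<open>\<complex>\<^sup>2\<close>, on which the Pauli matrices \<open>\<tau>\<^sub>i\<close> act.\<close>

type_synonym site = "int \<times> int \<times> bool"

definition core :: "int \<Rightarrow> site set" where
  "core N = {0..N} \<times> {0..N} \<times> UNIV"

definition zmat :: "int \<Rightarrow> int \<Rightarrow> int \<Rightarrow> complex" where
  "zmat N k k' = (if k' = k + 1 then of_real (wt N (k + 1)) else 0) + (if k' = k - 1 then of_real (wt N k) else 0)"

definition dmat :: "int \<Rightarrow> int \<Rightarrow> int \<Rightarrow> complex" where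
  "dmat N k k' = (if k' = k + 1 then of_real (wt N (k + 1)) else 0) - (if k' = k - 1 then of_real (wt N k) else 0)"

definition idmat :: "int \<Rightarrow> int \<Rightarrow> complex" where
  "idmat k k' = (if k' = k then 1 else 0)"

text \<open>With \<open>Y = - \<i> D\<close> these are the entries of the Hamiltonian of the
  overview, where \<open>False\<close> labels the first basis vector of
  \<open>\<complex>\<^sup>2\<close>; \<kappa> scales Y and Z but not the constant 1.\<close>

definition hmat :: "int \<Rightarrow> real \<Rightarrow> site \<Rightarrow> site \<Rightarrow> complex" where
  "hmat N \<kappa> = (\<lambda>(k, l, a) (k', l', b).
     if a = b then (if a then -1 else 1) *
       (of_real \<kappa> * (zmat N k k' * idmat l l' + idmat k k' * zmat N l l') - idmat k k' * idmat l l')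
     else of_real \<kappa> * (- \<i> * (dmat N k k' * idmat l l')
       + (if a then 1 else -1) * (idmat k k' * dmat N l l')))"

definition Hf :: "int \<Rightarrow> real \<Rightarrow> site \<Rightarrow> site \<Rightarrow> complex" where
  "Hf N \<kappa> s t = (if s \<in> core N \<and> t \<in> core N then hmat N \<kappa> s t else if s = t then 1 else 0)"

definition pos :: "int \<Rightarrow> site \<Rightarrow> complex" where
  "pos N = (\<lambda>(k, l, a). of_real (spin_pos N k) - \<i> * of_real (spin_pos N l))"

text \<open>Only the core is scaled. Outside, \<open>Hf\<close> is the identity and keeps the
  localizer invertible at every position.\<close>

definition Wf :: "int \<Rightarrow> real \<Rightarrow> site \<Rightarrow> complex" where
  "Wf N \<kappa> s = (if s \<in> core N then of_real \<kappa> * pos N s else pos N s)"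

text \<open>\<open>Kf\<close> accounts for the shifts by \<open>h/2\<close> in \<open>Top\<close>; it makes the eigenvalue of \<open>v0\<close> exact
  and is negligible for large \<open>N\<close>.\<close>

definition Kf :: "int \<Rightarrow> site \<times> bool \<Rightarrow> site \<times> bool \<Rightarrow> complex" where
  "Kf N = (\<lambda>((k, l, a), c) ((k', l', b), d).
     if (k, l, a) \<in> core N \<and> k' = k \<and> l' = l \<and> a = c \<and> b = d \<and> b \<noteq> a
     then (if a then - \<i> else \<i>) * of_real (spin_step N) else 0)"

definition Gf :: "int \<Rightarrow> real \<Rightarrow> site \<times> bool \<Rightarrow> site \<times> bool \<Rightarrow> complex" where
  "Gf N \<kappa> i j = loc (Hf N \<kappa>) (Wf N \<kappa>) i j + of_real \<kappa> * Kf N i j"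

lemma finite_core [simp]: "finite (core N)"
  by (simp add: core_def)

lemma mem_core [simp]: "(k, l, a) \<in> core N \<longleftrightarrow> 0 \<le> k \<and> k \<le> N \<and> 0 \<le> l \<and> l \<le> N"
  by (auto simp: core_def)

lemma cnj_zmat: "cnj (zmat N k k') = zmat N k' k"
  by (auto simp: zmat_def)

lemma cnj_dmat: "cnj (dmat N k k') = - dmat N k' k"
  by (auto simp: dmat_def)

lemma cnj_idmat: "cnj (idmat k k') = idmat k' k"
  by (auto simp: idmat_def)

lemma cnj_hmat: "cnj (hmat N \<kappa> s t) = hmat N \<kappa> t s"
  by (cases s; cases t) (auto simp: hmat_def cnj_zmat cnj_dmat cnj_idmat)

lemma hermitian_Hf: "hermitian_on S (Hf N \<kappa>)"
  by (rule hermitian_onI) (auto simp: Hf_def cnj_hmat)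

lemma hermitian_Gf: "hermitian_on (S \<times> UNIV) (Gf N \<kappa>)"
proof (rule hermitian_onI)
  fix i j assume ij: "i \<in> S \<times> (UNIV :: bool set)" "j \<in> S \<times> (UNIV :: bool set)"
  have "cnj (Kf N i j) = Kf N j i"
    by (cases i; cases j) (auto simp: Kf_def)
  thus "cnj (Gf N \<kappa> i j) = Gf N \<kappa> j i"
    using hermitian_onD[OF hermitian_loc[OF hermitian_Hf] ij, of N \<kappa> "Wf N \<kappa>"] by (simp add: Gf_def)
qed

section \<open>Action of the matrices on functions\<close>

lemma sum_core: "(\<Sum>s\<in>core N. F s) = (\<Sum>k\<in>{0..N}. \<Sum>l\<in>{0..N}. F (k, l, False) + F (k, l, True))"
proof -
  have "(\<Sum>s\<in>core N. F s) = (\<Sum>k\<in>{0..N}. \<Sum>l\<in>{0..N}. \<Sum>a\<in>UNIV. F (k, l, a))"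
    unfolding core_def by (simp add: sum.cartesian_product)
  thus ?thesis by (simp add: UNIV_bool add.commute)
qed

lemma sum_zmat:
  assumes "0 \<le> k" "k \<le> N"
  shows "(\<Sum>k'\<in>{0..N}. zmat N k k' * g k') = Zop N g k"
proof -
  have "(\<Sum>k'\<in>{0..N}. zmat N k k' * g k')
    = (\<Sum>k'\<in>{0..N}. if k' = k + 1 then of_real (wt N (k + 1)) * g k' else 0)
      + (\<Sum>k'\<in>{0..N}. if k' = k - 1 then of_real (wt N k) * g k' else 0)"
    unfolding sum.distrib[symmetric] by (intro sum.cong refl) (auto simp: zmat_def algebra_simps)
  thus ?thesis using assms by (auto simp: Zop_def)
qed

lemma sum_dmat:
  assumes "0 \<le> k" "k \<le> N"
  shows "(\<Sum>k'\<in>{0..N}. dmat N k k' * g k') = Dop N g k"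
proof -
  have "(\<Sum>k'\<in>{0..N}. dmat N k k' * g k')
    = (\<Sum>k'\<in>{0..N}. if k' = k + 1 then of_real (wt N (k + 1)) * g k' else 0)
      - (\<Sum>k'\<in>{0..N}. if k' = k - 1 then of_real (wt N k) * g k' else 0)"
    unfolding sum_subtractf[symmetric] by (intro sum.cong refl) (auto simp: dmat_def algebra_simps)
  thus ?thesis using assms by (auto simp: Dop_def)
qed

lemma sum_idmat:
  assumes "0 \<le> k" "k \<le> N"
  shows "(\<Sum>k'\<in>{0..N}. idmat k k' * g k') = g k"
proof -
  have "(\<Sum>k'\<in>{0..N}. idmat k k' * g k') = (\<Sum>k'\<in>{0..N}. if k' = k then g k' else 0)"
    by (intro sum.cong refl) (auto simp: idmat_def)
  thus ?thesis using assms by simp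
qed

lemma sum_tensor:
  fixes a b :: "int \<Rightarrow> complex"
  assumes "\<And>g. (\<Sum>k'\<in>{0..N}. a k' * g k') = P g" "\<And>g. (\<Sum>l'\<in>{0..N}. b l' * g l') = Q g"
  shows "(\<Sum>k'\<in>{0..N}. \<Sum>l'\<in>{0..N}. a k' * b l' * u k' l') = P (\<lambda>k'. Q (u k'))"
proof -
  have "(\<Sum>k'\<in>{0..N}. \<Sum>l'\<in>{0..N}. a k' * b l' * u k' l') = (\<Sum>k'\<in>{0..N}. a k' * Q (u k'))"
    unfolding assms(2)[symmetric] by (simp add: sum_distrib_left mult.assoc)
  thus ?thesis by (simp add: assms(1))
qed

lemma mv_Hf:
  assumes S: "finite S" "core N \<subseteq> S" and kl: "0 \<le> k" "k \<le> N" "0 \<le> l" "l \<le> N"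
    and u: "\<And>k l. u0 k l = u (k, l, False)" "\<And>k l. u1 k l = u (k, l, True)"
  shows "mv S (Hf N \<kappa>) u (k, l, False)
      = of_real \<kappa> * (op1 (Zop N) u0 k l + op2 (Zop N) u0 k l) - u0 k l
        - of_real \<kappa> * (\<i> * op1 (Dop N) u1 k l + op2 (Dop N) u1 k l)"
    and "mv S (Hf N \<kappa>) u (k, l, True)
      = - of_real \<kappa> * (op1 (Zop N) u1 k l + op2 (Zop N) u1 k l) + u1 k l
        + of_real \<kappa> * (op2 (Dop N) u0 k l - \<i> * op1 (Dop N) u0 k l)"
proof -
  have red: "mv S (Hf N \<kappa>) u s = (\<Sum>t\<in>core N. hmat N \<kappa> s t * u t)" if "s \<in> core N" for s
  proof -
    have "mv S (Hf N \<kappa>) u s = (\<Sum>t\<in>core N. Hf N \<kappa> s t * u t)"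
      unfolding mv_def by (rule sum.mono_neutral_right[OF S]) (use that in \<open>auto simp: Hf_def\<close>)
    thus ?thesis using that by (simp add: Hf_def)
  qed
  note z1 = sum_zmat[OF kl(1,2)] note z2 = sum_zmat[OF kl(3,4)]
  note d1 = sum_dmat[OF kl(1,2)] note d2 = sum_dmat[OF kl(3,4)]
  note i1 = sum_idmat[OF kl(1,2)] note i2 = sum_idmat[OF kl(3,4)]
  have T: "(\<Sum>k'\<in>{0..N}. \<Sum>l'\<in>{0..N}. zmat N k k' * idmat l l' * f k' l') = op1 (Zop N) f k l"
    "(\<Sum>k'\<in>{0..N}. \<Sum>l'\<in>{0..N}. idmat k k' * zmat N l l' * f k' l') = op2 (Zop N) f k l"
    "(\<Sum>k'\<in>{0..N}. \<Sum>l'\<in>{0..N}. dmat N k k' * idmat l l' * f k' l') = op1 (Dop N) f k l"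
    "(\<Sum>k'\<in>{0..N}. \<Sum>l'\<in>{0..N}. idmat k k' * dmat N l l' * f k' l') = op2 (Dop N) f k l"
    "(\<Sum>k'\<in>{0..N}. \<Sum>l'\<in>{0..N}. idmat k k' * idmat l l' * f k' l') = f k l" for f
    unfolding op1_def op2_def
    by (rule sum_tensor[OF z1 i2] sum_tensor[OF i1 z2] sum_tensor[OF d1 i2] sum_tensor[OF i1 d2] sum_tensor[OF i1 i2])+
  have "mv S (Hf N \<kappa>) u (k, l, False) = (\<Sum>k'\<in>{0..N}. \<Sum>l'\<in>{0..N}.
      of_real \<kappa> * (zmat N k k' * idmat l l' * u0 k' l') + of_real \<kappa> * (idmat k k' * zmat N l l' * u0 k' l')
      - idmat k k' * idmat l l' * u0 k' l'
      - of_real \<kappa> * \<i> * (dmat N k k' * idmat l l' * u1 k' l') - of_real \<kappa> * (idmat k k' * dmat N l l' * u1 k' l'))"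
    using kl unfolding red[OF iffD2[OF mem_core, OF conjI[OF kl(1) conjI[OF kl(2) conjI[OF kl(3,4)]]]]] sum_core
    by (intro sum.cong refl) (simp add: hmat_def u algebra_simps)
  also have "\<dots> = of_real \<kappa> * (op1 (Zop N) u0 k l + op2 (Zop N) u0 k l) - u0 k l
        - of_real \<kappa> * (\<i> * op1 (Dop N) u1 k l + op2 (Dop N) u1 k l)"
    unfolding sum.distrib sum_subtractf sum_distrib_left[symmetric] T by (simp add: algebra_simps)
  finally show "mv S (Hf N \<kappa>) u (k, l, False)
      = of_real \<kappa> * (op1 (Zop N) u0 k l + op2 (Zop N) u0 k l) - u0 k l
        - of_real \<kappa> * (\<i> * op1 (Dop N) u1 k l + op2 (Dop N) u1 k l)" .
  have "mv S (Hf N \<kappa>) u (k, l, True) = (\<Sum>k'\<in>{0..N}. \<Sum>l'\<in>{0..N}.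
      of_real \<kappa> * (idmat k k' * dmat N l l' * u0 k' l') - of_real \<kappa> * \<i> * (dmat N k k' * idmat l l' * u0 k' l')
      + idmat k k' * idmat l l' * u1 k' l'
      - of_real \<kappa> * (zmat N k k' * idmat l l' * u1 k' l') - of_real \<kappa> * (idmat k k' * zmat N l l' * u1 k' l'))"
    using kl unfolding red[OF iffD2[OF mem_core, OF conjI[OF kl(1) conjI[OF kl(2) conjI[OF kl(3,4)]]]]] sum_core
    by (intro sum.cong refl) (simp add: hmat_def u algebra_simps)
  also have "\<dots> = - of_real \<kappa> * (op1 (Zop N) u1 k l + op2 (Zop N) u1 k l) + u1 k l
        + of_real \<kappa> * (op2 (Dop N) u0 k l - \<i> * op1 (Dop N) u0 k l)"
    unfolding sum.distrib sum_subtractf sum_distrib_left[symmetric] T by (simp add: algebra_simps)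
  finally show "mv S (Hf N \<kappa>) u (k, l, True)
      = - of_real \<kappa> * (op1 (Zop N) u1 k l + op2 (Zop N) u1 k l) + u1 k l
        + of_real \<kappa> * (op2 (Dop N) u0 k l - \<i> * op1 (Dop N) u0 k l)" .
qed

lemma mv_Hf_outside:
  assumes "finite S" "s \<in> S" "s \<notin> core N"
  shows "mv S (Hf N \<kappa>) u s = u s"
proof -
  have "mv S (Hf N \<kappa>) u s = (\<Sum>t\<in>S. if s = t then u t else 0)"
    unfolding mv_def by (intro sum.cong refl) (use assms in \<open>auto simp: Hf_def\<close>)
  thus ?thesis using assms by simp
qed

lemma mv_Kf:
  assumes S: "finite S" "core N \<subseteq> S"
  shows "mv (S \<times> UNIV) (Kf N) f ((k, l, a), c)
    = (if (k, l, a) \<in> core N \<and> a = c then (if a then - \<i> else \<i>) * of_real (spin_step N) * f ((k, l, \<not> a), \<not> c) else 0)"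
proof (cases "(k, l, a) \<in> core N \<and> a = c")
  case True
  hence mem: "((k, l, \<not> a), \<not> c) \<in> S \<times> UNIV" using S by auto
  have "mv (S \<times> UNIV) (Kf N) f ((k, l, a), c)
      = (\<Sum>j\<in>S \<times> UNIV. if j = ((k, l, \<not> a), \<not> c) then (if a then - \<i> else \<i>) * of_real (spin_step N) * f j else 0)"
    unfolding mv_def by (intro sum.cong refl) (use True in \<open>auto simp: Kf_def split: if_splits\<close>)
  thus ?thesis using True mem S by simp
next
  case False
  have "mv (S \<times> UNIV) (Kf N) f ((k, l, a), c) = 0"
    unfolding mv_def by (rule sum.neutral) (use False in \<open>auto simp: Kf_def\<close>)
  thus ?thesis by (subst if_not_P[OF False])
qed

lemma mv_Gf:
  "mv I (Gf N \<kappa>) f i = mv I (loc (Hf N \<kappa>) (Wf N \<kappa>)) f i + of_real \<kappa> * mv I (Kf N) f i"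
  by (simp add: mv_def Gf_def ring_distribs sum.distrib sum_distrib_left mult_ac)

text \<open>The change of basis that turns \<open>Gf\<close> into \<open>Gp\<close>, \<open>Gw\<close>, \<open>Gr\<close>, \<open>Gq\<close>.\<close>

definition cp where "cp f k l = f ((k, l, False), False) + \<i> * f ((k, l, True), True)"
definition cq where "cq f k l = f ((k, l, False), False) - \<i> * f ((k, l, True), True)"
definition cr where "cr f k l = f ((k, l, True), False) + \<i> * f ((k, l, False), True)"
definition cw where "cw f k l = f ((k, l, True), False) - \<i> * f ((k, l, False), True)"

lemma mv_Gf_core:
  assumes S: "finite S" "core N \<subseteq> S" and kl: "0 \<le> k" "k \<le> N" "0 \<le> l" "l \<le> N"
  shows "cp (mv (S \<times> UNIV) (Gf N \<kappa>) f) k l = Gp N \<kappa> (cp f) (cw f) (cr f) k l"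
    and "cw (mv (S \<times> UNIV) (Gf N \<kappa>) f) k l = Gw N \<kappa> (cw f) (cp f) (cq f) k l"
    and "cr (mv (S \<times> UNIV) (Gf N \<kappa>) f) k l = Gr N \<kappa> (cr f) (cq f) (cp f) k l"
    and "cq (mv (S \<times> UNIV) (Gf N \<kappa>) f) k l = Gq N \<kappa> (cq f) (cr f) (cw f) k l"
proof -
  have mem: "(k, l, a) \<in> S" "(k, l, a) \<in> core N" for a using S kl by auto
  have h: "mv S (Hf N \<kappa>) (\<lambda>t. f (t, b)) (k, l, False)
      = of_real \<kappa> * (op1 (Zop N) (\<lambda>k l. f ((k, l, False), b)) k l + op2 (Zop N) (\<lambda>k l. f ((k, l, False), b)) k l)
        - f ((k, l, False), b)
        - of_real \<kappa> * (\<i> * op1 (Dop N) (\<lambda>k l. f ((k, l, True), b)) k l + op2 (Dop N) (\<lambda>k l. f ((k, l, True), b)) k l)"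
    "mv S (Hf N \<kappa>) (\<lambda>t. f (t, b)) (k, l, True)
      = - of_real \<kappa> * (op1 (Zop N) (\<lambda>k l. f ((k, l, True), b)) k l + op2 (Zop N) (\<lambda>k l. f ((k, l, True), b)) k l)
        + f ((k, l, True), b)
        + of_real \<kappa> * (op2 (Dop N) (\<lambda>k l. f ((k, l, False), b)) k l - \<i> * op1 (Dop N) (\<lambda>k l. f ((k, l, False), b)) k l)" for b
    by (rule mv_Hf[OF S kl]; simp)+
  have W: "Wf N \<kappa> (k, l, a) = of_real \<kappa> * (of_real (spin_pos N k) - \<i> * of_real (spin_pos N l))" for a
    using mem(2) by (simp add: Wf_def pos_def del: mem_core)
  note defs = cp_def cq_def cr_def cw_def mv_Gf mv_loc[OF S(1) mem(1)] mv_Kf[OF S] h W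
    Gp_def Gw_def Gr_def Gq_def Cop_def op1_def op2_def Top_def Aop_def Zop_def Dop_def
  show "cp (mv (S \<times> UNIV) (Gf N \<kappa>) f) k l = Gp N \<kappa> (cp f) (cw f) (cr f) k l"
    using kl by (simp add: defs algebra_simps)
  show "cw (mv (S \<times> UNIV) (Gf N \<kappa>) f) k l = Gw N \<kappa> (cw f) (cp f) (cq f) k l"
    using kl by (simp add: defs algebra_simps)
  show "cr (mv (S \<times> UNIV) (Gf N \<kappa>) f) k l = Gr N \<kappa> (cr f) (cq f) (cp f) k l"
    using kl by (simp add: defs algebra_simps)
  show "cq (mv (S \<times> UNIV) (Gf N \<kappa>) f) k l = Gq N \<kappa> (cq f) (cr f) (cw f) k l"
    using kl by (simp add: defs algebra_simps)
qed

lemma mv_Gf_outside: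
  assumes S: "finite S" "core N \<subseteq> S" and s: "s \<in> S" "s \<notin> core N"
  shows "mv (S \<times> UNIV) (Gf N \<kappa>) f (s, False) = f (s, False) + cnj (pos N s) * f (s, True)"
    and "mv (S \<times> UNIV) (Gf N \<kappa>) f (s, True) = pos N s * f (s, False) - f (s, True)"
proof -
  have K: "mv (S \<times> UNIV) (Kf N) f (s, c) = 0" for c
    using s mv_Kf[OF S] by (cases s) (simp del: mem_core)
  show "mv (S \<times> UNIV) (Gf N \<kappa>) f (s, False) = f (s, False) + cnj (pos N s) * f (s, True)"
    and "mv (S \<times> UNIV) (Gf N \<kappa>) f (s, True) = pos N s * f (s, False) - f (s, True)"
    using s by (simp_all add: mv_Gf K mv_loc S mv_Hf_outside Wf_def)
qed

lemma parallelogram: "(cmod (a + \<i> * b))\<^sup>2 + (cmod (a - \<i> * b))\<^sup>2 = 2 * (cmod a)\<^sup>2 + 2 * (cmod b)\<^sup>2"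
  by (simp add: cmod_power2) (simp add: power2_eq_square algebra_simps)

lemma sum_core_components:
  "2 * (\<Sum>s\<in>core N. (cmod (f (s, False)))\<^sup>2 + (cmod (f (s, True)))\<^sup>2)
    = Re (cip2 N (cp f) (cp f)) + Re (cip2 N (cw f) (cw f)) + Re (cip2 N (cr f) (cr f)) + Re (cip2 N (cq f) (cq f))"
proof -
  have "2 * ((cmod (f ((k, l, False), False)))\<^sup>2 + (cmod (f ((k, l, False), True)))\<^sup>2
      + ((cmod (f ((k, l, True), False)))\<^sup>2 + (cmod (f ((k, l, True), True)))\<^sup>2))
    = (cmod (cp f k l))\<^sup>2 + (cmod (cw f k l))\<^sup>2 + (cmod (cr f k l))\<^sup>2 + (cmod (cq f k l))\<^sup>2" for k l
    using parallelogram[of "f ((k, l, False), False)" "f ((k, l, True), True)"]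
      parallelogram[of "f ((k, l, True), False)" "f ((k, l, False), True)"]
    by (simp add: cp_def cq_def cr_def cw_def)
  thus ?thesis
    unfolding cip2_self Re_complex_of_real sum_core sum_distrib_left by (simp only: sum.distrib)
qed

lemma rotation_norm:
  "(cmod (u + cnj w * v))\<^sup>2 + (cmod (w * u - v))\<^sup>2 = (1 + (cmod w)\<^sup>2) * ((cmod u)\<^sup>2 + (cmod v)\<^sup>2)"
  by (simp add: cmod_power2) (simp add: power2_eq_square algebra_simps)

text \<open>The change of basis to \<open>cp\<close>, \<open>cw\<close>, \<open>cr\<close>,
  \<open>cq\<close> is \<open>sqrt 2\<close> times a unitary, hence the factors 2. At a site outside
  the core the localizer is a 2 by 2 matrix whose square is the scalar
  \<open>1 + (cmod (pos N s))\<^sup>2\<close>.\<close>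

lemma norm_Gf:
  assumes S: "finite S" "core N \<subseteq> S" and N: "0 \<le> N"
  shows "2 * (nrm (S \<times> UNIV) (mv (S \<times> UNIV) (Gf N \<kappa>) f))\<^sup>2
    = Re (energy N \<kappa> 1 1 (cp f)) + Re (energy N \<kappa> (-1) 1 (cw f))
      + Re (energy N \<kappa> 1 (-1) (cr f)) + Re (energy N \<kappa> (-1) (-1) (cq f))
      + 2 * (\<Sum>s\<in>S - core N. (1 + (cmod (pos N s))\<^sup>2) * ((cmod (f (s, False)))\<^sup>2 + (cmod (f (s, True)))\<^sup>2))"
proof -
  define g where "g = mv (S \<times> UNIV) (Gf N \<kappa>) f"
  have "(nrm (S \<times> UNIV) g)\<^sup>2 = (\<Sum>s\<in>S. (cmod (g (s, False)))\<^sup>2 + (cmod (g (s, True)))\<^sup>2)"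
    by (simp add: nrm_squared sum_times_bool sum.distrib)
  also have "\<dots> = (\<Sum>s\<in>core N. (cmod (g (s, False)))\<^sup>2 + (cmod (g (s, True)))\<^sup>2)
      + (\<Sum>s\<in>S - core N. (cmod (g (s, False)))\<^sup>2 + (cmod (g (s, True)))\<^sup>2)"
    using sum.subset_diff[OF S(2,1)] by (simp add: add.commute)
  finally have a: "2 * (nrm (S \<times> UNIV) g)\<^sup>2 = 2 * (\<Sum>s\<in>core N. (cmod (g (s, False)))\<^sup>2 + (cmod (g (s, True)))\<^sup>2)
      + 2 * (\<Sum>s\<in>S - core N. (cmod (g (s, False)))\<^sup>2 + (cmod (g (s, True)))\<^sup>2)" by simp
  have b: "(\<Sum>s\<in>S - core N. (cmod (g (s, False)))\<^sup>2 + (cmod (g (s, True)))\<^sup>2)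
      = (\<Sum>s\<in>S - core N. (1 + (cmod (pos N s))\<^sup>2) * ((cmod (f (s, False)))\<^sup>2 + (cmod (f (s, True)))\<^sup>2))"
    by (intro sum.cong refl) (simp add: g_def mv_Gf_outside[OF S] rotation_norm)
  have e: "cip2 N x x = cip2 N y y" if "\<And>k l. 0 \<le> k \<Longrightarrow> k \<le> N \<Longrightarrow> 0 \<le> l \<Longrightarrow> l \<le> N \<Longrightarrow> x k l = y k l" for x y
    using that by (simp add: cip2_def)
  have c: "cip2 N (cp g) (cp g) = cip2 N (Gp N \<kappa> (cp f) (cw f) (cr f)) (Gp N \<kappa> (cp f) (cw f) (cr f))"
    "cip2 N (cw g) (cw g) = cip2 N (Gw N \<kappa> (cw f) (cp f) (cq f)) (Gw N \<kappa> (cw f) (cp f) (cq f))"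
    "cip2 N (cr g) (cr g) = cip2 N (Gr N \<kappa> (cr f) (cq f) (cp f)) (Gr N \<kappa> (cr f) (cq f) (cp f))"
    "cip2 N (cq g) (cq g) = cip2 N (Gq N \<kappa> (cq f) (cr f) (cw f)) (Gq N \<kappa> (cq f) (cr f) (cw f))"
    unfolding g_def by (rule e, rule mv_Gf_core[OF S]; assumption)+
  have d: "2 * (\<Sum>s\<in>core N. (cmod (g (s, False)))\<^sup>2 + (cmod (g (s, True)))\<^sup>2)
      = Re (energy N \<kappa> 1 1 (cp f)) + Re (energy N \<kappa> (-1) 1 (cw f))
        + Re (energy N \<kappa> 1 (-1) (cr f)) + Re (energy N \<kappa> (-1) (-1) (cq f))"
    unfolding sum_core_components[of g N] c
    using arg_cong[OF norm_G[OF N, of \<kappa> "cp f" "cw f" "cr f" "cq f"], of Re]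
    by (simp only: plus_complex.sel)
  show ?thesis
    unfolding g_def[symmetric] a b d ..
qed

lemma Gf_lower:
  assumes S: "finite S" "core N \<subseteq> S" and N: "0 \<le> N"
  shows "1 * nrm (S \<times> UNIV) f \<le> nrm (S \<times> UNIV) (mv (S \<times> UNIV) (Gf N 1) f)"
proof -
  have "(nrm (S \<times> UNIV) f)\<^sup>2 = (\<Sum>s\<in>S. (cmod (f (s, False)))\<^sup>2 + (cmod (f (s, True)))\<^sup>2)"
    by (simp add: nrm_squared sum_times_bool sum.distrib)
  also have "\<dots> = (\<Sum>s\<in>core N. (cmod (f (s, False)))\<^sup>2 + (cmod (f (s, True)))\<^sup>2)
      + (\<Sum>s\<in>S - core N. (cmod (f (s, False)))\<^sup>2 + (cmod (f (s, True)))\<^sup>2)"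
    using sum.subset_diff[OF S(2,1)] by (simp add: add.commute)
  finally have "2 * (nrm (S \<times> UNIV) f)\<^sup>2
    = Re (cip2 N (cp f) (cp f)) + Re (cip2 N (cw f) (cw f)) + Re (cip2 N (cr f) (cr f)) + Re (cip2 N (cq f) (cq f))
      + 2 * (\<Sum>s\<in>S - core N. (cmod (f (s, False)))\<^sup>2 + (cmod (f (s, True)))\<^sup>2)"
    using sum_core_components[of f N] by simp
  also have "\<dots> \<le> 2 * (nrm (S \<times> UNIV) (mv (S \<times> UNIV) (Gf N 1) f))\<^sup>2"
  proof -
    have "(\<Sum>s\<in>S - core N. (cmod (f (s, False)))\<^sup>2 + (cmod (f (s, True)))\<^sup>2)
      \<le> (\<Sum>s\<in>S - core N. (1 + (cmod (pos N s))\<^sup>2) * ((cmod (f (s, False)))\<^sup>2 + (cmod (f (s, True)))\<^sup>2))"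
    proof (rule sum_mono)
      fix s
      show "(cmod (f (s, False)))\<^sup>2 + (cmod (f (s, True)))\<^sup>2
        \<le> (1 + (cmod (pos N s))\<^sup>2) * ((cmod (f (s, False)))\<^sup>2 + (cmod (f (s, True)))\<^sup>2)"
        using mult_right_mono[of 1 "1 + (cmod (pos N s))\<^sup>2" "(cmod (f (s, False)))\<^sup>2 + (cmod (f (s, True)))\<^sup>2"]
        by simp
    qed
    thus ?thesis
      unfolding norm_Gf[OF S N]
      using energy_lower[OF N, of 1 1 "cp f"] energy_lower[OF N, of "-1" 1 "cw f"]
        energy_lower[OF N, of 1 "-1" "cr f"] energy_lower[OF N, of "-1" "-1" "cq f"] by linarith
  qed
  finally have "(nrm (S \<times> UNIV) f)\<^sup>2 \<le> (nrm (S \<times> UNIV) (mv (S \<times> UNIV) (Gf N 1) f))\<^sup>2" by simp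
  hence "nrm (S \<times> UNIV) f \<le> nrm (S \<times> UNIV) (mv (S \<times> UNIV) (Gf N 1) f)"
    by (rule power2_le_imp_le) simp
  thus ?thesis by simp
qed

text \<open>The product of two coherent states, with phases chosen such that \<open>cp\<close> is
  the only nonvanishing component on the core.\<close>

definition v0 :: "int \<Rightarrow> site \<times> bool \<Rightarrow> complex" where
  "v0 N = (\<lambda>((k, l, a), c). if 0 \<le> k \<and> k \<le> N \<and> 0 \<le> l \<and> l \<le> N \<and> a = c
     then (if a then - \<i> else 1) * (of_real (coherent N k) * of_real (coherent N l)) else 0)"

text \<open>By \<open>norm_Gf\<close> all energies of a kernel vector vanish, and so does the part
  outside the core. Three components are then 0, \<open>cp f\<close> is a multiple of the product of
  coherent states, and orthogonality to \<open>v0\<close> removes this multiple.\<close>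

lemma Gf_injective:
  assumes S: "finite S" "core N \<subseteq> S" and N: "0 \<le> N" and \<kappa>: "0 \<le> \<kappa>"
    and z: "\<forall>i\<in>S \<times> UNIV. mv (S \<times> UNIV) (Gf N \<kappa>) f i = 0"
    and orth: "(\<Sum>i\<in>S \<times> UNIV. cnj (v0 N i) * f i) = 0"
  shows "\<forall>i\<in>S \<times> UNIV. f i = 0"
proof -
  let ?R = "\<Sum>s\<in>S - core N. (1 + (cmod (pos N s))\<^sup>2) * ((cmod (f (s, False)))\<^sup>2 + (cmod (f (s, True)))\<^sup>2)"
  have "nrm (S \<times> UNIV) (mv (S \<times> UNIV) (Gf N \<kappa>) f) = nrm (S \<times> (UNIV :: bool set)) (\<lambda>_. 0)"
    by (rule nrm_cong) (use z in blast)
  also have "\<dots> = 0" by (simp add: nrm_def L2_set_def)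
  finally have "Re (energy N \<kappa> 1 1 (cp f)) + Re (energy N \<kappa> (-1) 1 (cw f))
      + Re (energy N \<kappa> 1 (-1) (cr f)) + Re (energy N \<kappa> (-1) (-1) (cq f)) + 2 * ?R = 0"
    using norm_Gf[OF S N, of \<kappa> f] by simp
  moreover have "0 \<le> ?R" by (intro sum_nonneg mult_nonneg_nonneg) auto
  ultimately have e: "Re (energy N \<kappa> 1 1 (cp f)) = 0" "Re (energy N \<kappa> (-1) 1 (cw f)) = 0"
      "Re (energy N \<kappa> 1 (-1) (cr f)) = 0" "Re (energy N \<kappa> (-1) (-1) (cq f)) = 0" and R: "?R = 0"
    using energy_nonneg[of N \<kappa> 1 1 "cp f"] energy_nonneg[of N \<kappa> "-1" 1 "cw f"]
      energy_nonneg[of N \<kappa> 1 "-1" "cr f"] energy_nonneg[of N \<kappa> "-1" "-1" "cq f"] by linarith+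
  have out: "f (s, c) = 0" if "s \<in> S - core N" for s c
  proof -
    have "(1 + (cmod (pos N s))\<^sup>2) * ((cmod (f (s, False)))\<^sup>2 + (cmod (f (s, True)))\<^sup>2) = 0"
      using R that S by (subst (asm) sum_nonneg_eq_0_iff) (auto intro!: mult_nonneg_nonneg)
    moreover have "1 + (cmod (pos N s))\<^sup>2 \<noteq> 0"
      using zero_le_power2[of "cmod (pos N s)"] by linarith
    ultimately have "(cmod (f (s, False)))\<^sup>2 + (cmod (f (s, True)))\<^sup>2 = 0" by simp
    thus ?thesis by (cases c) (simp_all add: sum_power2_eq_zero_iff)
  qed
  have w: "cw f k l = 0" and r: "cr f k l = 0" and q: "cq f k l = 0"
    if "0 \<le> k" "k \<le> N" "0 \<le> l" "l \<le> N" for k l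
    using energy_0_imp_0[OF e(2) \<kappa> _ _ _ that] energy_0_imp_0[OF e(3) \<kappa> _ _ _ that]
      energy_0_imp_0[OF e(4) \<kappa> _ _ _ that] by auto
  have p: "cp f k l = cp f 0 0 * (of_real (coherent N k) * of_real (coherent N l))"
    if "0 \<le> k" "k \<le> N" "0 \<le> l" "l \<le> N" for k l
    by (rule energy_0_imp_coherent[OF e(1) that])
  have v0_in: "v0 N (s, c) \<noteq> 0 \<Longrightarrow> s \<in> core N" for s c
    by (cases s) (auto simp: v0_def split: if_splits)
  have "0 = (\<Sum>i\<in>core N \<times> UNIV. cnj (v0 N i) * f i)"
    unfolding orth[symmetric]
  proof (rule sum.mono_neutral_right)
    show "\<forall>i\<in>S \<times> UNIV - core N \<times> UNIV. cnj (v0 N i) * f i = 0"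
    proof
      fix i assume "i \<in> S \<times> (UNIV :: bool set) - core N \<times> UNIV"
      hence "fst i \<notin> core N" by (cases i) simp
      hence "v0 N i = 0" using v0_in[of "fst i" "snd i"] by auto
      thus "cnj (v0 N i) * f i = 0" by simp
    qed
  qed (use S in auto)
  also have "\<dots> = (\<Sum>s\<in>core N. cnj (v0 N (s, False)) * f (s, False) + cnj (v0 N (s, True)) * f (s, True))"
    by (simp add: sum_times_bool sum.distrib)
  also have "\<dots> = (\<Sum>k\<in>{0..N}. \<Sum>l\<in>{0..N}. of_real (coherent N k) * of_real (coherent N l) * cp f k l)"
    unfolding sum_core by (intro sum.cong refl) (simp add: v0_def cp_def algebra_simps)
  also have "\<dots> = (\<Sum>k\<in>{0..N}. \<Sum>l\<in>{0..N}. cp f 0 0 * of_real ((coherent N k * coherent N l)\<^sup>2))"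
  proof (intro sum.cong refl)
    fix k l assume "k \<in> {0..N}" "l \<in> {0..N}"
    hence kl: "0 \<le> k" "k \<le> N" "0 \<le> l" "l \<le> N" by auto
    show "of_real (coherent N k) * of_real (coherent N l) * cp f k l = cp f 0 0 * of_real ((coherent N k * coherent N l)\<^sup>2)"
      unfolding p[OF kl] by (simp add: power2_eq_square)
  qed
  also have "\<dots> = cp f 0 0 * of_real (\<Sum>k\<in>{0..N}. \<Sum>l\<in>{0..N}. (coherent N k * coherent N l)\<^sup>2)"
    by (simp only: sum_distrib_left of_real_sum)
  finally have "cp f 0 0 * of_real (\<Sum>k\<in>{0..N}. \<Sum>l\<in>{0..N}. (coherent N k * coherent N l)\<^sup>2) = 0" by simp
  moreover have "(\<Sum>k\<in>{0..N}. \<Sum>l\<in>{0..N}. (coherent N k * coherent N l)\<^sup>2) > 0"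
  proof (rule sum_pos2[of _ 0])
    show "0 < (\<Sum>l\<in>{0..N}. (coherent N 0 * coherent N l)\<^sup>2)"
      by (rule sum_pos2[of _ 0]) (use N in \<open>auto simp: coherent_def\<close>)
  qed (use N in \<open>auto intro: sum_nonneg\<close>)
  ultimately have "cp f 0 0 = 0"
    by (auto simp only: mult_eq_0_iff of_real_eq_0_iff less_irrefl)
  hence p0: "cp f k l = 0" if "0 \<le> k" "k \<le> N" "0 \<le> l" "l \<le> N" for k l
    using p[OF that] by simp
  have "f ((k, l, a), c) = 0" if kl: "0 \<le> k" "k \<le> N" "0 \<le> l" "l \<le> N" for k l a c
  proof -
    have "2 * f ((k, l, False), False) = cp f k l + cq f k l" "2 * \<i> * f ((k, l, True), True) = cp f k l - cq f k l"
      "2 * f ((k, l, True), False) = cr f k l + cw f k l" "2 * \<i> * f ((k, l, False), True) = cr f k l - cw f k l"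
      by (simp_all add: cp_def cq_def cr_def cw_def)
    hence "f ((k, l, False), False) = 0" "f ((k, l, True), True) = 0" "f ((k, l, True), False) = 0" "f ((k, l, False), True) = 0"
      unfolding w[OF kl] r[OF kl] q[OF kl] p0[OF kl] by simp_all
    thus ?thesis by (cases a; cases c) simp_all
  qed
  hence core0: "f (s, c) = 0" if "s \<in> core N" for s c
    using that by (cases s) simp
  show ?thesis
  proof
    fix i assume i: "i \<in> S \<times> (UNIV :: bool set)"
    obtain s c where sc: "i = (s, c)" by (rule prod.exhaust)
    show "f i = 0"
      using i core0[of s c] out[of s c] unfolding sc by (cases "s \<in> core N") simp_all
  qed
qed

text \<open>Only \<open>Cop\<close> contributes on the core: three components of \<open>v0\<close>
  vanish there, and both ladder operators annihilate the fourth.\<close>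

lemma Gf_v0:
  assumes S: "finite S" "core N \<subseteq> S" and i: "i \<in> S \<times> UNIV"
  shows "mv (S \<times> UNIV) (Gf N \<kappa>) (v0 N) i = of_real (2 * \<kappa> - 1) * v0 N i"
proof -
  obtain k l a c where ie: "i = ((k, l, a), c)" by (metis prod.exhaust)
  show ?thesis
  proof (cases "(k, l, a) \<in> core N")
    case False
    have z: "v0 N ((k, l, a), c) = 0" for c using False by (auto simp: v0_def)
    show ?thesis
      using mv_Gf_outside[OF S _ False, of \<kappa> "v0 N"] i z unfolding ie by (cases c) auto
  next
    case True
    hence kl: "0 \<le> k" "k \<le> N" "0 \<le> l" "l \<le> N" by auto
    let ?g = "mv (S \<times> UNIV) (Gf N \<kappa>) (v0 N)"
    define F where "F = (\<lambda>k l. 2 * (complex_of_real (coherent N k) * of_real (coherent N l)))"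
    have v: "cp (v0 N) k l = F k l" "cw (v0 N) k l = 0" "cr (v0 N) k l = 0" "cq (v0 N) k l = 0"
      if "0 \<le> k" "k \<le> N" "0 \<le> l" "l \<le> N" for k l
      using that by (auto simp: cp_def cw_def cr_def cq_def v0_def F_def)
    \<comment> \<open>The components are known on the square only. This suffices, since the weights
      vanish at its ends and the operators do not look outside.\<close>
    have cong1: "op1 P x k l = op1 P y k l" and cong2: "op2 P x k l = op2 P y k l"
      if "\<And>k l. 0 \<le> k \<Longrightarrow> k \<le> N \<Longrightarrow> 0 \<le> l \<Longrightarrow> l \<le> N \<Longrightarrow> x k l = y k l"
        "P = Aop N s \<or> P = Top N s" for x y P s
    proof -
      have nb: "of_real (wt N (j + 1)) * X (j + 1) = of_real (wt N (j + 1)) * Y (j + 1)"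
        "of_real (wt N j) * X (j - 1) = of_real (wt N j) * Y (j - 1)" "X j = Y j"
        if "\<And>j. 0 \<le> j \<Longrightarrow> j \<le> N \<Longrightarrow> X j = Y j" "0 \<le> j" "j \<le> N" for X Y :: "int \<Rightarrow> complex" and j
        using that by (cases "j = N"; cases "j = 0"; simp)+
      have PP: "P X j = P Y j" if "\<And>j. 0 \<le> j \<Longrightarrow> j \<le> N \<Longrightarrow> X j = Y j" "0 \<le> j" "j \<le> N" for X Y j
        using \<open>P = Aop N s \<or> P = Top N s\<close> nb[of X Y j, OF that] by (auto simp: Aop_def Top_def Dop_def Zop_def)
      show "op1 P x k l = op1 P y k l" unfolding op1_def by (rule PP) (use that kl in auto)
      show "op2 P x k l = op2 P y k l" unfolding op2_def by (rule PP) (use that kl in auto)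
    qed
    have z1: "op1 (Aop N s) x k l = 0" and z2: "op2 (Aop N s) x k l = 0" and z3: "Cop N \<kappa> s s' x k l = 0"
      if "\<And>k l. 0 \<le> k \<Longrightarrow> k \<le> N \<Longrightarrow> 0 \<le> l \<Longrightarrow> l \<le> N \<Longrightarrow> x k l = 0" for x s s'
    proof -
      have zz: "op1 (Aop N s) (\<lambda>_ _. 0) k l = 0" "op2 (Aop N s) (\<lambda>_ _. 0) k l = 0"
        "op1 (Top N s) (\<lambda>_ _. 0) k l = 0" "op2 (Top N s') (\<lambda>_ _. 0) k l = 0" for s s'
        by (simp_all add: op1_def op2_def Aop_def Dop_def Top_def Zop_def)
      show "op1 (Aop N s) x k l = 0" using cong1[of x "\<lambda>_ _. 0" "Aop N s" s] that zz by simp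
      show "op2 (Aop N s) x k l = 0" using cong2[of x "\<lambda>_ _. 0" "Aop N s" s] that zz by simp
      show "Cop N \<kappa> s s' x k l = 0"
        using cong1[of x "\<lambda>_ _. 0" "Top N s" s] cong2[of x "\<lambda>_ _. 0" "Top N s'" s'] that kl zz
        by (simp add: Cop_def)
    qed
    have A1: "op1 (Aop N 1) (cp (v0 N)) k l = 0" "op2 (Aop N 1) (cp (v0 N)) k l = 0"
      using cong1[of "cp (v0 N)" F "Aop N 1" 1] cong2[of "cp (v0 N)" F "Aop N 1" 1] v Aop_coherent2[OF kl, of 2]
      by (simp_all add: F_def)
    have "Cop N \<kappa> 1 1 (cp (v0 N)) k l = Cop N \<kappa> 1 1 F k l"
      using cong1[of "cp (v0 N)" F "Top N 1" 1] cong2[of "cp (v0 N)" F "Top N 1" 1] v kl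
      by (simp add: Cop_def)
    also have "\<dots> = of_real (2 * \<kappa> - 1) * F k l" unfolding F_def by (rule Cop_coherent2[OF kl])
    finally have C: "Cop N \<kappa> 1 1 (cp (v0 N)) k l = of_real (2 * \<kappa> - 1) * F k l" .
    have "cp ?g k l = of_real (2 * \<kappa> - 1) * F k l" "cw ?g k l = 0" "cr ?g k l = 0" "cq ?g k l = 0"
      unfolding mv_Gf_core[OF S kl] Gp_def Gw_def Gr_def Gq_def
      using C A1 z1[of "cw (v0 N)"] z1[of "cr (v0 N)"] z1[of "cq (v0 N)"]
        z2[of "cw (v0 N)"] z2[of "cr (v0 N)"] z2[of "cq (v0 N)"]
        z3[of "cw (v0 N)"] z3[of "cr (v0 N)"] z3[of "cq (v0 N)"] v by simp_all
    moreover have "2 * g ((k, l, False), False) = cp g k l + cq g k l" "2 * \<i> * g ((k, l, True), True) = cp g k l - cq g k l"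
      "2 * g ((k, l, True), False) = cr g k l + cw g k l" "2 * \<i> * g ((k, l, False), True) = cr g k l - cw g k l" for g
      by (simp_all add: cp_def cq_def cr_def cw_def)
    note this[of ?g]
    ultimately have g: "2 * ?g ((k, l, False), False) = of_real (2 * \<kappa> - 1) * F k l"
      "2 * \<i> * ?g ((k, l, True), True) = of_real (2 * \<kappa> - 1) * F k l"
      "?g ((k, l, True), False) = 0" "?g ((k, l, False), True) = 0" by simp_all
    have "?g ((k, l, True), True) = - \<i> / 2 * (2 * \<i> * ?g ((k, l, True), True))" by simp
    also have "\<dots> = of_real (2 * \<kappa> - 1) * (- \<i> * (F k l / 2))" unfolding g(2) by simp
    finally have g2: "?g ((k, l, True), True) = of_real (2 * \<kappa> - 1) * (- \<i> * (F k l / 2))" .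
    have "?g ((k, l, False), False) = (2 * ?g ((k, l, False), False)) / 2" by simp
    also have "\<dots> = of_real (2 * \<kappa> - 1) * (F k l / 2)" unfolding g(1) by simp
    finally have g1: "?g ((k, l, False), False) = of_real (2 * \<kappa> - 1) * (F k l / 2)" .
    have vF: "v0 N ((k, l, True), True) = - \<i> * (F k l / 2)" "v0 N ((k, l, False), False) = F k l / 2"
      "v0 N ((k, l, True), False) = 0" "v0 N ((k, l, False), True) = 0"
      using kl by (simp_all add: v0_def F_def)
    show ?thesis unfolding ie by (cases a; cases c) (simp_all only: g1 g2 g(3,4) vF mult_zero_right)
  qed
qed

section \<open>The finite-dimensional obstruction\<close>

lemma continuous_on_Gf: "continuous_on A (\<lambda>\<kappa>. Gf N \<kappa> i j)"
proof -
  have h: "continuous_on A (\<lambda>\<kappa>. hmat N \<kappa> s t)" for s t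
    unfolding hmat_def split_beta
    by (cases "snd (snd s) = snd (snd t)"; cases "snd (snd s)") (auto intro!: continuous_intros)
  have H: "continuous_on A (\<lambda>\<kappa>. Hf N \<kappa> s t)" for s t
    by (cases "s \<in> core N \<and> t \<in> core N"; cases "s = t") (auto simp: Hf_def h simp del: mem_core)
  have W: "continuous_on A (\<lambda>\<kappa>. Wf N \<kappa> s)" for s
    by (cases "s \<in> core N") (auto simp: Wf_def intro!: continuous_intros)
  show ?thesis
    unfolding Gf_def loc_def split_beta
    by (cases "snd i"; cases "snd j"; cases "fst i = fst j") (auto intro!: continuous_intros H W)
qed

lemma fsgn_Gf_flip:
  assumes S: "finite S" "core N \<subseteq> S" and N: "0 \<le> N"
  shows "fsgn (S \<times> UNIV) (Gf N 0) = - fsgn (S \<times> UNIV) (Gf N 1)"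
proof -
  let ?I = "S \<times> (UNIV :: bool set)"
  define r where "r = nrm ?I (v0 N)"
  have I: "finite ?I" using S by simp
  have m: "((0, 0, False), False) \<in> ?I" using S N by auto
  have "v0 N ((0, 0, False), False) \<noteq> 0" using N by (simp add: v0_def coherent_def)
  hence r0: "r > 0" using nrm_eq_0[OF I _ m, of "v0 N"] nrm_nonneg[of ?I "v0 N"] unfolding r_def by (auto simp: less_le)
  define v where "v i = of_real (1 / r) * v0 N i" for i
  have "(\<Sum>i\<in>?I. cnj (v i) * v i) = of_real (1 / r\<^sup>2) * cip ?I (v0 N) (v0 N)"
    by (simp add: v_def cip_def sum_distrib_left power2_eq_square mult_ac)
  hence v1: "(\<Sum>i\<in>?I. cnj (v i) * v i) = 1" using r0 by (simp add: cip_self r_def[symmetric])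
  show ?thesis
  proof (rule fsgn_flip[where v = v and \<mu> = "\<lambda>\<kappa>. 2 * \<kappa> - 1", OF I continuous_on_Gf hermitian_Gf _ v1])
    fix t i assume "t \<in> {0..1 :: real}" and i: "i \<in> ?I"
    show "mv ?I (Gf N t) v i = of_real (2 * t - 1) * v i"
      unfolding v_def[abs_def] mv_scale Gf_v0[OF S i] by simp
  next
    fix t :: real and f assume t: "t \<in> {0..1}" and z: "\<forall>i\<in>?I. mv ?I (Gf N t) f i = 0"
      and o: "(\<Sum>i\<in>?I. cnj (v i) * f i) = 0"
    have "of_real (1 / r) * (\<Sum>i\<in>?I. cnj (v0 N i) * f i) = 0"
      using o by (simp add: v_def sum_distrib_left mult_ac)
    hence "(\<Sum>i\<in>?I. cnj (v0 N i) * f i) = 0" using r0 by simp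
    thus "\<forall>i\<in>?I. f i = 0" using Gf_injective[OF S N _ z] t by simp
  qed (auto intro!: continuous_intros)
qed

text \<open>At \<kappa> = 0 the Hamiltonian is diagonal with entries 1 and -1. It has gap 1 and
  commutes with every diagonal \<open>W\<close>.\<close>

lemma fsgn_Gf_0:
  assumes S: "finite S" "core N \<subseteq> S"
  shows "fsgn (S \<times> UNIV) (Gf N 0) = fsgn (S \<times> UNIV) (loc (\<lambda>_ _. 0) (\<lambda>_. 1))"
proof -
  have G: "Gf N 0 = loc (Hf N 0) (Wf N 0)" by (simp add: Gf_def fun_eq_iff)
  define e :: "site \<Rightarrow> complex" where "e = (\<lambda>(k, l, a). if (k, l, a) \<in> core N \<and> \<not> a then -1 else 1)"
  have mv: "mv S (Hf N 0) u s = e s * u s" if s: "s \<in> S" for u s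
  proof -
    obtain k l a where se: "s = (k, l, a)" by (metis prod.exhaust)
    show ?thesis
    proof (cases "s \<in> core N")
      case True
      thus ?thesis unfolding se
        using mv_Hf[OF S, of k l "\<lambda>k l. u (k, l, False)" u "\<lambda>k l. u (k, l, True)" 0]
        by (cases a) (simp_all add: e_def)
    next
      case False
      have "e s = 1" using False by (cases s) (auto simp: e_def)
      thus ?thesis using mv_Hf_outside[OF S(1) s False] by simp
    qed
  qed
  have ne: "cmod (e s) = 1" for s by (simp add: e_def split: prod.splits)
  show ?thesis
    unfolding G
  proof (rule fsgn_loc_gap[OF S(1) hermitian_Hf, where g = 1 and \<delta> = 0])
    show "1 * nrm S u \<le> nrm S (mv S (Hf N 0) u)" for u
      by (simp, rule nrm_mono) (simp add: mv norm_mult ne)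
    have "nrm S (\<lambda>s. mv S (Hf N 0) (\<lambda>t. \<phi> t * u t) s - \<phi> s * mv S (Hf N 0) u s) = nrm S (\<lambda>s. 0)" for u \<phi>
      by (rule nrm_cong) (simp add: mv)
    hence cm: "nrm S (\<lambda>s. mv S (Hf N 0) (\<lambda>t. \<phi> t * u t) s - \<phi> s * mv S (Hf N 0) u s) \<le> 0 * nrm S u" for u \<phi>
      by (simp add: nrm_def L2_set_def)
    show "nrm S (\<lambda>s. mv S (Hf N 0) (\<lambda>t. Wf N 0 t * u t) s - Wf N 0 s * mv S (Hf N 0) u s) \<le> 0 * nrm S u"
      "nrm S (\<lambda>s. mv S (Hf N 0) (\<lambda>t. cnj (Wf N 0 t) * u t) s - cnj (Wf N 0 s) * mv S (Hf N 0) u s) \<le> 0 * nrm S u" for u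
      using cm[of "Wf N 0" u] cm[of "\<lambda>t. cnj (Wf N 0 t)" u] by simp_all
  qed simp_all
qed

lemma fsgn_trivial_nonzero:
  assumes S: "finite S"
  shows "fsgn (S \<times> UNIV) (loc (\<lambda>_ _. 0) (\<lambda>_. 1)) \<noteq> 0"
proof (rule fsgn_nonzero)
  show "hermitian_on (S \<times> UNIV) (loc (\<lambda>_ _. 0) (\<lambda>_. 1))"
    by (rule hermitian_loc) (simp add: hermitian_on_def)
  show "injective_on (S \<times> UNIV) (loc (\<lambda>_ _. 0) (\<lambda>_. 1))"
    unfolding injective_on_def
  proof (intro allI impI ballI)
    fix f :: "'a \<times> bool \<Rightarrow> complex" and i assume z: "\<forall>i\<in>S \<times> UNIV. mv (S \<times> UNIV) (loc (\<lambda>_ _. 0) (\<lambda>_. 1)) f i = 0"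
      and "i \<in> S \<times> (UNIV :: bool set)"
    then obtain s c where i: "i = (s, c)" "s \<in> S" by auto
    have "mv S (\<lambda>_ _. 0) u s = 0" for u by (simp add: mv_def)
    thus "f i = 0"
      using z[rule_format, of "(s, False)"] z[rule_format, of "(s, True)"] i by (cases c) (simp_all add: mv_loc S)
  qed
qed (use S in simp)

text \<open>The lower bound 1 for \<open>Gf N 1\<close> absorbs 1/2 from the distance of
  \<open>T\<close> to the model and \<open>spin_step N\<close> from \<open>Kf\<close>; the latter is
  at most 2/5 for N \<ge> 4.\<close>

lemma fsgn_loc_near_Gf:
  assumes S: "finite S" "core N \<subseteq> S" and N: "4 \<le> N" and T: "hermitian_on S T"
    and near: "\<And>u. nrm S (\<lambda>s. mv S T u s - mv S (Hf N 1) u s) \<le> 1 / 2 * nrm S u"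
  shows "fsgn (S \<times> UNIV) (loc T (pos N)) = fsgn (S \<times> UNIV) (Gf N 1)"
proof (rule fsgn_perturb[where c = 1 and e = "1 / 2 + spin_step N"])
  let ?I = "S \<times> (UNIV :: bool set)"
  show fin: "finite ?I" using S by simp
  show "hermitian_on ?I (loc T (pos N))" by (rule hermitian_loc[OF T])
  show "hermitian_on ?I (Gf N 1)" by (rule hermitian_Gf)
  show "1 * nrm ?I f \<le> nrm ?I (mv ?I (Gf N 1) f)" for f by (rule Gf_lower[OF S]) (use N in simp)
  have "real_of_int N \<ge> 4" using N by linarith
  thus "1 / 2 + spin_step N < 1" by (simp add: spin_step_def field_simps)
  fix f
  have W: "Wf N 1 = pos N" by (simp add: Wf_def fun_eq_iff)
  have "(nrm ?I (\<lambda>i. mv ?I (loc T (pos N)) f i - mv ?I (loc (Hf N 1) (pos N)) f i))\<^sup>2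
      = (nrm S (\<lambda>s. mv S T (\<lambda>s. f (s, False)) s - mv S (Hf N 1) (\<lambda>s. f (s, False)) s))\<^sup>2
        + (nrm S (\<lambda>s. mv S (Hf N 1) (\<lambda>s. f (s, True)) s - mv S T (\<lambda>s. f (s, True)) s))\<^sup>2"
    unfolding nrm_times_bool
    by (intro arg_cong2[where f = "(+)"] arg_cong[where f = "\<lambda>x. x\<^sup>2"] nrm_cong) (simp_all add: mv_loc S)
  also have "\<dots> = (nrm S (\<lambda>s. mv S T (\<lambda>s. f (s, False)) s - mv S (Hf N 1) (\<lambda>s. f (s, False)) s))\<^sup>2
        + (nrm S (\<lambda>s. mv S T (\<lambda>s. f (s, True)) s - mv S (Hf N 1) (\<lambda>s. f (s, True)) s))\<^sup>2"
    by (simp add: nrm_def norm_minus_commute)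
  also have "\<dots> \<le> (1 / 2 * nrm S (\<lambda>s. f (s, False)))\<^sup>2 + (1 / 2 * nrm S (\<lambda>s. f (s, True)))\<^sup>2"
    by (intro add_mono power_mono near) auto
  also have "\<dots> = (1 / 2 * nrm ?I f)\<^sup>2"
    by (simp only: power_mult_distrib nrm_times_bool distrib_left)
  finally have 1: "nrm ?I (\<lambda>i. mv ?I (loc T (pos N)) f i - mv ?I (loc (Hf N 1) (pos N)) f i) \<le> 1 / 2 * nrm ?I f"
    by (rule power2_le_imp_le) simp
  have K: "Kf N i j \<noteq> 0 \<Longrightarrow> (case i of ((k, l, a), c) \<Rightarrow> j = ((k, l, \<not> a), \<not> c))"
    "Kf N i j \<noteq> 0 \<Longrightarrow> (case j of ((k, l, a), c) \<Rightarrow> i = ((k, l, \<not> a), \<not> c))" for i j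
    by (auto simp: Kf_def split: prod.splits if_splits)
  have 2: "nrm ?I (mv ?I (Kf N) f) \<le> spin_step N * real 1 * nrm ?I f"
  proof (rule nrm_mv_schur[OF fin])
    show "cmod (Kf N i j) \<le> spin_step N" for i j
    proof -
      have "0 \<le> spin_step N" using N by (simp add: spin_step_def)
      thus ?thesis by (auto simp: Kf_def norm_mult split: prod.splits)
    qed
    show "card {j \<in> ?I. Kf N i j \<noteq> 0} \<le> 1" for i
    proof -
      have "{j \<in> ?I. Kf N i j \<noteq> 0} \<subseteq> {case i of ((k, l, a), c) \<Rightarrow> ((k, l, \<not> a), \<not> c)}"
        using K(1)[of i] by (auto split: prod.splits)
      from card_mono[OF _ this] show ?thesis by simp
    qed
    show "card {i \<in> ?I. Kf N i j \<noteq> 0} \<le> 1" for j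
    proof -
      have "{i \<in> ?I. Kf N i j \<noteq> 0} \<subseteq> {case j of ((k, l, a), c) \<Rightarrow> ((k, l, \<not> a), \<not> c)}"
        using K(2)[of _ j] by (auto split: prod.splits)
      from card_mono[OF _ this] show ?thesis by simp
    qed
  qed
  have "nrm ?I (\<lambda>i. mv ?I (loc T (pos N)) f i - mv ?I (Gf N 1) f i)
      = nrm ?I (\<lambda>i. (mv ?I (loc T (pos N)) f i - mv ?I (loc (Hf N 1) (pos N)) f i) - mv ?I (Kf N) f i)"
    by (simp add: mv_Gf W algebra_simps)
  also have "\<dots> \<le> (1 / 2 + spin_step N) * nrm ?I f"
    using nrm_diff_le[of ?I "\<lambda>i. mv ?I (loc T (pos N)) f i - mv ?I (loc (Hf N 1) (pos N)) f i" "mv ?I (Kf N) f"] 1 2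
    by (simp add: algebra_simps)
  finally show "nrm ?I (\<lambda>i. mv ?I (loc T (pos N)) f i - mv ?I (Gf N 1) f i) \<le> (1 / 2 + spin_step N) * nrm ?I f" .
qed

section \<open>Locality, commutators and cutoffs\<close>

definition near_sites :: "int \<Rightarrow> site \<Rightarrow> site \<Rightarrow> bool" where
  "near_sites R s t \<longleftrightarrow> \<bar>fst s - fst t\<bar> \<le> R \<and> \<bar>fst (snd s) - fst (snd t)\<bar> \<le> R"

lemma near_sites_sym: "near_sites R s t \<longleftrightarrow> near_sites R t s"
  by (auto simp: near_sites_def abs_minus_commute)

lemma card_near_sites:
  assumes "0 \<le> R"
  shows "card {t \<in> S. near_sites R s t} \<le> 2 * (nat (2 * R + 1))\<^sup>2"
proof -
  obtain k l a where s: "s = (k, l, a)" by (metis prod.exhaust)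
  have "{t \<in> S. near_sites R s t} \<subseteq> {k - R..k + R} \<times> {l - R..l + R} \<times> UNIV"
    by (auto simp: near_sites_def s)
  hence "card {t \<in> S. near_sites R s t} \<le> card ({k - R..k + R} \<times> {l - R..l + R} \<times> (UNIV :: bool set))"
    by (rule card_mono[rotated]) auto
  also have "\<dots> = 2 * (nat (2 * R + 1))\<^sup>2"
    by (simp add: card_cartesian_product power2_eq_square)
  finally show ?thesis .
qed

text \<open>The commutator has the entries \<open>b s t * (\<phi> t - \<phi> s)\<close>, so the
  Schur test applies with the band of \<open>b\<close>. The leading 2 in the count stands for the
  two values of the internal index.\<close>

lemma commutator_bound:
  assumes S: "finite S" and R: "0 \<le> R"
    and supp: "\<And>s t. b s t \<noteq> 0 \<Longrightarrow> near_sites R s t"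
    and bound: "\<And>s t. cmod (b s t) \<le> C"
    and lip: "\<And>s t. near_sites R s t \<Longrightarrow> cmod (\<phi> t - \<phi> s) \<le> \<Lambda>" and \<Lambda>: "0 \<le> \<Lambda>"
  shows "nrm S (\<lambda>s. mv S b (\<lambda>t. \<phi> t * u t) s - \<phi> s * mv S b u s)
    \<le> C * \<Lambda> * real (2 * (nat (2 * R + 1))\<^sup>2) * nrm S u"
proof -
  define A where "A s t = b s t * (\<phi> t - \<phi> s)" for s t
  have C: "0 \<le> C" using bound norm_ge_zero order_trans by blast
  have An: "A s t \<noteq> 0 \<Longrightarrow> near_sites R s t" for s t
    using supp[of s t] by (auto simp only: A_def mult_eq_0_iff)
  have "mv S b (\<lambda>t. \<phi> t * u t) s - \<phi> s * mv S b u s = mv S A u s" for s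
    unfolding mv_def A_def sum_distrib_left sum_subtractf[symmetric]
    by (intro sum.cong refl) (simp add: algebra_simps)
  moreover have "nrm S (mv S A u) \<le> C * \<Lambda> * real (2 * (nat (2 * R + 1))\<^sup>2) * nrm S u"
  proof (rule nrm_mv_schur[OF S])
    show "cmod (A s t) \<le> C * \<Lambda>" for s t
    proof (cases "b s t = 0")
      case True
      thus ?thesis using C \<Lambda> by (simp add: A_def)
    next
      case False
      thus ?thesis unfolding A_def norm_mult using supp lip bound C by (intro mult_mono) auto
    qed
    have "card {t \<in> S. A s t \<noteq> 0} \<le> card {t \<in> S. near_sites R s t}" for s
      by (rule card_mono) (use S in simp, use An in blast)
    thus "card {t \<in> S. A s t \<noteq> 0} \<le> 2 * (nat (2 * R + 1))\<^sup>2" for s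
      using card_near_sites[OF R] le_trans by blast
    have "card {s \<in> S. A s t \<noteq> 0} \<le> card {s \<in> S. near_sites R t s}" for t
      by (rule card_mono) (use S in simp, use An near_sites_sym in blast)
    thus "card {s \<in> S. A s t \<noteq> 0} \<le> 2 * (nat (2 * R + 1))\<^sup>2" for t
      using card_near_sites[OF R] le_trans by blast
  qed
  ultimately show ?thesis by simp
qed

text \<open>The margin of width \<open>N\<close> around the core has room for the support of
  \<open>chi\<close>, within distance N/2, and for a propagation up to N/2.\<close>

definition sbox :: "int \<Rightarrow> site set" where
  "sbox N = {- N..2 * N} \<times> {- N..2 * N} \<times> UNIV"

definition rho :: "int \<Rightarrow> site \<Rightarrow> int" where
  "rho N = (\<lambda>(k, l, a). max (max (max (- k) (k - N)) (max (- l) (l - N))) 0)"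

text \<open>Equal to 1 on the core and to 0 from distance N/2 on, where \<open>rho\<close> measures
  the distance from the square in the maximum norm.\<close>

definition chi :: "int \<Rightarrow> site \<Rightarrow> real" where
  "chi N s = max 0 (1 - 2 * rho N s / N)"

lemma rho_lipschitz: "near_sites R s t \<Longrightarrow> \<bar>rho N s - rho N t\<bar> \<le> R"
proof -
  have m: "\<bar>max a b - max c d\<bar> \<le> R" if "\<bar>a - c\<bar> \<le> R" "\<bar>b - d\<bar> \<le> R" for a b c d :: int
    using that by (auto simp: max_def)
  assume "near_sites R s t"
  moreover obtain k l a where s: "s = (k, l, a)" by (metis prod.exhaust)
  moreover obtain k' l' a' where t: "t = (k', l', a')" by (metis prod.exhaust)
  ultimately have "\<bar>k - k'\<bar> \<le> R" "\<bar>l - l'\<bar> \<le> R" by (simp_all add: near_sites_def)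
  thus ?thesis unfolding s t rho_def prod.case by (intro m) auto
qed

lemma chi_lipschitz:
  assumes "near_sites R s t" "0 < N"
  shows "\<bar>chi N s - chi N t\<bar> \<le> 2 * real_of_int R / real_of_int N"
proof -
  have "\<bar>chi N s - chi N t\<bar> \<le> \<bar>2 * rho N t / N - 2 * rho N s / N\<bar>"
    unfolding chi_def by linarith
  also have "\<dots> = 2 * \<bar>rho N s - rho N t\<bar> / N"
    using assms(2) by (simp add: diff_divide_distrib[symmetric] abs_minus_commute abs_mult flip: right_diff_distrib of_int_diff of_int_abs)
  also have "\<dots> \<le> 2 * real_of_int R / real_of_int N"
    using rho_lipschitz[OF assms(1), of N] assms(2) by (intro divide_right_mono) auto
  finally show ?thesis .
qed

lemma pos_lipschitz:
  assumes "near_sites R s t" "0 < N"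
  shows "cmod (pos N s - pos N t) \<le> 4 * real_of_int R / real_of_int N"
proof -
  obtain k l a where s: "s = (k, l, a)" by (metis prod.exhaust)
  obtain k' l' a' where t: "t = (k', l', a')" by (metis prod.exhaust)
  have x: "\<bar>spin_pos N i - spin_pos N j\<bar> \<le> 2 * real_of_int R / real_of_int N" if "\<bar>i - j\<bar> \<le> R" for i j
  proof -
    have "\<bar>spin_pos N i - spin_pos N j\<bar> = 2 * \<bar>i - j\<bar> / (N + 1)"
      using assms(2) by (simp add: spin_pos_def diff_divide_distrib[symmetric] abs_mult flip: right_diff_distrib of_int_diff of_int_abs)
    also have "\<dots> \<le> 2 * real_of_int R / real_of_int N"
      using that assms(2) by (intro frac_le) auto
    finally show ?thesis .
  qed
  have "pos N s - pos N t = of_real (spin_pos N k - spin_pos N k') - \<i> * of_real (spin_pos N l - spin_pos N l')"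
    by (simp add: pos_def s t algebra_simps)
  also have "cmod \<dots> \<le> \<bar>spin_pos N k - spin_pos N k'\<bar> + \<bar>spin_pos N l - spin_pos N l'\<bar>"
    by (rule order_trans[OF norm_triangle_ineq4]) (simp add: norm_mult del: of_real_diff)
  also have "\<dots> \<le> 2 * real_of_int R / real_of_int N + 2 * real_of_int R / real_of_int N"
    using assms(1) by (intro add_mono x) (auto simp: near_sites_def s t)
  finally show ?thesis by simp
qed

lemma finite_sbox [simp]: "finite (sbox N)"
  by (simp add: sbox_def)

lemma core_subset_sbox: "0 \<le> N \<Longrightarrow> core N \<subseteq> sbox N"
  by (auto simp: core_def sbox_def)

text \<open>A Hermitian matrix close to \<open>Hf N 1\<close> need not have a gap after compression to the box, since
  the boundary may produce small eigenvalues; here it does because \<open>Hf N 1\<close> is the identity near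
  the boundary, and the cutoff \<open>chi\<close> separates the two regions.\<close>

lemma box_gap:
  assumes N: "0 < N" "2 * R \<le> N" and R: "0 \<le> R"
    and supp: "\<And>s t. b s t \<noteq> 0 \<Longrightarrow> near_sites R s t"
    and bound: "\<And>s t. cmod (b s t) \<le> C"
    and gap: "\<And>u. (\<And>s t. u s \<noteq> 0 \<Longrightarrow> near_sites R s t \<Longrightarrow> t \<in> sbox N)
        \<Longrightarrow> g * nrm (sbox N) u \<le> nrm (sbox N) (mv (sbox N) b u)"
    and near: "\<And>u. nrm (sbox N) (\<lambda>s. mv (sbox N) b u s - mv (sbox N) (Hf N 1) u s) \<le> 1 / 2 * nrm (sbox N) u"
    and small: "C * (2 * real_of_int R / real_of_int N) * real (2 * (nat (2 * R + 1))\<^sup>2) \<le> \<mu>"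
    and \<mu>: "4 * \<mu> \<le> g" "4 * \<mu> \<le> 1 / 2" "0 \<le> \<mu>"
  shows "\<mu> * nrm (sbox N) u \<le> nrm (sbox N) (mv (sbox N) b u)"
proof -
  let ?S = "sbox N"
  let ?T = "mv ?S b"
  define \<phi> where "\<phi> s = complex_of_real (chi N s)" for s
  define x y where "x = (\<lambda>s. \<phi> s * u s)" and "y = (\<lambda>s. u s - x s)"
  define c where "c s = ?T x s - \<phi> s * ?T u s" for s
  have chi01: "0 \<le> chi N s" "chi N s \<le> 1" for s
    using N by (auto simp: chi_def rho_def split: prod.splits)
  have c: "nrm ?S c \<le> \<mu> * nrm ?S u"
  proof -
    have "nrm ?S c \<le> C * (2 * real_of_int R / real_of_int N) * real (2 * (nat (2 * R + 1))\<^sup>2) * nrm ?S u"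
      unfolding c_def[abs_def] x_def
    proof (rule commutator_bound[OF finite_sbox R supp bound])
      fix s t assume "near_sites R s t"
      thus "cmod (\<phi> t - \<phi> s) \<le> 2 * real_of_int R / real_of_int N"
        using chi_lipschitz[of R s t N] N
        unfolding \<phi>_def of_real_diff[symmetric] norm_of_real by (simp add: abs_minus_commute)
    qed (use N R in auto)
    thus ?thesis using mult_right_mono[OF small nrm_nonneg[of ?S u]] by linarith
  qed
  \<comment> \<open>\<open>x\<close> is supported within distance N/2 of the core and R \<le> N/2,
    so its R-neighbourhood stays in the box and \<open>gap\<close> applies.\<close>
  have gx: "g * nrm ?S x \<le> nrm ?S (?T x)"
  proof (rule gap)
    fix s t assume xs: "x s \<noteq> 0" and st: "near_sites R s t"
    have "0 < chi N s" using xs chi01(1)[of s] by (auto simp: x_def \<phi>_def less_le)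
    hence "real_of_int (2 * rho N s) / real_of_int N < 1" unfolding chi_def by simp
    hence "2 * rho N s < N" using N by (simp only: divide_less_eq_1_pos of_int_0_less_iff of_int_less_iff)
    moreover obtain k l a where s: "s = (k, l, a)" by (metis prod.exhaust)
    moreover obtain k' l' a' where t: "t = (k', l', a')" by (metis prod.exhaust)
    moreover define m where "m = max (max (max (- k) (k - N)) (max (- l) (l - N))) 0"
    ultimately have r: "2 * m < N"
      by (simp add: rho_def)
    have "- k \<le> m \<and> k - N \<le> m \<and> - l \<le> m \<and> l - N \<le> m"
      unfolding m_def le_max_iff_disj by blast
    moreover have "\<bar>k - k'\<bar> \<le> R \<and> \<bar>l - l'\<bar> \<le> R" using st by (simp add: s t near_sites_def)
    ultimately have "- N \<le> k' \<and> k' \<le> 2 * N \<and> - N \<le> l' \<and> l' \<le> 2 * N" using r N(2) by linarith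
    thus "t \<in> sbox N" by (simp add: t sbox_def)
  qed
  have "nrm ?S (?T x) = nrm ?S (\<lambda>s. \<phi> s * ?T u s + c s)"
    by (simp add: c_def)
  also have "\<dots> \<le> nrm ?S (\<lambda>s. \<phi> s * ?T u s) + nrm ?S c" by (rule nrm_add_le)
  also have "nrm ?S (\<lambda>s. \<phi> s * ?T u s) \<le> nrm ?S (?T u)"
    by (rule nrm_mono) (use chi01 in \<open>simp add: \<phi>_def norm_mult mult_left_le_one_le\<close>)
  finally have X: "g * nrm ?S x \<le> nrm ?S (?T u) + \<mu> * nrm ?S u" using gx c by linarith
  have y0: "y s = 0" if "s \<in> core N" for s
    using that by (cases s) (auto simp: y_def x_def \<phi>_def chi_def rho_def)
  \<comment> \<open>\<open>y\<close> vanishes on the core, and elsewhere \<open>Hf N 1\<close> is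
    the identity; so \<open>near\<close> alone bounds \<open>?T y\<close> from below, by half the
    norm of \<open>y\<close>.\<close>
  have Hy: "mv ?S (Hf N 1) y s = y s" if s: "s \<in> ?S" for s
  proof (cases "s \<in> core N")
    case True
    have "mv ?S (Hf N 1) y s = 0"
      unfolding mv_def by (rule sum.neutral) (use True y0 in \<open>auto simp: Hf_def\<close>)
    thus ?thesis using y0[OF True] by simp
  next
    case False
    thus ?thesis by (rule mv_Hf_outside[OF finite_sbox s])
  qed
  have "nrm ?S y = nrm ?S (\<lambda>s. ?T y s - (?T y s - mv ?S (Hf N 1) y s))"
    by (rule nrm_cong) (simp add: Hy)
  also have "\<dots> \<le> nrm ?S (?T y) + 1 / 2 * nrm ?S y"
    using nrm_diff_le[of ?S "?T y" "\<lambda>s. ?T y s - mv ?S (Hf N 1) y s"] near[of y] by linarith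
  finally have Y1: "1 / 2 * nrm ?S y \<le> nrm ?S (?T y)" by simp
  have Ty: "?T y s = (1 - \<phi> s) * ?T u s - c s" for s
    using mv_add[of ?S b u "\<lambda>s. - 1 * x s" s] mv_scale[of ?S b "-1" x s]
    by (simp add: y_def c_def algebra_simps)
  have "nrm ?S (?T y) \<le> nrm ?S (\<lambda>s. (1 - \<phi> s) * ?T u s) + nrm ?S c"
    unfolding Ty[abs_def] by (rule nrm_diff_le)
  also have "nrm ?S (\<lambda>s. (1 - \<phi> s) * ?T u s) \<le> nrm ?S (?T u)"
  proof (rule nrm_mono)
    fix s
    have "cmod (1 - \<phi> s) = 1 - chi N s"
      unfolding \<phi>_def using chi01[of s] by (metis abs_of_nonneg diff_ge_0_iff_ge norm_of_real of_real_1 of_real_diff)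
    thus "cmod ((1 - \<phi> s) * ?T u s) \<le> cmod (?T u s)"
      using chi01[of s] by (simp add: norm_mult mult_left_le_one_le)
  qed
  finally have Y: "1 / 2 * nrm ?S y \<le> nrm ?S (?T u) + \<mu> * nrm ?S u" using Y1 c by linarith
  have "nrm ?S u = nrm ?S (\<lambda>s. x s + y s)" by (simp add: y_def)
  hence "nrm ?S u \<le> nrm ?S x + nrm ?S y" using nrm_add_le[of ?S x y] by simp
  \<comment> \<open>Both regions together give 4 \<mu> |u| \<le> 2 |T u| + 2 \<mu> |u|, whence the
    factor 4 in the hypotheses.\<close>
  hence "4 * \<mu> * nrm ?S u \<le> 4 * \<mu> * nrm ?S x + 4 * \<mu> * nrm ?S y"
    using mult_left_mono[of "nrm ?S u" "nrm ?S x + nrm ?S y" "4 * \<mu>"] \<mu>(3) by (simp add: distrib_left)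
  also have "\<dots> \<le> g * nrm ?S x + 1 / 2 * nrm ?S y"
    by (intro add_mono mult_right_mono \<mu>) auto
  finally show ?thesis using X Y by linarith
qed

text \<open>The gap gives \<open>loc b (pos N)\<close> the trivial sign, closeness to the model
  gives it the opposite one, and the trivial sign is nonzero. The hypothesis \<open>gap\<close>
  concerns vectors whose R-neighbourhood stays in the box, because for these the compression to the
  box loses nothing.\<close>

lemma finite_obstruction:
  assumes N: "4 \<le> N" "2 * R \<le> N" and R: "0 \<le> R"
    and herm: "\<And>s t. cnj (b s t) = b t s"
    and supp: "\<And>s t. b s t \<noteq> 0 \<Longrightarrow> near_sites R s t"
    and bound: "\<And>s t. cmod (b s t) \<le> C"
    and gap: "\<And>u. (\<And>s t. u s \<noteq> 0 \<Longrightarrow> near_sites R s t \<Longrightarrow> t \<in> sbox N)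
        \<Longrightarrow> g * nrm (sbox N) u \<le> nrm (sbox N) (mv (sbox N) b u)"
    and near: "\<And>u. nrm (sbox N) (\<lambda>s. mv (sbox N) b u s - mv (sbox N) (Hf N 1) u s) \<le> 1 / 2 * nrm (sbox N) u"
    and small: "C * (4 * real_of_int R / real_of_int N) * real (2 * (nat (2 * R + 1))\<^sup>2) < \<mu>\<^sup>2"
    and \<mu>: "4 * \<mu> \<le> g" "4 * \<mu> \<le> 1 / 2" "0 < \<mu>"
  shows False
proof -
  let ?S = "sbox N"
  let ?I = "?S \<times> (UNIV :: bool set)"
  have S: "finite ?S" "core N \<subseteq> ?S" using N core_subset_sbox by auto
  have C: "0 \<le> C" using bound norm_ge_zero order_trans by blast
  define n where "n = real (2 * (nat (2 * R + 1))\<^sup>2)"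
  have n0: "0 \<le> n" by (simp add: n_def)
  have h: "hermitian_on ?S b" by (rule hermitian_onI) (rule herm)
  \<comment> \<open>As \<mu> \<le> 1/8, the bound \<open>\<mu>\<^sup>2\<close> required by the
    localizer implies the bound \<mu> required by \<open>box_gap\<close>.\<close>
  have s2: "C * (2 * real_of_int R / real_of_int N) * n \<le> \<mu>"
  proof -
    have "C * (2 * real_of_int R / real_of_int N) * n \<le> C * (4 * real_of_int R / real_of_int N) * n"
      by (intro mult_right_mono mult_left_mono divide_right_mono) (use C n0 N R in auto)
    also have "\<dots> \<le> \<mu>\<^sup>2" using small unfolding n_def by simp
    also have "\<dots> \<le> \<mu> * 1" unfolding power2_eq_square using \<mu> by (intro mult_left_mono) auto
    finally show ?thesis by simp
  qed
  have g: "\<mu> * nrm ?S u \<le> nrm ?S (mv ?S b u)" for u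
  proof (rule box_gap[where R = R and C = C and g = g])
    show "C * (2 * real_of_int R / real_of_int N) * real (2 * (nat (2 * R + 1))\<^sup>2) \<le> \<mu>"
      using s2 by (simp only: n_def)
  qed (fact gap | use N R supp bound near \<mu> in \<open>simp; fail\<close>)+
  have d0: "0 \<le> C * (4 * real_of_int R / real_of_int N) * n" using C n0 N R by simp
  have "fsgn ?I (loc b (pos N)) = fsgn ?I (loc (\<lambda>_ _. 0) (\<lambda>_. 1))"
  proof (rule fsgn_loc_gap[OF S(1) h g \<mu>(3) _ _ d0])
    show "C * (4 * real_of_int R / real_of_int N) * n < \<mu>\<^sup>2" using small by (simp add: n_def)
    show "nrm ?S (\<lambda>s. mv ?S b (\<lambda>t. pos N t * u t) s - pos N s * mv ?S b u s) \<le> C * (4 * real_of_int R / real_of_int N) * n * nrm ?S u" for u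
      unfolding n_def
    proof (rule commutator_bound[OF S(1) R supp bound])
      fix s t assume "near_sites R s t"
      thus "cmod (pos N t - pos N s) \<le> 4 * real_of_int R / real_of_int N"
        using pos_lipschitz[of R s t N] N by (simp add: norm_minus_commute)
    qed (use N R in auto)
    show "nrm ?S (\<lambda>s. mv ?S b (\<lambda>t. cnj (pos N t) * u t) s - cnj (pos N s) * mv ?S b u s) \<le> C * (4 * real_of_int R / real_of_int N) * n * nrm ?S u" for u
      unfolding n_def
    proof (rule commutator_bound[OF S(1) R supp bound])
      fix s t assume "near_sites R s t"
      thus "cmod (cnj (pos N t) - cnj (pos N s)) \<le> 4 * real_of_int R / real_of_int N"
        using pos_lipschitz[of R s t N] N
        by (metis complex_cnj_diff complex_mod_cnj norm_minus_commute less_le_trans zero_less_numeral)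
    qed (use N R in auto)
  qed
  moreover have "fsgn ?I (loc b (pos N)) = fsgn ?I (Gf N 1)"
    by (rule fsgn_loc_near_Gf[OF S N(1) h near])
  moreover have "fsgn ?I (Gf N 0) = - fsgn ?I (Gf N 1)"
    by (rule fsgn_Gf_flip[OF S]) (use N in simp)
  moreover have "fsgn ?I (Gf N 0) = fsgn ?I (loc (\<lambda>_ _. 0) (\<lambda>_. 1))"
    by (rule fsgn_Gf_0[OF S])
  ultimately show False using fsgn_trivial_nonzero[OF S(1)] by simp
qed

section \<open>Banded operators on the lattice\<close>

text \<open>The index \<open>a\<close> is encoded in the parity of the second coordinate, and the \<open>N\<close>-th square
  is moved to \<open>2 N\<^sup>2\<close> in the first coordinate.\<close>

definition enc :: "int \<Rightarrow> site \<Rightarrow> int \<times> int" where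
  "enc N = (\<lambda>(k, l, a). (k + 2 * N\<^sup>2, 2 * l + (if a then 1 else 0)))"

definition dec :: "int \<Rightarrow> int \<times> int \<Rightarrow> site" where
  "dec N = (\<lambda>(x, y). (x - 2 * N\<^sup>2, y div 2, odd y))"

lemma dec_enc [simp]: "dec N (enc N s) = s"
  by (cases s) (auto simp: dec_def enc_def)

lemma enc_dec [simp]: "enc N (dec N p) = p"
  by (cases p) (auto simp: dec_def enc_def)

lemma inj_enc: "inj_on (enc N) S"
  by (metis dec_enc inj_onI)

text \<open>The cores for different \<open>N\<close> are so far apart that each box meets only its own core.\<close>

lemma box_core_unique:
  assumes "1 \<le> N" "1 \<le> M" "dec N p \<in> sbox N" "dec M p \<in> core M"
  shows "M = N"
proof -
  obtain x y where p: "p = (x, y)" by (metis prod.exhaust)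
  have N: "2 * N\<^sup>2 - N \<le> x" "x \<le> 2 * N\<^sup>2 + 2 * N"
    using assms(3) by (auto simp: p dec_def sbox_def)
  have M: "2 * M\<^sup>2 \<le> x" "x \<le> 2 * M\<^sup>2 + M"
    using assms(4) by (auto simp: p dec_def)
  have "\<not> N + 1 \<le> M"
  proof
    assume "N + 1 \<le> M"
    hence "(N + 1)\<^sup>2 \<le> M\<^sup>2" using assms by (intro power_mono) auto
    hence "2 * N\<^sup>2 + 4 * N + 2 \<le> 2 * M\<^sup>2" by (simp add: power2_eq_square algebra_simps)
    thus False using N M assms(1) by linarith
  qed
  moreover have "\<not> M + 1 \<le> N"
  proof
    assume "M + 1 \<le> N"
    hence "(M + 1)\<^sup>2 \<le> N\<^sup>2" using assms by (intro power_mono) auto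
    hence a: "2 * M\<^sup>2 + 4 * M + 2 \<le> 2 * N\<^sup>2" by (simp add: power2_eq_square algebra_simps)
    have "(M + 1) * N \<le> N * N" using \<open>M + 1 \<le> N\<close> assms by (intro mult_right_mono) auto
    moreover have "(M + 1) * (M + 1) \<le> (M + 1) * N" using \<open>M + 1 \<le> N\<close> assms by (intro mult_left_mono) auto
    \<comment> \<open>The difference of the values of \<open>2 n\<^sup>2 - n\<close> at N and at M +
      1, in factored form; \<open>2 N\<^sup>2 - N\<close> is the left end of the box.\<close>
    moreover have "0 \<le> (N - M - 1) * (2 * (N + M + 1) - 1)" using \<open>M + 1 \<le> N\<close> assms by simp
    ultimately have "2 * (M + 1)\<^sup>2 - (M + 1) \<le> 2 * N\<^sup>2 - N"
      by (simp add: power2_eq_square algebra_simps)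
    hence "2 * M\<^sup>2 + 3 * M + 1 \<le> 2 * N\<^sup>2 - N" by (simp add: power2_eq_square algebra_simps)
    thus False using N M assms by linarith
  qed
  ultimately show ?thesis by linarith
qed

section \<open>The direct sum of the models as a matrix over the lattice\<close>

definition in_block :: "int \<Rightarrow> int \<times> int \<Rightarrow> bool" where
  "in_block N p \<longleftrightarrow> 1 \<le> N \<and> dec N p \<in> core N"

definition block_of :: "int \<times> int \<Rightarrow> int" where
  "block_of p = (SOME N. in_block N p)"

definition model_matrix :: "int \<times> int \<Rightarrow> int \<times> int \<Rightarrow> complex" where
  "model_matrix p q = (if \<exists>N. in_block N p \<and> in_block N q
     then hmat (block_of p) 1 (dec (block_of p) p) (dec (block_of p) q)
     else if p = q then 1 else 0)"

lemma block_of: "in_block N p \<Longrightarrow> block_of p = N"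
proof -
  assume N: "in_block N p"
  hence M: "in_block (block_of p) p" unfolding block_of_def by (rule someI)
  show ?thesis
  proof (rule box_core_unique)
    show "dec N p \<in> sbox N" using N core_subset_sbox[of N] by (auto simp: in_block_def)
  qed (use N M in \<open>auto simp: in_block_def\<close>)
qed

lemma model_matrix_block: "in_block N p \<Longrightarrow> in_block N q \<Longrightarrow> model_matrix p q = hmat N 1 (dec N p) (dec N q)"
  using block_of[of N p] by (auto simp: model_matrix_def)

lemma model_matrix_outside: "\<nexists>N. in_block N p \<and> in_block N q \<Longrightarrow> model_matrix p q = (if p = q then 1 else 0)"
  unfolding model_matrix_def by (rule if_not_P)

lemma cnj_model_matrix: "cnj (model_matrix p q) = model_matrix q p"
proof (cases "\<exists>N. in_block N p \<and> in_block N q")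
  case True
  thus ?thesis by (auto simp: model_matrix_block cnj_hmat)
next
  case False
  hence "\<nexists>N. in_block N q \<and> in_block N p" by blast
  with False show ?thesis by (auto simp: model_matrix_outside)
qed

text \<open>The box meets no core but its own, so within it the lattice matrix looks like one model
  surrounded by the identity.\<close>

lemma model_matrix_enc:
  assumes N: "1 \<le> N" and s: "s \<in> sbox N" and t: "t \<in> sbox N"
  shows "model_matrix (enc N s) (enc N t) = Hf N 1 s t"
proof -
  have b: "in_block M (enc N r) \<longleftrightarrow> M = N \<and> r \<in> core N" if r: "r \<in> sbox N" for M r
  proof
    assume "in_block M (enc N r)"
    hence M: "1 \<le> M" "dec M (enc N r) \<in> core M" by (auto simp: in_block_def)
    hence "M = N" using box_core_unique[OF N M(1) _ M(2)] r by simp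
    thus "M = N \<and> r \<in> core N" using M by simp
  next
    assume "M = N \<and> r \<in> core N"
    thus "in_block M (enc N r)" using N by (simp add: in_block_def)
  qed
  show ?thesis
  proof (cases "s \<in> core N \<and> t \<in> core N")
    case True
    hence "model_matrix (enc N s) (enc N t) = hmat N 1 s t"
      using model_matrix_block[of N "enc N s" "enc N t"] b s t by simp
    thus ?thesis using True by (simp add: Hf_def)
  next
    case False
    have "model_matrix (enc N s) (enc N t) = (if enc N s = enc N t then 1 else 0)"
      by (rule model_matrix_outside) (use False b s t in blast)
    moreover have "enc N s = enc N t \<longleftrightarrow> s = t" by (metis dec_enc)
    ultimately show ?thesis unfolding Hf_def if_not_P[OF False] by simp
  qed
qed

lemma wt_le_1: "0 \<le> wt N k" "wt N k \<le> 1"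
proof -
  show "0 \<le> wt N k" by (simp add: wt_def)
  show "wt N k \<le> 1"
  proof (cases "1 \<le> k \<and> k \<le> N")
    case True
    hence "k * (N + 1 - k) \<le> (N + 1) * (N + 1)" by (intro mult_mono) auto
    hence "real_of_int (k * (N + 1 - k)) \<le> (real_of_int (N + 1))\<^sup>2"
      unfolding power2_eq_square of_int_mult[symmetric] of_int_le_iff .
    hence "sqrt (real_of_int (k * (N + 1 - k))) \<le> real_of_int (N + 1)"
      using True by (intro real_le_lsqrt) auto
    thus ?thesis using True by (simp add: wt_def)
  qed (auto simp: wt_def)
qed

lemma cmod_zmat: "cmod (zmat N k k') \<le> 1" and cmod_dmat: "cmod (dmat N k k') \<le> 1"
  and cmod_idmat: "cmod (idmat k k') \<le> 1"
  using wt_le_1[of N k] wt_le_1[of N "k + 1"] by (auto simp: zmat_def dmat_def idmat_def)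

lemma cmod_hmat: "cmod (hmat N 1 s t) \<le> 3"
proof -
  obtain k l a where s: "s = (k, l, a)" by (metis prod.exhaust)
  obtain k' l' b where t: "t = (k', l', b)" by (metis prod.exhaust)
  have m: "cmod (x * y) \<le> 1" if "cmod x \<le> 1" "cmod y \<le> 1" for x y
    using mult_mono[OF that] by (simp add: norm_mult)
  have 1: "cmod (zmat N k k' * idmat l l' + idmat k k' * zmat N l l' - idmat k k' * idmat l l') \<le> 1 + 1 + 1"
    by (rule order_trans[OF norm_triangle_ineq4] add_mono order_trans[OF norm_triangle_ineq] m cmod_zmat cmod_idmat)+
  have 2: "cmod (- \<i> * (dmat N k k' * idmat l l') + c * (idmat k k' * dmat N l l')) \<le> 1 + 1" if "cmod c \<le> 1" for c
    by (rule add_mono order_trans[OF norm_triangle_ineq] m cmod_dmat cmod_idmat that | simp)+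
  show ?thesis
  proof (cases "a = b")
    case True
    thus ?thesis using 1 by (simp add: hmat_def s t norm_mult)
  next
    case False
    hence e: "hmat N 1 s t = - \<i> * (dmat N k k' * idmat l l') + (if a then 1 else -1) * (idmat k k' * dmat N l l')"
      by (simp add: hmat_def s t)
    have "cmod (hmat N 1 s t) \<le> 1 + 1" unfolding e by (rule 2) simp
    thus ?thesis by simp
  qed
qed

lemma cmod_model_matrix: "cmod (model_matrix p q) \<le> 3"
  by (cases "\<exists>N. in_block N p \<and> in_block N q") (auto simp: model_matrix_block cmod_hmat model_matrix_outside)

lemma hmat_nonzero: "hmat N \<kappa> s t \<noteq> 0 \<Longrightarrow> near_sites 1 s t"
  by (cases s; cases t) (auto simp: hmat_def zmat_def dmat_def idmat_def near_sites_def split: if_splits)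

definition near_points :: "int \<Rightarrow> int \<times> int \<Rightarrow> int \<times> int \<Rightarrow> bool" where
  "near_points R p q \<longleftrightarrow> \<bar>fst p - fst q\<bar> \<le> R \<and> \<bar>snd p - snd q\<bar> \<le> R"

text \<open>The parity bit costs at most 1: 2 |l - l'| \<le> R + 1, which is at most 2 R once R
  \<ge> 1.\<close>

lemma near_sites_enc:
  assumes "1 \<le> R" "near_points R (enc N s) (enc N t)"
  shows "near_sites R s t"
  using assms by (cases s; cases t) (auto simp: near_points_def near_sites_def enc_def split: if_splits)

text \<open>The 3 is 2 * 1 + 1: the second coordinate is doubled and the parity bit adds at most
  1.\<close>

lemma near_points_enc:
  assumes "near_sites 1 s t"
  shows "near_points 3 (enc N s) (enc N t)"
  using assms by (cases s; cases t) (auto simp: near_points_def near_sites_def enc_def split: if_splits)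

lemma model_matrix_nonzero: "model_matrix p q \<noteq> 0 \<Longrightarrow> near_points 3 p q"
proof (cases "\<exists>N. in_block N p \<and> in_block N q")
  case True
  then obtain N where N: "in_block N p" "in_block N q" by blast
  assume "model_matrix p q \<noteq> 0"
  hence "near_sites 1 (dec N p) (dec N q)" using hmat_nonzero by (simp add: model_matrix_block[OF N])
  from near_points_enc[OF this, of N] show ?thesis by simp
next
  case False
  assume "model_matrix p q \<noteq> 0"
  hence "p = q" using model_matrix_outside[OF False] by (auto split: if_splits)
  thus ?thesis by (simp add: near_points_def)
qed

section \<open>Banded matrices on square-summable functions\<close>

lemma infsum_sum:
  fixes f :: "'a \<Rightarrow> 'b \<Rightarrow> complex"
  assumes "finite D" "\<And>d. d \<in> D \<Longrightarrow> f d summable_on A"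
  shows "(\<Sum>\<^sub>\<infinity>x\<in>A. \<Sum>d\<in>D. f d x) = (\<Sum>d\<in>D. \<Sum>\<^sub>\<infinity>x\<in>A. f d x)
    \<and> (\<lambda>x. \<Sum>d\<in>D. f d x) summable_on A"
  using assms
proof (induction D rule: finite_induct)
  case (insert d D)
  have "(\<lambda>x. \<Sum>d\<in>D. f d x) summable_on A" "f d summable_on A" using insert by auto
  thus ?case using insert by (simp add: infsum_add summable_on_add)
qed simp

lemma bij_translate: "bij (\<lambda>x. x + (c :: int \<times> int))"
  by (rule bij_betw_byWitness[where f' = "\<lambda>x. x - c"]) auto

lemma shifted_product_summable:
  fixes f g :: "(int \<times> int) ell2"
  assumes C: "\<And>x. cmod (c x) \<le> C"
  shows "(\<lambda>x. c x * cnj (ell2_apply f (x + d)) * ell2_apply g x) summable_on UNIV"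
proof (rule abs_summable_summable, rule summable_on_comparison_test)
  have "(\<lambda>x. (cmod (ell2_apply f (x + d)))\<^sup>2) summable_on UNIV"
    using summable_on_reindex_bij_betw[OF bij_translate[of d], of "\<lambda>x. (cmod (ell2_apply f x))\<^sup>2"] ell2_summable[of f]
    by simp
  thus "(\<lambda>x. C * ((cmod (ell2_apply f (x + d)))\<^sup>2 + (cmod (ell2_apply g x))\<^sup>2)) summable_on UNIV"
    by (intro summable_on_cmult_right summable_on_add ell2_summable)
  fix x
  have C0: "0 \<le> C" using C norm_ge_zero order_trans by blast
  have "cmod (ell2_apply f (x + d)) * cmod (ell2_apply g x)
      \<le> 2 * cmod (ell2_apply f (x + d)) * cmod (ell2_apply g x)" by simp
  also have "\<dots> \<le> (cmod (ell2_apply f (x + d)))\<^sup>2 + (cmod (ell2_apply g x))\<^sup>2"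
    by (rule sum_squares_bound)
  finally have "cmod (c x) * (cmod (ell2_apply f (x + d)) * cmod (ell2_apply g x))
      \<le> C * ((cmod (ell2_apply f (x + d)))\<^sup>2 + (cmod (ell2_apply g x))\<^sup>2)"
    using C C0 by (intro mult_mono) auto
  thus "norm (c x * cnj (ell2_apply f (x + d)) * ell2_apply g x)
      \<le> C * ((cmod (ell2_apply f (x + d)))\<^sup>2 + (cmod (ell2_apply g x))\<^sup>2)"
    by (simp add: norm_mult mult.assoc)
qed auto

lemma banded_row:
  fixes a :: "int \<times> int \<Rightarrow> int \<times> int \<Rightarrow> complex"
  assumes "\<And>x y. a x y \<noteq> 0 \<Longrightarrow> near_points R x y"
  shows "(\<Sum>\<^sub>\<infinity>y. a x y * f y) = (\<Sum>d\<in>{-R..R} \<times> {-R..R}. a x (x + d) * f (x + d))"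
proof -
  let ?D = "{-R..R} \<times> {-R..R}"
  have "(\<Sum>\<^sub>\<infinity>y. a x y * f y) = (\<Sum>\<^sub>\<infinity>y\<in>(+) x ` ?D. a x y * f y)"
  proof (rule infsum_cong_neutral)
    fix y assume y: "y \<in> UNIV - (+) x ` ?D"
    have "\<not> near_points R x y"
    proof
      assume "near_points R x y"
      hence "y - x \<in> ?D" by (cases x; cases y) (auto simp: near_points_def)
      hence "x + (y - x) \<in> (+) x ` ?D" by (rule imageI)
      thus False using y by simp
    qed
    thus "a x y * f y = 0" using assms[of x y] by auto
  qed auto
  also have "\<dots> = (\<Sum>y\<in>(+) x ` ?D. a x y * f y)" by simp
  also have "\<dots> = (\<Sum>d\<in>?D. a x (x + d) * f (x + d))"
    by (subst sum.reindex) (auto simp: inj_on_def)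
  finally show ?thesis .
qed

text \<open>Rows are written as finite sums over displacements \<open>d\<close>, so only a finite
  sum is exchanged with the series. For each \<open>d\<close> one translates the series by -d;
  renaming d to -d then yields the rows of the conjugate transpose.\<close>

lemma banded_adjoint:
  fixes a :: "int \<times> int \<Rightarrow> int \<times> int \<Rightarrow> complex"
  assumes C: "\<And>x y. cmod (a x y) \<le> C" and band: "\<And>x y. a x y \<noteq> 0 \<Longrightarrow> near_points R x y"
    and A: "has_matrix A a" and B: "has_matrix B (\<lambda>x y. cnj (a y x))"
  shows "cinner_ell2 (blinfun_apply A f) g = cinner_ell2 f (blinfun_apply B g)"
proof -
  let ?D = "{-R..R} \<times> {-R..R}"
  define F G where "F = ell2_apply f" and "G = ell2_apply g"
  have band': "cnj (a y x) \<noteq> 0 \<Longrightarrow> near_points R x y" for x y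
    using band[of y x] by (auto simp: near_points_def abs_minus_commute)
  have sm: "(\<lambda>x. cnj (a x (x + d)) * cnj (F (x + d)) * G x) summable_on UNIV" for d
    unfolding F_def G_def by (rule shifted_product_summable[of _ C]) (simp add: C)
  have sm': "(\<lambda>x. cnj (a (x - d) x) * cnj (F x) * G (x - d)) summable_on UNIV" for d
    using summable_on_reindex_bij_betw[OF bij_translate[of "-d"],
        of "\<lambda>x. cnj (a x (x + d)) * cnj (F (x + d)) * G x"] sm[of d] by simp
  have Af: "ell2_apply (blinfun_apply A f) x = (\<Sum>d\<in>?D. a x (x + d) * F (x + d))" for x
    using A[unfolded has_matrix_def, rule_format, of f x] banded_row[of a R x "ell2_apply f"] band
    by (simp add: F_def)
  have Bg: "ell2_apply (blinfun_apply B g) x = (\<Sum>d\<in>?D. cnj (a (x + d) x) * G (x + d))" for x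
    using B[unfolded has_matrix_def, rule_format, of g x]
      banded_row[of "\<lambda>x y. cnj (a y x)" R x "ell2_apply g"] band'
    by (simp add: G_def)
  have "cinner_ell2 (blinfun_apply A f) g
      = (\<Sum>\<^sub>\<infinity>x. \<Sum>d\<in>?D. cnj (a x (x + d)) * cnj (F (x + d)) * G x)"
    unfolding cinner_ell2_def Af by (simp add: G_def sum_distrib_right)
  also have "\<dots> = (\<Sum>d\<in>?D. \<Sum>\<^sub>\<infinity>x. cnj (a x (x + d)) * cnj (F (x + d)) * G x)"
    using infsum_sum[of ?D "\<lambda>d x. cnj (a x (x + d)) * cnj (F (x + d)) * G x" UNIV] sm by blast
  also have "\<dots> = (\<Sum>d\<in>?D. \<Sum>\<^sub>\<infinity>x. cnj (a (x - d) x) * cnj (F x) * G (x - d))"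
  proof (intro sum.cong refl)
    fix d
    show "(\<Sum>\<^sub>\<infinity>x. cnj (a x (x + d)) * cnj (F (x + d)) * G x)
        = (\<Sum>\<^sub>\<infinity>x. cnj (a (x - d) x) * cnj (F x) * G (x - d))"
      using infsum_reindex_bij_betw[OF bij_translate[of "-d"],
        of "\<lambda>x. cnj (a x (x + d)) * cnj (F (x + d)) * G x"] by simp
  qed
  also have "\<dots> = (\<Sum>\<^sub>\<infinity>x. \<Sum>d\<in>?D. cnj (a (x - d) x) * cnj (F x) * G (x - d))"
    using infsum_sum[of ?D "\<lambda>d x. cnj (a (x - d) x) * cnj (F x) * G (x - d)" UNIV] sm' by simp
  also have "\<dots> = (\<Sum>\<^sub>\<infinity>x. cnj (F x) * (\<Sum>d\<in>?D. cnj (a (x + d) x) * G (x + d)))"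
  proof (rule infsum_cong)
    fix x
    have "(\<Sum>d\<in>?D. cnj (a (x - d) x) * cnj (F x) * G (x - d))
        = (\<Sum>d\<in>?D. cnj (a (x + d) x) * cnj (F x) * G (x + d))"
      by (rule sum.reindex_bij_witness[of _ uminus uminus]) auto
    thus "(\<Sum>d\<in>?D. cnj (a (x - d) x) * cnj (F x) * G (x - d))
        = cnj (F x) * (\<Sum>d\<in>?D. cnj (a (x + d) x) * G (x + d))"
      by (simp add: sum_distrib_left mult_ac)
  qed
  also have "\<dots> = cinner_ell2 f (blinfun_apply B g)"
    unfolding cinner_ell2_def Bg by (simp add: F_def)
  finally show ?thesis .
qed

text \<open>By invariance d x y depends only on the displacement y - x, and by bounded geometry the
  balls around 0 are finite. So finite propagation allows finitely many displacements, whatever the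
  metric.\<close>

lemma finite_propagation_iff:
  fixes d :: "int \<times> int \<Rightarrow> int \<times> int \<Rightarrow> real"
  assumes "left_invariant d" and "bounded_geometry d"
  shows "finite_propagation d a \<longleftrightarrow> (\<exists>R. \<forall>x y. a x y \<noteq> 0 \<longrightarrow> near_points R x y)"
proof -
  have inv: "d x y = d 0 (y - x)" for x y
    using assms(1)[unfolded left_invariant_def, rule_format, of x 0 "y - x"] by simp
  show ?thesis
  proof
    assume "finite_propagation d a"
    then obtain r where r: "a x y \<noteq> 0 \<Longrightarrow> d x y \<le> r" for x y
      unfolding finite_propagation_def bdd_above_def by blast
    define B where "B = {z. d 0 z \<le> r}"
    have B: "finite B" using assms(2) unfolding bounded_geometry_def B_def by blast
    define R where "R = (\<Sum>z\<in>B. \<bar>fst z\<bar> + \<bar>snd z\<bar>)"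
    have "near_points R x y" if "a x y \<noteq> 0" for x y
    proof -
      have "y - x \<in> B" using r[OF that] inv by (simp add: B_def)
      hence "\<bar>fst (y - x)\<bar> + \<bar>snd (y - x)\<bar> \<le> R"
        unfolding R_def by (intro member_le_sum B) auto
      thus ?thesis unfolding near_points_def fst_diff snd_diff by linarith
    qed
    thus "\<exists>R. \<forall>x y. a x y \<noteq> 0 \<longrightarrow> near_points R x y" by blast
  next
    assume "\<exists>R. \<forall>x y. a x y \<noteq> 0 \<longrightarrow> near_points R x y"
    then obtain R where R: "a x y \<noteq> 0 \<Longrightarrow> near_points R x y" for x y by blast
    let ?D = "{-R..R} \<times> {-R..R}"
    have "{d x y | x y. a x y \<noteq> 0} \<subseteq> d 0 ` ?D"
    proof
      fix r assume "r \<in> {d x y | x y. a x y \<noteq> 0}"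
      then obtain x y where xy: "r = d x y" "a x y \<noteq> 0" by blast
      have "y - x \<in> ?D" using R[OF xy(2)] by (cases x; cases y) (auto simp: near_points_def)
      thus "r \<in> d 0 ` ?D" unfolding xy(1) inv[of x y] by (rule imageI)
    qed
    hence "finite {d x y | x y. a x y \<noteq> 0}" by (rule finite_subset) simp
    thus "finite_propagation d a" unfolding finite_propagation_def by (rule bdd_above_finite)
  qed
qed

lemma ell2_apply_diff: "ell2_apply (f - g) x = ell2_apply f x - ell2_apply g x"
  unfolding minus_ell2_def plus_ell2.rep_eq uminus_ell2.rep_eq by simp

section \<open>Passage between a box and the lattice\<close>

definition spread :: "int \<Rightarrow> (site \<Rightarrow> complex) \<Rightarrow> (int \<times> int) ell2" where
  "spread N u = Abs_ell2 (\<lambda>p. if dec N p \<in> sbox N then u (dec N p) else 0)"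

lemma box_image: "{p. dec N p \<in> sbox N} = enc N ` sbox N"
  by (auto intro: image_eqI[of _ _ "dec N _"])

lemma infsum_box:
  fixes F :: "int \<times> int \<Rightarrow> 'b :: {topological_comm_monoid_add, t2_space}"
  assumes "\<And>p. dec N p \<notin> sbox N \<Longrightarrow> F p = 0"
  shows "(\<Sum>\<^sub>\<infinity>p. F p) = (\<Sum>s\<in>sbox N. F (enc N s))" "F summable_on UNIV"
proof -
  have "(\<Sum>\<^sub>\<infinity>p. F p) = (\<Sum>\<^sub>\<infinity>p\<in>enc N ` sbox N. F p)"
    by (rule infsum_cong_neutral) (use assms in \<open>auto simp: box_image[symmetric]\<close>)
  also have "\<dots> = (\<Sum>s\<in>sbox N. F (enc N s))"
    by (simp add: sum.reindex[OF inj_enc])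
  finally show "(\<Sum>\<^sub>\<infinity>p. F p) = (\<Sum>s\<in>sbox N. F (enc N s))" .
  have "F summable_on enc N ` sbox N" by simp
  thus "F summable_on UNIV"
    by (rule summable_on_cong_neutral[THEN iffD1, rotated -1])
      (use assms in \<open>auto simp: box_image[symmetric]\<close>)
qed

lemma spread_apply: "ell2_apply (spread N u) p = (if dec N p \<in> sbox N then u (dec N p) else 0)"
proof -
  have "(\<lambda>p. (cmod (if dec N p \<in> sbox N then u (dec N p) else 0))\<^sup>2) summable_on UNIV"
    by (rule infsum_box(2)[of N]) simp
  thus ?thesis by (simp add: spread_def Abs_ell2_inverse)
qed

lemma norm_spread: "norm (spread N u) = nrm (sbox N) u"
proof -
  have "(\<Sum>\<^sub>\<infinity>p. (cmod (ell2_apply (spread N u) p))\<^sup>2) = (\<Sum>s\<in>sbox N. (cmod (ell2_apply (spread N u) (enc N s)))\<^sup>2)"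
    by (rule infsum_box(1)) (simp add: spread_apply)
  also have "\<dots> = (nrm (sbox N) u)\<^sup>2" by (simp add: spread_apply nrm_squared)
  finally show ?thesis by (simp add: norm_ell2)
qed

lemma nrm_restrict_le: "nrm (sbox N) (\<lambda>s. ell2_apply F (enc N s)) \<le> norm F"
proof -
  have "(nrm (sbox N) (\<lambda>s. ell2_apply F (enc N s)))\<^sup>2 = (\<Sum>p\<in>enc N ` sbox N. (cmod (ell2_apply F p))\<^sup>2)"
    by (simp add: nrm_squared sum.reindex[OF inj_enc])
  also have "\<dots> \<le> (\<Sum>\<^sub>\<infinity>p. (cmod (ell2_apply F p))\<^sup>2)"
    by (rule finite_sum_le_infsum) (auto simp: ell2_summable)
  also have "\<dots> = (norm F)\<^sup>2" by (simp add: norm_ell2 infsum_nonneg)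
  finally show ?thesis by (rule power2_le_imp_le) simp
qed

lemma nrm_restrict_eq:
  assumes "\<And>p. dec N p \<notin> sbox N \<Longrightarrow> ell2_apply F p = 0"
  shows "nrm (sbox N) (\<lambda>s. ell2_apply F (enc N s)) = norm F"
proof -
  have "(\<Sum>\<^sub>\<infinity>p. (cmod (ell2_apply F p))\<^sup>2) = (\<Sum>s\<in>sbox N. (cmod (ell2_apply F (enc N s)))\<^sup>2)"
    by (rule infsum_box(1)) (simp add: assms)
  also have "\<dots> = (nrm (sbox N) (\<lambda>s. ell2_apply F (enc N s)))\<^sup>2" by (simp add: nrm_squared)
  finally show ?thesis by (simp add: norm_ell2)
qed

lemma has_matrix_spread:
  assumes "has_matrix T a"
  shows "ell2_apply (blinfun_apply T (spread N u)) p = (\<Sum>t\<in>sbox N. a p (enc N t) * u t)"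
proof -
  have "ell2_apply (blinfun_apply T (spread N u)) p = (\<Sum>\<^sub>\<infinity>q. a p q * ell2_apply (spread N u) q)"
    using assms unfolding has_matrix_def by blast
  also have "\<dots> = (\<Sum>t\<in>sbox N. a p (enc N t) * ell2_apply (spread N u) (enc N t))"
    by (rule infsum_box(1)) (simp add: spread_apply)
  finally show ?thesis by (simp add: spread_apply)
qed

text \<open>The size \<open>N\<close> is chosen last, depending on the propagation \<open>R\<close>,
  the entry bound \<open>C\<close> and the gap \<open>g\<close>; the model matrix offers a box of
  that size.\<close>

lemma no_gapped_perturbation:
  assumes herm: "\<And>p q. cnj (b p q) = b q p" and band: "\<And>p q. b p q \<noteq> 0 \<Longrightarrow> near_points R p q"
    and C: "\<And>p q. cmod (b p q) \<le> C" and R: "1 \<le> R" and g: "0 < g"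
    and T: "has_matrix T b" and H: "has_matrix H model_matrix"
    and gap: "\<And>f. g * norm f \<le> norm (blinfun_apply T f)"
    and near: "\<And>f. norm (blinfun_apply T f - blinfun_apply H f) \<le> 1 / 2 * norm f"
  shows False
proof -
  \<comment> \<open>The largest value that \<open>box_gap\<close> permits.\<close>
  define \<mu> where "\<mu> = min g (1 / 2) / 4"
  have \<mu>: "0 < \<mu>" "4 * \<mu> \<le> g" "4 * \<mu> \<le> 1 / 2" using g by (auto simp: \<mu>_def)
  define K where "K = C * (4 * real_of_int R) * real (2 * (nat (2 * R + 1))\<^sup>2)"
  obtain m :: nat where m: "K / \<mu>\<^sup>2 < real m" using reals_Archimedean2 by blast
  define N where "N = int m + 4 + 2 * R"
  have N: "4 \<le> N" "2 * R \<le> N" "1 \<le> N" using R by (auto simp: N_def)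
  have "K / \<mu>\<^sup>2 < real_of_int N" using m R by (simp add: N_def)
  hence "K < \<mu>\<^sup>2 * real_of_int N" using \<mu> by (simp add: divide_less_eq mult.commute)
  hence "K / real_of_int N < \<mu>\<^sup>2" using N by (simp add: divide_less_eq)
  hence small: "C * (4 * real_of_int R / real_of_int N) * real (2 * (nat (2 * R + 1))\<^sup>2) < \<mu>\<^sup>2"
    by (simp add: K_def mult_ac)
  define b' where "b' s t = b (enc N s) (enc N t)" for s t
  have Tu: "ell2_apply (blinfun_apply T (spread N u)) (enc N s) = mv (sbox N) b' u s" for u s
    by (simp add: has_matrix_spread[OF T] mv_def b'_def)
  have Hu: "ell2_apply (blinfun_apply H (spread N u)) (enc N s) = mv (sbox N) (Hf N 1) u s" if "s \<in> sbox N" for u s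
    unfolding has_matrix_spread[OF H] mv_def by (intro sum.cong refl) (simp add: model_matrix_enc N that)
  have b'_near: "near_sites R s t" if "b' s t \<noteq> 0" for s t
    by (rule near_sites_enc[OF R band]) (use that in \<open>simp add: b'_def\<close>)
  show False
  proof (rule finite_obstruction[OF N(1,2) _ _ b'_near _ _ _ small \<mu>(2,3,1)])
    show "0 \<le> R" using R by simp
    show "cnj (b' s t) = b' t s" for s t by (simp add: b'_def herm)
    show "cmod (b' s t) \<le> C" for s t by (simp add: b'_def C)
  next
    fix u :: "site \<Rightarrow> complex"
    assume u: "\<And>s t. u s \<noteq> 0 \<Longrightarrow> near_sites R s t \<Longrightarrow> t \<in> sbox N"
    have "g * nrm (sbox N) u \<le> norm (blinfun_apply T (spread N u))"
      using gap[of "spread N u"] by (simp add: norm_spread)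
    \<comment> \<open>No mass leaves the box: a site within \<open>R\<close> of a point outside the
      box has \<open>u\<close> equal to 0 there.\<close>
    also have "\<dots> = nrm (sbox N) (\<lambda>s. ell2_apply (blinfun_apply T (spread N u)) (enc N s))"
    proof (rule nrm_restrict_eq[symmetric])
      fix p assume p: "dec N p \<notin> sbox N"
      have "b p (enc N t) * u t = 0" for t
      proof (rule ccontr)
        assume "b p (enc N t) * u t \<noteq> 0"
        hence "u t \<noteq> 0" "b' (dec N p) t \<noteq> 0" by (auto simp: b'_def)
        thus False using u[of t "dec N p"] b'_near[of "dec N p" t] near_sites_sym p by blast
      qed
      thus "ell2_apply (blinfun_apply T (spread N u)) p = 0"
        unfolding has_matrix_spread[OF T] by (rule sum.neutral[OF ballI])
    qed
    also have "\<dots> = nrm (sbox N) (mv (sbox N) b' u)" by (simp add: Tu)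
    finally show "g * nrm (sbox N) u \<le> nrm (sbox N) (mv (sbox N) b' u)" .
  next
    fix u :: "site \<Rightarrow> complex"
    have "nrm (sbox N) (\<lambda>s. mv (sbox N) b' u s - mv (sbox N) (Hf N 1) u s)
        = nrm (sbox N) (\<lambda>s. ell2_apply (blinfun_apply T (spread N u) - blinfun_apply H (spread N u)) (enc N s))"
      by (rule nrm_cong) (simp add: ell2_apply_diff Tu Hu)
    also have "\<dots> \<le> 1 / 2 * norm (spread N u)"
      by (rule order_trans[OF nrm_restrict_le near])
    finally show "nrm (sbox N) (\<lambda>s. mv (sbox N) b' u s - mv (sbox N) (Hf N 1) u s) \<le> 1 / 2 * nrm (sbox N) u"
      by (simp add: norm_spread)
  qed
qed

theorem theorem1p6:
  fixes d :: "int \<times> int \<Rightarrow> int \<times> int \<Rightarrow> real"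
  assumes "Metric_space UNIV d"
    and "left_invariant d"
    and "bounded_geometry d"
  shows "\<not> real_rank_zero (uniform_roe d)"
proof
  assume rr: "real_rank_zero (uniform_roe d)"
  have fp: "finite_propagation d a \<longleftrightarrow> (\<exists>R. \<forall>x y. a x y \<noteq> 0 \<longrightarrow> near_points R x y)" for a
    by (rule finite_propagation_iff[OF assms(2,3)])
  have ube: "uniformly_bounded_entries a \<longleftrightarrow> (\<exists>C. \<forall>x y. cmod (a x y) \<le> C)" for a :: "int \<times> int \<Rightarrow> int \<times> int \<Rightarrow> complex"
    unfolding uniformly_bounded_entries_def bounded_iff by blast
  have ube_model_matrix: "uniformly_bounded_entries model_matrix" unfolding ube using cmod_model_matrix by blast
  have fp_model_matrix: "finite_propagation d model_matrix" unfolding fp using model_matrix_nonzero by blast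
  obtain H where H: "has_matrix H model_matrix"
    using has_matrix_exists[OF assms(1,3) ube_model_matrix fp_model_matrix] by blast
  have Hm': "(\<lambda>x y. cnj (model_matrix y x)) = model_matrix" by (simp add: cnj_model_matrix fun_eq_iff)
  have "selfadjoint H"
    unfolding selfadjoint_def using banded_adjoint[OF cmod_model_matrix model_matrix_nonzero H, of H] H Hm' by simp
  moreover have "H \<in> uniform_roe d"
    unfolding uniform_roe_def algebraic_uniform_roe_def
    by (rule subsetD[OF closure_subset]) (use ube_model_matrix fp_model_matrix H in blast)
  ultimately have "H \<in> closure {T \<in> uniform_roe d. selfadjoint T \<and> invertible_in (uniform_roe d) T}"
    using rr unfolding real_rank_zero_def by blast
  then obtain T0 where T0: "T0 \<in> uniform_roe d" "selfadjoint T0" "invertible_in (uniform_roe d) T0"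
      and T0H: "dist T0 H < 1 / 8"
    unfolding closure_approachable by (metis (no_types, lifting) mem_Collect_eq zero_less_divide_1_iff zero_less_numeral)
  obtain S where S: "S o\<^sub>L T0 = id_blinfun" using T0(3) unfolding invertible_in_def by blast
  \<comment> \<open>The left inverse bounds \<open>T0\<close> from below; the added 1 avoids a
    separate case for \<open>S = 0\<close>.\<close>
  define g0 where "g0 = 1 / (1 + norm S)"
  have g0: "0 < g0" by (simp add: g0_def add_pos_nonneg)
  have T0_gap: "g0 * norm f \<le> norm (blinfun_apply T0 f)" for f
  proof -
    have "norm f = norm (blinfun_apply S (blinfun_apply T0 f))"
      using S by (metis blinfun_apply_blinfun_compose id_blinfun.rep_eq id_apply)
    also have "\<dots> \<le> norm S * norm (blinfun_apply T0 f)" by (rule norm_blinfun)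
    also have "\<dots> \<le> (1 + norm S) * norm (blinfun_apply T0 f)" by (intro mult_right_mono) auto
    finally show ?thesis by (simp add: g0_def divide_le_eq add_pos_nonneg mult.commute)
  qed
  \<comment> \<open>A perturbation by \<delta> keeps half of the gap \<open>g0\<close>, and together
    with the distance 1/8 of \<open>T0\<close> to \<open>H\<close> it stays within the admissible
    1/2.\<close>
  define \<delta> where "\<delta> = min (1 / 8) (g0 / 2)"
  have \<delta>: "0 < \<delta>" "\<delta> \<le> 1 / 8" "\<delta> \<le> g0 / 2" using g0 by (auto simp: \<delta>_def)
  obtain T1 where T1: "T1 \<in> algebraic_uniform_roe d" and T1T0: "dist T1 T0 < \<delta>"
    using T0(1) \<delta>(1) unfolding uniform_roe_def closure_approachable by blast
  obtain a where a: "uniformly_bounded_entries a" "finite_propagation d a" "has_matrix T1 a"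
    using T1 unfolding algebraic_uniform_roe_def by blast
  obtain C where C: "cmod (a x y) \<le> C" for x y using a(1) unfolding ube by blast
  obtain R0 where R0: "a x y \<noteq> 0 \<Longrightarrow> near_points R0 x y" for x y using a(2) unfolding fp by blast
  \<comment> \<open>The 1 is demanded by \<open>near_sites_enc\<close>.\<close>
  define R where "R = max 1 R0"
  have R: "a x y \<noteq> 0 \<Longrightarrow> near_points R x y" for x y
    using R0[of x y] by (auto simp: near_points_def R_def)
  have R': "cnj (a y x) \<noteq> 0 \<Longrightarrow> near_points R x y" for x y
    using R[of y x] by (auto simp: near_points_def abs_minus_commute)
  have "uniformly_bounded_entries (\<lambda>x y. cnj (a y x))"
    unfolding ube complex_mod_cnj using C by blast
  moreover have "finite_propagation d (\<lambda>x y. cnj (a y x))" unfolding fp using R' by blast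
  \<comment> \<open>\<open>T1\<close> need not be self-adjoint. The conjugate transpose of its
    matrix gives the adjoint \<open>T2\<close>, and the average of both is banded with a Hermitian
    matrix.\<close>
  ultimately obtain T2 where T2: "has_matrix T2 (\<lambda>x y. cnj (a y x))"
    using has_matrix_exists[OF assms(1,3)] by blast
  have T1_near: "norm (blinfun_apply T1 f - blinfun_apply T0 f) \<le> \<delta> * norm f" for f
  proof -
    have "norm (blinfun_apply (T1 - T0) f) \<le> norm (T1 - T0) * norm f" by (rule norm_blinfun)
    also have "\<dots> \<le> \<delta> * norm f" using T1T0 by (intro mult_right_mono) (auto simp: dist_norm)
    finally show ?thesis by (simp add: blinfun.diff_left)
  qed
  have T2_near: "norm (blinfun_apply T2 f - blinfun_apply T0 f) \<le> \<delta> * norm f" for f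
  proof -
    \<comment> \<open>Tested against the error \<open>h\<close> itself, \<open>T2\<close> and
      \<open>T0\<close> move to the other side as \<open>T1\<close> and \<open>T0\<close>; so
      \<open>T1_near\<close> carries over to the adjoint.\<close>
    define h where "h = blinfun_apply T2 f - blinfun_apply T0 f"
    have "cinner_ell2 (blinfun_apply T2 f) h = cinner_ell2 f (blinfun_apply T1 h)"
      by (rule banded_adjoint[where C = C, OF _ R' T2]) (simp_all add: C a(3))
    moreover have "cinner_ell2 (blinfun_apply T0 f) h = cinner_ell2 f (blinfun_apply T0 h)"
      using T0(2) unfolding selfadjoint_def by blast
    ultimately have e: "inner (blinfun_apply T2 f) h = inner f (blinfun_apply T1 h)"
        "inner (blinfun_apply T0 f) h = inner f (blinfun_apply T0 h)"
      by (simp_all only: inner_ell2_def)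
    have "inner h h = inner (blinfun_apply T2 f) h - inner (blinfun_apply T0 f) h"
      unfolding inner_diff_left[symmetric] h_def ..
    also have "\<dots> = inner f (blinfun_apply T1 h - blinfun_apply T0 h)"
      unfolding e inner_diff_right ..
    also have "\<dots> \<le> norm f * norm (blinfun_apply T1 h - blinfun_apply T0 h)" by (rule norm_cauchy_schwarz)
    also have "\<dots> \<le> norm f * (\<delta> * norm h)" by (intro mult_left_mono T1_near) simp
    finally have "norm h * norm h \<le> (\<delta> * norm f) * norm h"
      by (simp add: power2_norm_eq_inner[symmetric] power2_eq_square mult_ac)
    hence "norm h \<le> \<delta> * norm f"
      using \<delta>(1) by (cases "norm h = 0") (auto simp: mult_le_cancel_right)
    thus ?thesis by (simp add: h_def)
  qed
  define T where "T = (1 / 2) *\<^sub>R (T1 + T2)"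
  define b where "b x y = (a x y + cnj (a y x)) / 2" for x y
  have Tf: "blinfun_apply T f = (1 / 2) *\<^sub>R (blinfun_apply T1 f + blinfun_apply T2 f)" for f
    by (simp add: T_def blinfun.scaleR_left blinfun.add_left)
  have b_near: "near_points R x y" if "b x y \<noteq> 0" for x y
    using that R[where x = x and y = y] R'[where x = x and y = y]
    by (cases "a x y = 0") (auto simp: b_def)
  have T_b: "has_matrix T b"
    unfolding has_matrix_def
  proof (intro allI)
    fix f x
    have "ell2_apply (blinfun_apply T f) x
        = (ell2_apply (blinfun_apply T1 f) x + ell2_apply (blinfun_apply T2 f) x) / 2"
      by (simp add: Tf scaleR_ell2.rep_eq plus_ell2.rep_eq)
    also have "\<dots> = (\<Sum>\<^sub>\<infinity>y. b x y * ell2_apply f y)"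
    proof -
      have r: "ell2_apply (blinfun_apply T1 f) x = (\<Sum>d\<in>{-R..R} \<times> {-R..R}. a x (x + d) * ell2_apply f (x + d))"
        using a(3)[unfolded has_matrix_def, rule_format, of f x] banded_row[of a R x "ell2_apply f"] R by simp
      have r': "ell2_apply (blinfun_apply T2 f) x
          = (\<Sum>d\<in>{-R..R} \<times> {-R..R}. cnj (a (x + d) x) * ell2_apply f (x + d))"
        using T2[unfolded has_matrix_def, rule_format, of f x]
          banded_row[of "\<lambda>x y. cnj (a y x)" R x "ell2_apply f"] R' by simp
      have "(\<Sum>\<^sub>\<infinity>y. b x y * ell2_apply f y) = (\<Sum>d\<in>{-R..R} \<times> {-R..R}. b x (x + d) * ell2_apply f (x + d))"
        by (rule banded_row) (rule b_near)
      thus ?thesis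
        unfolding r r' b_def
        by (simp add: sum.distrib[symmetric] sum_divide_distrib algebra_simps add_divide_distrib)
    qed
    finally show "ell2_apply (blinfun_apply T f) x = (\<Sum>\<^sub>\<infinity>y. b x y * ell2_apply f y)" .
  qed
  have T_near: "norm (blinfun_apply T f - blinfun_apply T0 f) \<le> \<delta> * norm f" for f
  proof -
    have "blinfun_apply T f - blinfun_apply T0 f
        = (1 / 2) *\<^sub>R ((blinfun_apply T1 f - blinfun_apply T0 f) + (blinfun_apply T2 f - blinfun_apply T0 f))"
      unfolding Tf by (simp add: algebra_simps) (simp add: scaleR_add_left[symmetric] flip: add.assoc)
    also have "norm \<dots> \<le> (1 / 2) * (\<delta> * norm f + \<delta> * norm f)"
      unfolding norm_scaleR using norm_triangle_le[OF add_mono[OF T1_near[of f] T2_near[of f]]] by simp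
    finally show ?thesis by simp
  qed
  show False
  proof (rule no_gapped_perturbation[of b R C "g0 / 2" T H])
    show "cnj (b p q) = b q p" for p q by (simp add: b_def add.commute)
    show "cmod (b p q) \<le> C" for p q
    proof -
      have "cmod (a p q + cnj (a q p)) \<le> C + C"
        by (rule norm_triangle_le) (unfold complex_mod_cnj, intro add_mono C)
      thus ?thesis by (simp add: b_def norm_divide)
    qed
    show "g0 / 2 * norm f \<le> norm (blinfun_apply T f)" for f
    proof -
      have "norm (blinfun_apply T0 f) - norm (blinfun_apply T f) \<le> norm (blinfun_apply T f - blinfun_apply T0 f)"
        by (metis norm_minus_commute norm_triangle_ineq2)
      moreover have "\<delta> * norm f \<le> g0 / 2 * norm f" using \<delta>(3) by (intro mult_right_mono) auto
      ultimately show ?thesis using T0_gap[of f] T_near[of f] by (simp add: field_simps)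
    qed
    show "norm (blinfun_apply T f - blinfun_apply H f) \<le> 1 / 2 * norm f" for f
    proof -
      have "norm (blinfun_apply (T0 - H) f) \<le> norm (T0 - H) * norm f" by (rule norm_blinfun)
      also have "\<dots> \<le> 1 / 8 * norm f" using T0H by (intro mult_right_mono) (auto simp: dist_norm)
      finally have 1: "norm (blinfun_apply T0 f - blinfun_apply H f) \<le> 1 / 8 * norm f"
        by (simp add: blinfun.diff_left)
      have 2: "\<delta> * norm f \<le> 1 / 8 * norm f" using \<delta>(2) by (intro mult_right_mono) auto
      have "norm (blinfun_apply T f - blinfun_apply H f)
          \<le> norm (blinfun_apply T f - blinfun_apply T0 f) + norm (blinfun_apply T0 f - blinfun_apply H f)"
        using norm_triangle_ineq[of "blinfun_apply T f - blinfun_apply T0 f" "blinfun_apply T0 f - blinfun_apply H f"] by simp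
      thus ?thesis using 1 2 T_near[of f] norm_ge_zero[of f] by linarith
    qed
  qed (use b_near T_b H g0 in \<open>auto simp: R_def\<close>)
qed

end
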